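(* Suppose that for each prime $p$ we are given a subset $\Omega_p\subset \mathbb{Z}/p\mathbb{Z}$, and fix $\epsilon>0$. Assume that for each integer $k\ge 2$ there is a constant $C_k$ such that for every prime $p$ and every $\mathbf{h}=(h_1,\dots,h_{k-1})\in\mathbb{Z}^{k-1}$ for which $0,h_1,\dots,h_{k-1}$ are distinct modulo $p$, $$N_k(\mathbf{h},\Omega_p)=r_p^k\, p\,\bigl(1+E\bigr)\quad\text{with}\quad |E|\le C_k(1-r_p)p^{-\epsilon}.$$ Assume moreover that $s_p=p^{o(1)}$ as $p\to\infty$ (i.e. $\Omega_p\neq\emptyset$ and $\log s_p/\log p\to 0$). Then the spacings between elements of the sets $\Omega_q$, $q$ squarefree, become Poisson distributed as $s_q\to\infty$.
   Context: For a positive integer $q$ and a set $\Omega\subset\mathbb{Z}/q\mathbb{Z}$, and $\mathbf{h}=(h_1,\dots,h_{k-1})\in\mathbb{Z}^{k-1}$ with $h_0:=0$, put $N_k(\mathbf{h},\Omega)=\#\{t \bmod q:\ t+h_i\in\Omega \text{ for } 0\le i\le k-1\}$. Write $s_q=q/|\Omega_q|$ and $r_q=1/s_q$. For a squarefree positive integer $q$, $\Omega_q\subset\mathbb{Z}/q\mathbb{Z}$ is defined by the Chinese remainder theorem: $x\in\Omega_q$ iff $x \bmod p\in\Omega_p$ for every prime $p\mid q$. If $0\le x_1<x_2<\dots<x_m<q$ are representatives of the elements of $\Omega_q$, put $\Delta_j=(x_{j+1}-x_j)/s_q$ (indices modulo $m$, with $x_{m+1}=x_1+q$). For real $t_1,\dots,t_k\ge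 0$ let $\mathrm{Prob}_q(t_1,\dots,t_k)$ be the proportion of indices $j$ for which $\Delta_{j+i}>t_i$ for all $i=1,\dots,k$. The spacings of the $\Omega_q$ become Poisson distributed as $s_q\to\infty$ if for every $k\ge1$ and all $t_1,\dots,t_k\ge0$, $\mathrm{Prob}_q(t_1,\dots,t_k)\to e^{-(t_1+\dots+t_k)}$ along every sequence of squarefree $q$ with $s_q\to\infty$. *)

theory Defs
  imports Complex_Main "HOL-Computational_Algebra.Squarefree"
begin

text \<open>
  A subset of \<open>\<int>/q\<int>\<close> is represented by the set of its least non-negative residues,
  i.e. by a subset of \<open>{0..<int q}\<close>.
\<close>

definition inv_density :: "nat \<Rightarrow> int set \<Rightarrow> real" where
  "inv_density q A = real q / real (card A)"

definition density :: "nat \<Rightarrow> int set \<Rightarrow> real" where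
  "density q A = 1 / inv_density q A"

text \<open>
  The quantity \<open>N\<^sub>k(h, A)\<close> for \<open>A \<subseteq> \<int>/q\<int>\<close>. The tuple \<open>h = (h\<^sub>1, \<dots>, h\<^sub>k\<^sub>-\<^sub>1)\<close> is a list,
  so that \<open>k = length h + 1\<close>; the list \<open>0 # h\<close> supplies the convention \<open>h\<^sub>0 = 0\<close>.
\<close>

definition num_tuples :: "nat \<Rightarrow> int list \<Rightarrow> int set \<Rightarrow> nat" where
  "num_tuples q h A = card {t \<in> {0..<int q}. \<forall>a \<in> set (0 # h). (t + a) mod int q \<in> A}"

definition crt_set :: "(nat \<Rightarrow> int set) \<Rightarrow> nat \<Rightarrow> int set" where
  "crt_set \<Omega> q = {x \<in> {0..<int q}. \<forall>p. prime p \<and> p dvd q \<longrightarrow> x mod int p \<in> \<Omega> p}"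

text \<open>
  Elements and gaps are indexed by \<open>0, \<dots>, m - 1\<close> (\<open>m = card A\<close>) instead of \<open>1, \<dots>, m\<close>.
  The last gap wraps around to the smallest element plus \<open>q\<close>.
\<close>

definition spacing :: "nat \<Rightarrow> int set \<Rightarrow> nat \<Rightarrow> real" where
  "spacing q A j =
     (let x = sorted_list_of_set A;
          d = (if Suc j < card A then x ! Suc j - x ! j else x ! 0 + int q - x ! j)
      in real_of_int d / inv_density q A)"

definition Prob :: "nat \<Rightarrow> int set \<Rightarrow> nat \<Rightarrow> (nat \<Rightarrow> real) \<Rightarrow> real" where
  "Prob q A k t =
     real (card {j. j < card A \<and> (\<forall>i\<in>{1..k}. spacing q A ((j + i) mod card A) > t i)})
       / real (card A)"

definition spacings_become_poisson :: "(nat \<Rightarrow> int set) \<Rightarrow> bool" where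
  "spacings_become_poisson A \<longleftrightarrow>
     (\<forall>k\<ge>1. \<forall>t. (\<forall>i\<in>{1..k}. t i \<ge> 0) \<longrightarrow>
        (\<forall>Q :: nat \<Rightarrow> nat.
           (\<forall>n. squarefree (Q n)) \<longrightarrow>
           filterlim (\<lambda>n. inv_density (Q n) (A (Q n))) at_top sequentially \<longrightarrow>
           (\<lambda>n. Prob (Q n) (A (Q n)) k t) \<longlonglongrightarrow> exp (- (\<Sum>i=1..k. t i))))"

end

theory Submission imports Defs "HOL-Number_Theory.Cong" "HOL-Library.FuncSet" begin

text \<open>
  Write \<open>s\<close> for the inverse density of \<open>\<Omega>\<^sub>q\<close>. The count \<open>N\<^sub>k(h, \<Omega>\<^sub>q)\<close>, normalised to have mean 1 over
  \<open>h\<close>, is a product over \<open>p | q\<close> of factors \<open>1 + \<epsilon>\<^sub>p(h)\<close>. Expand the product over sets \<open>G\<close> of primes.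
  The \<open>G\<close> with \<open>\<Prod>G \<le> s powr (1/6)\<close> cancel when \<open>h\<close> runs over intervals of length comparable to \<open>s\<close>, since
  \<open>\<epsilon>\<^sub>p\<close> has mean 0 modulo \<open>p\<close>. The other \<open>G\<close> are negligible by Rankin's trick: \<open>\<epsilon>\<^sub>p(h)\<close> is small unless
  \<open>p\<close> divides a difference of entries of \<open>(0, h)\<close>, and on average over \<open>h\<close> such primes contribute a
  factor \<open>s powr o(1)\<close> only.

  Hence all factorial moments of the number of points in a union of intervals converge to those of
  a Poisson variable, and by Bonferroni's inequalities so do the void probabilities. On a grid of
  mesh \<open>s / M\<close> the occupied cells thus become independent, so the gaps between them become geometric.
  As \<open>M \<longlongrightarrow> \<infinity>\<close> this bounds from below the probability that the spacings lie in a given box; since the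
  bounds for disjoint boxes exhausting the space add up to 1, they are sharp.
\<close>

section \<open>Multiplicativity of the tuple counts\<close>

text \<open>The main obstacle is that \<open>q\<close> is not controlled by \<open>s\<close>: it may
  have many prime factors \<open>p\<close> with local inverse density close to 1, so no error may be
  measured in \<open>q\<close> or in the number of its primes. Hence the deviation bounds retain the
  factor \<open>1 - 1 / s p\<close>, which is at most \<open>ln (s p)\<close>: a product of factors
  \<open>1 + \<delta> * ln (s p)\<close> is at most \<open>s powr \<delta>\<close>.

  The two ranges of \<open>G\<close> want different sets of tuples. Cancellation needs the full
  product set of lists over \<open>U\<close>, whereas Rankin's trick needs distinct entries, since a
  zero difference is divisible by every prime. The lists with repetitions are therefore added and
  removed for small \<open>G\<close> only, where crude bounds suffice.

  Averages are taken over the points of the sieved set, not over all residues, because gaps start at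
  a point; the \<open>r\<close>-th factorial moment thus involves counts of \<open>r + 1\<close>
  points. As only lower bounds for boxes are sought, base points that see two points in one cell can
  simply be discarded.\<close>

lemma card_residues_prod_primes:
  fixes F :: "nat set" and R :: "nat \<Rightarrow> int \<Rightarrow> bool"
  assumes "finite F" "\<forall>p\<in>F. prime p"
  shows "card {t \<in> {0..<int (\<Prod>F)}. \<forall>p\<in>F. R p (t mod int p)}
           = (\<Prod>p\<in>F. card {t \<in> {0..<int p}. R p t})"
  using assms
proof (induction F rule: finite_induct)
  case empty
  have "{t::int. 0 \<le> t \<and> t < 1} = {0}" by auto
  then show ?case by (simp add: atLeastLessThan_def)
next
  case (insert p F)
  define Q where "Q = \<Prod>F"
  have pr: "prime p" and prF: "\<forall>r\<in>F. prime r" using insert.prems by auto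
  have Qpos: "Q > 0" using prF unfolding Q_def by (meson prod_pos prime_gt_0_nat)
  have ppos: "p > 0" using pr by (simp add: prime_gt_0_nat)
  have "coprime p Q"
    unfolding Q_def by (rule prod_coprime_right) (use insert pr prF in \<open>auto intro: primes_coprime\<close>)
  then have cop: "coprime (int p) (int Q)" by (simp only: coprime_int_iff)
  let ?S = "{t \<in> {0..<int (p * Q)}. \<forall>r\<in>insert p F. R r (t mod int r)}"
  let ?A = "{t \<in> {0..<int p}. R p t}"
  let ?B = "{t \<in> {0..<int Q}. \<forall>r\<in>F. R r (t mod int r)}"
  have PQ: "\<Prod>(insert p F) = p * Q" using insert by (simp add: Q_def)
  have modmod: "(t mod int Q) mod int r = t mod int r" if "r \<in> F" for t r
    by (rule mod_mod_cancel) (use that insert(1) in \<open>simp add: dvd_prodI[where f = "\<lambda>x. x"] Q_def del: of_nat_prod\<close>)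
  have "bij_betw (\<lambda>t. (t mod int p, t mod int Q)) ?S (?A \<times> ?B)"
    unfolding bij_betw_def
  proof
    show "inj_on (\<lambda>t. (t mod int p, t mod int Q)) ?S"
    proof (rule inj_onI)
      fix x y assume x: "x \<in> ?S" and y: "y \<in> ?S"
        and "(x mod int p, x mod int Q) = (y mod int p, y mod int Q)"
      then have "[x = y] (mod int p)" "[x = y] (mod int Q)" by (auto simp: cong_def)
      then have "[x = y] (mod int p * int Q)" using cop by (rule coprime_cong_mult)
      then have "x mod int (p * Q) = y mod int (p * Q)" by (simp add: cong_def)
      then show "x = y" using x y PQ by simp
    qed
    show "(\<lambda>t. (t mod int p, t mod int Q)) ` ?S = ?A \<times> ?B"
    proof (intro equalityI subsetI)
      fix z assume "z \<in> (\<lambda>t. (t mod int p, t mod int Q)) ` ?S"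
      then show "z \<in> ?A \<times> ?B" using ppos Qpos modmod by auto
    next
      fix z assume z: "z \<in> ?A \<times> ?B"
      then obtain a b where ab: "z = (a, b)" "a \<in> ?A" "b \<in> ?B" by auto
      obtain x where x: "[x = a] (mod int p)" "[x = b] (mod int Q)"
        using binary_chinese_remainder_int[OF cop] by blast
      let ?t = "x mod int (p * Q)"
      have "?t mod int p = x mod int p" "?t mod int Q = x mod int Q"
        by (rule mod_mod_cancel, simp)+
      moreover have "x mod int p = a" "x mod int Q = b" using x ab unfolding cong_def by auto
      ultimately have 1: "?t mod int p = a" and 2: "?t mod int Q = b" by simp_all
      have 3: "?t mod int r = b mod int r" if "r \<in> F" for r
        using modmod[OF that, of ?t] 2 by simp
      have "?t \<in> ?S" using 1 3 ab ppos Qpos PQ by auto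
      then show "z \<in> (\<lambda>t. (t mod int p, t mod int Q)) ` ?S"
        using 1 2 ab(1) by (intro image_eqI[of _ _ ?t]) auto
    qed
  qed
  then have "card ?S = card ?A * card ?B"
    by (simp add: bij_betw_same_card card_cartesian_product)
  then show ?case unfolding PQ using insert.IH[OF prF] insert(1,2) by (simp add: Q_def)
qed

lemma prime_dvd_prod_primes_iff:
  fixes F :: "nat set"
  assumes "finite F" "\<forall>p\<in>F. prime p" "prime p"
  shows "p dvd \<Prod>F \<longleftrightarrow> p \<in> F"
  using assms by (metis dvd_prodI prime_dvd_prod_iff primes_dvd_imp_eq)

text \<open>For a fixed prime the conditions on all shifts depend only on
  \<open>t mod int p\<close>, so the Chinese remainder theorem turns the conjunction over primes
  into a product of counts. The empty list gives the cardinality of \<open>crt_set\<close>.\<close>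

lemma num_tuples_crt_set:
  assumes "finite F" "\<forall>p\<in>F. prime p"
  shows "num_tuples (\<Prod>F) h (crt_set \<Omega> (\<Prod>F)) = (\<Prod>p\<in>F. num_tuples p h (\<Omega> p))"
proof -
  have Qpos: "\<Prod>F > 0" using assms by (meson prod_pos prime_gt_0_nat)
  have "{t \<in> {0..<int (\<Prod>F)}. \<forall>a\<in>set (0 # h). (t + a) mod int (\<Prod>F) \<in> crt_set \<Omega> (\<Prod>F)}
     = {t \<in> {0..<int (\<Prod>F)}. \<forall>p\<in>F. \<forall>a\<in>set (0 # h). (t mod int p + a) mod int p \<in> \<Omega> p}"
  proof (intro Collect_cong conj_cong refl)
    fix t assume "t \<in> {0..<int (\<Prod>F)}"
    have *: "(x mod int (\<Prod>F)) mod int p = x mod int p" if "p \<in> F" for p x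
      by (rule mod_mod_cancel) (use that assms(1) in \<open>simp add: dvd_prodI[where f = "\<lambda>x. x"] del: of_nat_prod\<close>)
    have "x mod int (\<Prod>F) \<in> crt_set \<Omega> (\<Prod>F) \<longleftrightarrow> (\<forall>p\<in>F. x mod int p \<in> \<Omega> p)" for x
    proof -
      have "x mod int (\<Prod>F) \<in> {0..<int (\<Prod>F)}"
        using Qpos by (simp del: of_nat_prod)
      then have "x mod int (\<Prod>F) \<in> crt_set \<Omega> (\<Prod>F) \<longleftrightarrow>
          (\<forall>p. prime p \<and> p dvd \<Prod>F \<longrightarrow> x mod int (\<Prod>F) mod int p \<in> \<Omega> p)"
        unfolding crt_set_def by (simp only: mem_Collect_eq simp_thms)
      also have "\<dots> \<longleftrightarrow> (\<forall>p\<in>F. x mod int (\<Prod>F) mod int p \<in> \<Omega> p)"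
        using prime_dvd_prod_primes_iff[OF assms] assms(2) by blast
      also have "\<dots> \<longleftrightarrow> (\<forall>p\<in>F. x mod int p \<in> \<Omega> p)"
        using * by (simp only: cong: ball_cong)
      finally show ?thesis .
    qed
    then show "(\<forall>a\<in>set (0 # h). (t + a) mod int (\<Prod>F) \<in> crt_set \<Omega> (\<Prod>F))
      = (\<forall>p\<in>F. \<forall>a\<in>set (0 # h). (t mod int p + a) mod int p \<in> \<Omega> p)"
      by (auto simp: mod_simps simp del: of_nat_prod)
  qed
  then show ?thesis unfolding num_tuples_def
    using card_residues_prod_primes[OF assms, of "\<lambda>p t. \<forall>a\<in>set (0 # h). (t + a) mod int p \<in> \<Omega> p"]
    by presburger
qed

lemma num_tuples_Nil:
  assumes "A \<subseteq> {0..<int q}"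
  shows "num_tuples q [] A = card A"
proof -
  have "{t \<in> {0..<int q}. \<forall>a\<in>set [0]. (t + a) mod int q \<in> A} = A"
    using assms by auto
  then show ?thesis unfolding num_tuples_def by simp
qed

lemma crt_set_subset: "crt_set \<Omega> q \<subseteq> {0..<int q}"
  by (auto simp: crt_set_def)

lemma card_crt_set:
  assumes "finite F" "\<forall>p\<in>F. prime p" "\<forall>p\<in>F. \<Omega> p \<subseteq> {0..<int p}"
  shows "card (crt_set \<Omega> (\<Prod>F)) = (\<Prod>p\<in>F. card (\<Omega> p))"
  using num_tuples_crt_set[OF assms(1,2), of "[]" \<Omega>] assms(3)
  by (simp add: num_tuples_Nil crt_set_subset del: of_nat_prod)

lemma inv_density_crt_set:
  assumes "finite F" "\<forall>p\<in>F. prime p" "\<forall>p\<in>F. \<Omega> p \<subseteq> {0..<int p}"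
  shows "inv_density (\<Prod>F) (crt_set \<Omega> (\<Prod>F)) = (\<Prod>p\<in>F. inv_density p (\<Omega> p))"
  using card_crt_set[OF assms] by (simp add: inv_density_def prod_dividef)

lemma squarefree_prod_prime_factors:
  assumes "squarefree (q::nat)"
  shows "\<Prod>(prime_factors q) = q"
proof -
  have q: "q > 0" using assms by (metis not_squarefree_0 gr0I)
  have "q = (\<Prod>p\<in>prime_factors q. p ^ multiplicity p q)"
    using prime_factorization_nat q by blast
  also have "\<dots> = \<Prod>(prime_factors q)"
    using assms q by (intro prod.cong) (auto simp: squarefree_factorial_semiring')
  finally show ?thesis by simp
qed

text \<open>The number of tuples, normalised to have mean value 1 over \<open>h\<close>.\<close>
definition ncount :: "nat \<Rightarrow> int list \<Rightarrow> int set \<Rightarrow> real" where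
  "ncount q h A = real (num_tuples q h A) * inv_density q A ^ Suc (length h) / real q"

lemma ncount_crt_set:
  assumes "finite F" "\<forall>p\<in>F. prime p" "\<forall>p\<in>F. \<Omega> p \<subseteq> {0..<int p}"
  shows "ncount (\<Prod>F) h (crt_set \<Omega> (\<Prod>F)) = (\<Prod>p\<in>F. ncount p h (\<Omega> p))"
  unfolding ncount_def
  using num_tuples_crt_set[OF assms(1,2), of h \<Omega>] inv_density_crt_set[OF assms]
  by (simp only: of_nat_prod prod.distrib prod_dividef prod_power_distrib)

lemma inv_density_ge_1:
  assumes "A \<subseteq> {0..<int q}" "A \<noteq> {}"
  shows "inv_density q A \<ge> 1"
proof -
  have "card A \<le> q" using card_mono[OF _ assms(1)] by simp
  moreover have "card A > 0" using assms finite_subset by (fastforce simp: card_gt_0_iff)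
  ultimately show ?thesis by (simp add: inv_density_def)
qed

lemma one_minus_mult_le_power:
  fixes r :: real assumes "0 \<le> r" "r \<le> 1"
  shows "1 - real n * (1 - r) \<le> r ^ n"
  using Bernoulli_inequality[of "r - 1" n] assms by (simp add: algebra_simps)

text \<open>With \<open>k = Suc (length h)\<close> and \<open>r\<close> the density, the proportion
  of good \<open>t\<close> lies between \<open>1 - k * (1 - r)\<close>, by a union bound over the
  shifts, and 1; Bernoulli's inequality puts \<open>r ^ k\<close> into the same interval. Nothing is
  assumed about \<open>h\<close>, so this serves the primes at which entries of \<open>0 # h\<close>
  collide.\<close>

lemma ncount_deviation:
  assumes A: "A \<subseteq> {0..<int q}" "A \<noteq> {}"
  shows "\<bar>ncount q h A - 1\<bar>
    \<le> real (Suc (length h)) * (1 - 1 / inv_density q A) * inv_density q A ^ Suc (length h)"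
proof -
  define k where "k = Suc (length h)"
  define s where "s = inv_density q A"
  have s1: "s \<ge> 1" using inv_density_ge_1[OF A] by (simp add: s_def)
  have finA: "finite A" using A finite_subset by blast
  have cA: "card A > 0" using A finA by (simp add: card_gt_0_iff)
  have q: "q > 0" using A by (cases "q = 0") auto
  have r: "1 / s = card A / q" by (simp add: s_def inv_density_def)
  let ?T = "{t \<in> {0..<int q}. \<forall>a\<in>set (0 # h). (t + a) mod int q \<in> A}"
  let ?B = "\<lambda>a. {t \<in> {0..<int q}. (t + a) mod int q \<notin> A}"
  have cB: "card (?B a) \<le> q - card A" for a
  proof -
    have "inj_on (\<lambda>t. (t + a) mod int q) (?B a)"
    proof (rule inj_onI)
      fix x y assume xy: "x \<in> ?B a" "y \<in> ?B a" "(x + a) mod int q = (y + a) mod int q"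
      then have "[x + a = y + a] (mod int q)" by (simp add: cong_def)
      then have "[x = y] (mod int q)" by (simp add: cong_add_rcancel)
      then show "x = y" using xy by (simp add: cong_def)
    qed
    then have "card (?B a) = card ((\<lambda>t. (t + a) mod int q) ` ?B a)" by (simp add: card_image)
    also have "\<dots> \<le> card ({0..<int q} - A)"
      by (rule card_mono) (use q in auto)
    also have "\<dots> = q - card A" using A finA by (simp add: card_Diff_subset)
    finally show ?thesis .
  qed
  have "{0..<int q} - ?T \<subseteq> (\<Union>a\<in>set (0 # h). ?B a)" by auto
  then have "card ({0..<int q} - ?T) \<le> card (\<Union>a\<in>set (0 # h). ?B a)"
    by (intro card_mono finite_UN_I) (auto intro: finite_subset[of _ "{0..<int q}"])
  also have "\<dots> \<le> (\<Sum>a\<in>set (0 # h). card (?B a))" by (rule card_UN_le) simp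
  also have "\<dots> \<le> (\<Sum>a\<in>set (0 # h). q - card A)" by (intro sum_mono cB)
  also have "\<dots> = card (set (0 # h)) * (q - card A)" by simp
  also have "\<dots> \<le> k * (q - card A)"
    using card_length[of "0 # h"] by (intro mult_right_mono) (auto simp: k_def)
  finally have "card ({0..<int q} - ?T) \<le> k * (q - card A)" .
  moreover have "card ({0..<int q} - ?T) = q - card ?T"
    by (subst card_Diff_subset) (auto intro: finite_subset[of _ "{0..<int q}"])
  moreover have cTq: "card ?T \<le> q" using card_mono[of "{0..<int q}" ?T] by fastforce
  moreover have cAq: "card A \<le> q" using card_mono[OF _ A(1)] by simp
  ultimately have "q - card ?T \<le> k * (q - card A)" by simp
  then have "real (q - card ?T) \<le> real (k * (q - card A))" by (simp only: of_nat_le_iff)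
  then have "real q - real (card ?T) \<le> real k * (real q - real (card A))"
    using cTq cAq by (simp only: of_nat_diff of_nat_mult)
  then have "(real q - real (card ?T)) / q \<le> real k * (real q - real (card A)) / q"
    by (rule divide_right_mono) simp
  then have low: "1 - real k * (1 - 1/s) \<le> card ?T / q"
    unfolding r using q by (simp only: diff_divide_distrib right_diff_distrib) simp
  have up: "card ?T / q \<le> 1" using cTq q by simp
  have rk: "1 - real k * (1 - 1/s) \<le> (1/s)^k"
    by (rule one_minus_mult_le_power) (use s1 in auto)
  have rk1: "(1/s)^k \<le> 1" using s1 by (intro power_le_one) auto
  have "\<bar>card ?T / q - (1/s)^k\<bar> \<le> real k * (1 - 1/s)" using low up rk rk1 by linarith
  then have "\<bar>card ?T / q - (1/s)^k\<bar> * s^k \<le> real k * (1 - 1/s) * s^k"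
    using s1 by (intro mult_right_mono) auto
  moreover have "\<bar>card ?T / q - (1/s)^k\<bar> * s^k = \<bar>(card ?T / q - (1/s)^k) * s^k\<bar>"
    using s1 by (simp add: abs_mult)
  moreover have "(card ?T / q - (1/s)^k) * s^k = ncount q h A - 1"
    using s1 by (simp add: ncount_def num_tuples_def k_def s_def[symmetric] power_divide field_simps)
  ultimately show ?thesis by (simp add: k_def s_def)
qed

section \<open>Moments of hit counts by double counting\<close>

lemma card_filter_eq_sum:
  assumes "finite A"
  shows "card {x\<in>A. P x} = (\<Sum>x\<in>A. if P x then 1 else 0)"
  using sum.inter_filter[OF assms, of "\<lambda>_. 1::nat" P] by simp

lemma sum_card_swap:
  assumes "finite A" "finite B"
  shows "(\<Sum>x\<in>A. card {y\<in>B. P x y}) = (\<Sum>y\<in>B. card {x\<in>A. P x y})"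
  unfolding card_filter_eq_sum[OF assms(1)] card_filter_eq_sum[OF assms(2)] by (rule sum.swap)

lemma finite_lists_of_length:
  "finite U \<Longrightarrow> finite {h. length h = r \<and> set h \<subseteq> U}"
  using finite_lists_length_eq[of U r] by (simp add: conj_commute)

lemma num_tuples_eq:
  assumes "A \<subseteq> {0..<int q}"
  shows "num_tuples q h A = card {t \<in> A. \<forall>a\<in>set h. (t + a) mod int q \<in> A}"
proof -
  have "{t \<in> {0..<int q}. \<forall>a \<in> set (0 # h). (t + a) mod int q \<in> A}
    = {t \<in> A. \<forall>a\<in>set h. (t + a) mod int q \<in> A}"
    using assms by auto
  then show ?thesis by (simp add: num_tuples_def)
qed

text \<open>Double counting of pairs \<open>(t, h)\<close>: for fixed \<open>t\<close> the
  admissible lists are all lists over the set of shifts that hit \<open>A\<close>, which gives a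
  plain power moment.\<close>

lemma sum_num_tuples_lists:
  assumes A: "A \<subseteq> {0..<int q}" and U: "finite U"
  shows "(\<Sum>h\<in>{h. length h = r \<and> set h \<subseteq> U}. num_tuples q h A)
    = (\<Sum>t\<in>A. card {u\<in>U. (t + u) mod int q \<in> A} ^ r)"
proof -
  have finA: "finite A" using A finite_subset by blast
  have "(\<Sum>h\<in>{h. length h = r \<and> set h \<subseteq> U}. num_tuples q h A)
    = (\<Sum>t\<in>A. card {h \<in> {h. length h = r \<and> set h \<subseteq> U}. \<forall>a\<in>set h. (t + a) mod int q \<in> A})"
    unfolding num_tuples_eq[OF A] by (rule sum_card_swap) (use finA U finite_lists_of_length in auto)
  also have "\<dots> = (\<Sum>t\<in>A. card {u\<in>U. (t + u) mod int q \<in> A} ^ r)"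
  proof (rule sum.cong[OF refl])
    fix t
    have "{h \<in> {h. length h = r \<and> set h \<subseteq> U}. \<forall>a\<in>set h. (t + a) mod int q \<in> A}
      = {h. set h \<subseteq> {u\<in>U. (t + u) mod int q \<in> A} \<and> length h = r}" by auto
    then show "card {h \<in> {h. length h = r \<and> set h \<subseteq> U}. \<forall>a\<in>set h. (t + a) mod int q \<in> A}
      = card {u\<in>U. (t + u) mod int q \<in> A} ^ r"
      using card_lists_length_eq[of "{u\<in>U. (t + u) mod int q \<in> A}" r] U by simp
  qed
  finally show ?thesis .
qed

lemma card_distinct_lists:
  assumes "finite X"
  shows "card {h. length h = r \<and> distinct h \<and> set h \<subseteq> X} = fact r * (card X choose r)"
proof (cases "r \<le> card X")
  case True
  have "card {h. length h = r \<and> distinct h \<and> set h \<subseteq> X} = \<Prod>{card X - r + 1 .. card X}"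
    by (rule card_lists_distinct_length_eq[OF assms True])
  also have "\<dots> = fact (card X) div fact (card X - r)"
    using fact_div_fact[of "card X - r" "card X"] by simp
  also have "\<dots> = fact r * (card X choose r)"
  proof -
    have "fact r * fact (card X - r) * (card X choose r) = (fact (card X) :: nat)"
      by (rule binomial_fact_lemma[OF True])
    then have "fact r * (card X choose r) * fact (card X - r) = (fact (card X) :: nat)"
      by (simp only: mult_ac)
    then show ?thesis by (metis nonzero_mult_div_cancel_right fact_nonzero)
  qed
  finally show ?thesis .
next
  case False
  have "length h \<le> card X" if "distinct h" "set h \<subseteq> X" for h
    using card_mono[OF assms that(2)] distinct_card[OF that(1)] by simp
  then have "{h. length h = r \<and> distinct h \<and> set h \<subseteq> X} = {}" using False by blast
  then show ?thesis using False by (simp only: card.empty) simp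
qed

text \<open>Distinct entries turn the power moment into a factorial moment, the form in which
  Bonferroni's inequalities consume it.\<close>

lemma sum_num_tuples_distinct_lists:
  assumes A: "A \<subseteq> {0..<int q}" and U: "finite U"
  shows "(\<Sum>h\<in>{h. length h = r \<and> distinct h \<and> set h \<subseteq> U}. num_tuples q h A)
    = fact r * (\<Sum>t\<in>A. card {u\<in>U. (t + u) mod int q \<in> A} choose r)"
proof -
  have finA: "finite A" using A finite_subset by blast
  have fin: "finite {h. length h = r \<and> distinct h \<and> set h \<subseteq> U}"
    by (rule finite_subset[OF _ finite_lists_of_length[OF U, of r]]) auto
  have "(\<Sum>h\<in>{h. length h = r \<and> distinct h \<and> set h \<subseteq> U}. num_tuples q h A)
    = (\<Sum>t\<in>A. card {h \<in> {h. length h = r \<and> distinct h \<and> set h \<subseteq> U}. \<forall>a\<in>set h. (t + a) mod int q \<in> A})"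
    unfolding num_tuples_eq[OF A] by (rule sum_card_swap) (use finA fin in auto)
  also have "\<dots> = (\<Sum>t\<in>A. fact r * (card {u\<in>U. (t + u) mod int q \<in> A} choose r))"
  proof (rule sum.cong[OF refl])
    fix t
    have "{h \<in> {h. length h = r \<and> distinct h \<and> set h \<subseteq> U}. \<forall>a\<in>set h. (t + a) mod int q \<in> A}
      = {h. length h = r \<and> distinct h \<and> set h \<subseteq> {u\<in>U. (t + u) mod int q \<in> A}}" by auto
    then show "card {h \<in> {h. length h = r \<and> distinct h \<and> set h \<subseteq> U}. \<forall>a\<in>set h. (t + a) mod int q \<in> A}
      = fact r * (card {u\<in>U. (t + u) mod int q \<in> A} choose r)"
      using card_distinct_lists[of "{u\<in>U. (t + u) mod int q \<in> A}" r] U by simp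
  qed
  finally show ?thesis by (simp add: sum_distrib_left)
qed

section \<open>Elementary sums over tuples, divisors and primes\<close>

text \<open>A list is determined by its entries other than the \<open>i\<close>-th together with the
  difference: as \<open>j \<le> i\<close>, the subtracted entry of \<open>0 # h\<close> is 0 or lies
  in \<open>take i h\<close>, so \<open>h ! i\<close> can be recovered. Fixing a difference thus
  costs one free entry.\<close>

lemma sum_lists_difference_le:
  fixes y :: "int \<Rightarrow> real" and U :: "int set"
  assumes U: "U \<subseteq> {1..int H}" and ij: "i < r" "j \<le> i" and y: "\<And>n. y n \<ge> 0"
  shows "(\<Sum>h\<in>{h. length h = r \<and> set h \<subseteq> U}. y ((0 # h) ! Suc i - (0 # h) ! j))
    \<le> real (card U) ^ (r - 1) * (\<Sum>n\<in>{- int H..int H}. y n)"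
proof -
  have finU: "finite U" using U finite_subset by blast
  let ?L = "{h. length h = r \<and> set h \<subseteq> U}"
  let ?L' = "{h. length h = r - 1 \<and> set h \<subseteq> U}"
  define f where "f h = (take i h @ drop (Suc i) h, (0 # h) ! Suc i - (0 # h) ! j)" for h :: "int list"
  have inj: "inj_on f ?L"
  proof (rule inj_onI)
    fix h h' assume h: "h \<in> ?L" "h' \<in> ?L" and e: "f h = f h'"
    then have t: "take i h = take i h'" and d: "drop (Suc i) h = drop (Suc i) h'"
      and n: "h ! i - (0 # h) ! j = h' ! i - (0 # h') ! j"
      using ij by (auto simp: f_def)
    have "(0 # h) ! j = (0 # h') ! j"
    proof (cases j)
      case (Suc j')
      then have "h ! j' = take i h ! j'" "h' ! j' = take i h' ! j'" using ij by auto
      then show ?thesis using t Suc by simp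
    qed simp
    then have "h ! i = h' ! i" using n by simp
    then show "h = h'" using t d h ij by (metis (mono_tags, lifting) id_take_nth_drop mem_Collect_eq)
  qed
  have img: "f ` ?L \<subseteq> ?L' \<times> {- int H..int H}"
  proof
    fix z assume "z \<in> f ` ?L"
    then obtain h where h: "length h = r" "set h \<subseteq> U" "z = f h" by auto
    have 1: "set (take i h @ drop (Suc i) h) \<subseteq> U"
      using h by (auto dest: in_set_takeD in_set_dropD)
    have 2: "length (take i h @ drop (Suc i) h) = r - 1" using h ij by simp
    have "h ! i \<in> U" using h ij nth_mem by blast
    then have 3: "h ! i \<in> {1..int H}" using U by blast
    have "(0 # h) ! j \<in> set (0 # h)" using h ij by (intro nth_mem) auto
    then have "(0 # h) ! j \<in> insert 0 {1..int H}" using h U by auto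
    then have "(0 # h) ! Suc i - (0 # h) ! j \<in> {- int H..int H}" using 3 by auto
    then show "z \<in> ?L' \<times> {- int H..int H}" using 1 2 h by (simp add: f_def)
  qed
  have "(\<Sum>h\<in>?L. y ((0 # h) ! Suc i - (0 # h) ! j)) = (\<Sum>h\<in>?L. y (snd (f h)))"
    by (simp add: f_def)
  also have "\<dots> = (\<Sum>z\<in>f ` ?L. y (snd z))" using sum.reindex[OF inj, of "\<lambda>z. y (snd z)"] by simp
  also have "\<dots> \<le> (\<Sum>z\<in>?L' \<times> {- int H..int H}. y (snd z))"
    by (rule sum_mono2[OF _ img]) (use finU y finite_lists_of_length in auto)
  also have "\<dots> = (\<Sum>l\<in>?L'. \<Sum>n\<in>{- int H..int H}. y n)"
    by (simp only: sum.cartesian_product split_def)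
  also have "\<dots> = real (card ?L') * (\<Sum>n\<in>{- int H..int H}. y n)" by simp
  also have "card ?L' = card U ^ (r - 1)"
    using card_lists_length_eq[OF finU, of "r - 1"] by (simp add: conj_commute)
  finally show ?thesis by simp
qed

text \<open>Leaving out 0 avoids an additive constant, so the bound decays like \<open>1 / d\<close>
  even for \<open>d\<close> beyond \<open>H\<close>.\<close>

lemma card_multiples_le:
  assumes "d > 0"
  shows "real (card {n \<in> {- int H..int H} - {0}. int d dvd n}) \<le> 2 * real H / real d"
proof -
  have "{n \<in> {- int H..int H} - {0}. int d dvd n}
    \<subseteq> (\<lambda>m. int d * int m) ` {1..H div d} \<union> (\<lambda>m. - (int d * int m)) ` {1..H div d}"
  proof
    fix n assume n: "n \<in> {n \<in> {- int H..int H} - {0}. int d dvd n}"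
    then obtain k where k: "n = int d * k" by (auto elim: dvdE)
    define m where "m = nat \<bar>k\<bar>"
    have "int (d * m) = \<bar>n\<bar>" using k by (simp add: m_def abs_mult)
    then have dm: "int (d * m) \<le> int H" using n by auto
    have "k \<noteq> 0" using n k by auto
    then have m1: "m \<ge> 1" by (simp add: m_def)
    have "d * m \<le> H" using dm by (simp only: of_nat_le_iff)
    then have "m \<le> H div d" using assms by (simp add: less_eq_div_iff_mult_less_eq mult.commute)
    then have mm: "m \<in> {1..H div d}" using m1 by simp
    have "n = int d * int m \<or> n = - (int d * int m)"
      using k by (cases "k \<ge> 0") (simp_all add: m_def)
    then show "n \<in> (\<lambda>m. int d * int m) ` {1..H div d} \<union> (\<lambda>m. - (int d * int m)) ` {1..H div d}"
      using mm by blast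
  qed
  then have "card {n \<in> {- int H..int H} - {0}. int d dvd n}
    \<le> card ((\<lambda>m. int d * int m) ` {1..H div d} \<union> (\<lambda>m. - (int d * int m)) ` {1..H div d})"
    by (intro card_mono) auto
  also have "\<dots> \<le> card ((\<lambda>m. int d * int m) ` {1..H div d}) + card ((\<lambda>m. - (int d * int m)) ` {1..H div d})"
    by (rule card_Un_le)
  also have "\<dots> \<le> card {1..H div d} + card {1..H div d}"
    by (intro add_mono card_image_le) auto
  finally have "card {n \<in> {- int H..int H} - {0}. int d dvd n} \<le> 2 * (H div d)" by simp
  then have "real (card {n \<in> {- int H..int H} - {0}. int d dvd n}) \<le> real (2 * (H div d))"
    by (simp only: of_nat_le_iff)
  also have "\<dots> \<le> 2 * (real H / real d)" using of_nat_div_le_of_nat[of H d, where ?'a = real] by simp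
  finally show ?thesis by simp
qed

lemma prod_primes_dvd_iff:
  fixes G :: "nat set" and n :: int
  assumes "finite G" "\<forall>p\<in>G. prime p"
  shows "int (\<Prod>G) dvd n \<longleftrightarrow> (\<forall>p\<in>G. int p dvd n)"
  using assms
proof (induction G rule: finite_induct)
  case (insert p G)
  have "coprime p (\<Prod>G)"
    by (rule prod_coprime_right) (use insert in \<open>auto intro: primes_coprime\<close>)
  then have "coprime (int p) (int (\<Prod>G))" by (simp only: coprime_int_iff)
  moreover have "int (\<Prod>(insert p G)) = int p * int (\<Prod>G)" using insert(1,2) by simp
  ultimately have "int (\<Prod>(insert p G)) dvd n \<longleftrightarrow> int p dvd n \<and> int (\<Prod>G) dvd n"
    by (metis divides_mult dvd_mult_left dvd_mult_right)
  then show ?case using insert by (simp del: of_nat_prod)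
qed simp

lemma prod_one_plus:
  fixes f :: "'b \<Rightarrow> real"
  assumes "finite P"
  shows "(\<Prod>p\<in>P. 1 + f p) = (\<Sum>G\<in>Pow P. \<Prod>p\<in>G. f p)"
  using prod_add[OF assms, of f "\<lambda>_. 1"] by (simp add: add.commute)

text \<open>Expanding over subsets \<open>G\<close> leaves the conditions
  \<open>\<Prod>G dvd n\<close>, and \<open>card_multiples_le\<close> supplies the weight
  \<open>1 / \<Prod>G\<close> for each of them, however large; the expansion is then folded back
  into a product.\<close>

lemma sum_divisor_products_le:
  fixes f :: "nat \<Rightarrow> real"
  assumes P: "finite P" "\<forall>p\<in>P. prime p" and f: "\<And>p. p \<in> P \<Longrightarrow> f p \<ge> 0"
  shows "(\<Sum>n\<in>{- int H..int H} - {0}. \<Prod>p\<in>P. if int p dvd n then 1 + f p else 1)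
    \<le> 2 * real H * (\<Prod>p\<in>P. 1 + f p / real p)"
proof -
  let ?N = "{- int H..int H} - {0}"
  have "(\<Prod>p\<in>P. if int p dvd n then 1 + f p else 1)
      = (\<Sum>G\<in>Pow P. if int (\<Prod>G) dvd n then \<Prod>p\<in>G. f p else 0)" for n
  proof -
    have "(\<Prod>p\<in>P. if int p dvd n then 1 + f p else 1) = (\<Prod>p\<in>P. 1 + (if int p dvd n then f p else 0))"
      by (intro prod.cong) auto
    also have "\<dots> = (\<Sum>G\<in>Pow P. \<Prod>p\<in>G. if int p dvd n then f p else 0)"
      by (rule prod_one_plus[OF P(1)])
    also have "\<dots> = (\<Sum>G\<in>Pow P. if int (\<Prod>G) dvd n then \<Prod>p\<in>G. f p else 0)"
    proof (rule sum.cong[OF refl])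
      fix G assume "G \<in> Pow P"
      then have G: "finite G" "\<forall>p\<in>G. prime p" using P finite_subset by auto
      show "(\<Prod>p\<in>G. if int p dvd n then f p else 0) = (if int (\<Prod>G) dvd n then \<Prod>p\<in>G. f p else 0)"
      proof (cases "\<forall>p\<in>G. int p dvd n")
        case True
        then show ?thesis using prod_primes_dvd_iff[OF G, of n] by (simp cong: prod.cong)
      next
        case False
        then have "(\<Prod>p\<in>G. if int p dvd n then f p else 0) = 0"
          using G by (intro prod_zero) auto
        moreover have "\<not> int (\<Prod>G) dvd n" using False prod_primes_dvd_iff[OF G, of n] by blast
        ultimately show ?thesis by (simp only: if_False)
      qed
    qed
    finally show ?thesis .
  qed
  then have "(\<Sum>n\<in>?N. \<Prod>p\<in>P. if int p dvd n then 1 + f p else 1)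
     = (\<Sum>n\<in>?N. \<Sum>G\<in>Pow P. if int (\<Prod>G) dvd n then \<Prod>p\<in>G. f p else 0)" by simp
  also have "\<dots> = (\<Sum>G\<in>Pow P. \<Sum>n\<in>?N. if int (\<Prod>G) dvd n then \<Prod>p\<in>G. f p else 0)"
    by (rule sum.swap)
  also have "\<dots> \<le> (\<Sum>G\<in>Pow P. 2 * real H * (\<Prod>p\<in>G. f p / real p))"
  proof (rule sum_mono)
    fix G assume "G \<in> Pow P"
    then have G: "finite G" "\<forall>p\<in>G. prime p" "G \<subseteq> P" using P finite_subset by auto
    have pos: "\<Prod>G > 0" using G by (meson prod_pos prime_gt_0_nat)
    have f0: "(\<Prod>p\<in>G. f p) \<ge> 0" using G f by (intro prod_nonneg) auto
    have "(\<Sum>n\<in>?N. if int (\<Prod>G) dvd n then \<Prod>p\<in>G. f p else 0)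
      = real (card {n \<in> ?N. int (\<Prod>G) dvd n}) * (\<Prod>p\<in>G. f p)"
      using sum.inter_filter[of ?N "\<lambda>_. \<Prod>p\<in>G. f p" "\<lambda>n. int (\<Prod>G) dvd n"] by (simp del: of_nat_prod)
    also have "\<dots> \<le> (2 * real H / real (\<Prod>G)) * (\<Prod>p\<in>G. f p)"
      by (intro mult_right_mono card_multiples_le pos f0)
    also have "\<dots> = 2 * real H * (\<Prod>p\<in>G. f p / real p)" by (simp add: prod_dividef)
    finally show "(\<Sum>n\<in>?N. if int (\<Prod>G) dvd n then \<Prod>p\<in>G. f p else 0)
      \<le> 2 * real H * (\<Prod>p\<in>G. f p / real p)" .
  qed
  also have "\<dots> = 2 * real H * (\<Prod>p\<in>P. 1 + f p / real p)"
    by (simp add: prod_one_plus[OF P(1)] sum_distrib_left)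
  finally show ?thesis .
qed

text \<open>The primes below \<open>N\<close> are absorbed into a constant formed from all numbers
  below \<open>N\<close>, so it does not depend on \<open>F\<close>. The condition
  \<open>g p \<ge> 1\<close> lets those primes keep their factor \<open>g p\<close>.\<close>

lemma prod_le_of_eventually_le:
  fixes f g :: "nat \<Rightarrow> real"
  assumes f: "\<And>p. prime p \<Longrightarrow> f p \<ge> 0" and g: "\<And>p. prime p \<Longrightarrow> g p \<ge> 1"
    and ev: "\<And>p. prime p \<Longrightarrow> p \<ge> N \<Longrightarrow> f p \<le> g p"
  shows "\<exists>B>0. \<forall>F. finite F \<longrightarrow> (\<forall>p\<in>F. prime p) \<longrightarrow> (\<Prod>p\<in>F. f p) \<le> B * (\<Prod>p\<in>F. g p)"
proof -
  define c where "c p = (if p < N then max 1 (f p) else 1)" for p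
  have c1: "c p \<ge> 1" for p by (simp add: c_def)
  define B where "B = (\<Prod>p<N. c p)"
  have B: "B > 0" unfolding B_def using c1 by (intro prod_pos) (auto intro: less_le_trans[OF zero_less_one])
  have "(\<Prod>p\<in>F. f p) \<le> B * (\<Prod>p\<in>F. g p)" if F: "finite F" "\<forall>p\<in>F. prime p" for F
  proof -
    have "(\<Prod>p\<in>F. f p) \<le> (\<Prod>p\<in>F. c p * g p)"
    proof (rule prod_mono)
      fix p assume p: "p \<in> F"
      then have pp: "prime p" using F by auto
      have "f p \<le> c p * g p"
      proof (cases "p < N")
        case True
        have "f p \<le> max 1 (f p) * 1" by simp
        also have "\<dots> \<le> max 1 (f p) * g p" using g[OF pp] by (intro mult_left_mono) auto
        finally show ?thesis using True by (simp add: c_def)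
      qed (use ev[OF pp] in \<open>simp add: c_def\<close>)
      then show "0 \<le> f p \<and> f p \<le> c p * g p" using f[OF pp] by simp
    qed
    also have "\<dots> = (\<Prod>p\<in>F. c p) * (\<Prod>p\<in>F. g p)" by (rule prod.distrib)
    also have "\<dots> \<le> B * (\<Prod>p\<in>F. g p)"
    proof (rule mult_right_mono)
      have "(\<Prod>p\<in>F. c p) = (\<Prod>p\<in>F \<inter> {..<N}. c p)"
        by (rule prod.mono_neutral_right) (use F in \<open>auto simp: c_def\<close>)
      also have "\<dots> \<le> B" unfolding B_def
        by (rule prod_mono2) (use c1 in \<open>auto intro: order_trans[OF zero_le_one]\<close>)
      finally show "(\<Prod>p\<in>F. c p) \<le> B" .
      show "0 \<le> (\<Prod>p\<in>F. g p)" using g F by (intro prod_nonneg) (auto intro: order_trans[OF zero_le_one])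
    qed
    finally show ?thesis .
  qed
  then show ?thesis using B by blast
qed

text \<open>The left side is convex in \<open>\<rho>\<close> and the right side is its chord on the
  unit interval. The point is to keep one factor \<open>\<rho>\<close> in front after taking a
  power.\<close>

lemma power_one_plus_mult_le:
  fixes a \<rho> :: real
  assumes "0 \<le> \<rho>" "\<rho> \<le> 1" "a \<ge> 0"
  shows "(1 + \<rho> * a) ^ n \<le> 1 + \<rho> * ((1 + a) ^ n - 1)"
proof (induction n)
  case (Suc n)
  define X where "X = (1 + a) ^ n"
  have X: "X \<ge> 1" unfolding X_def using assms by (intro one_le_power) auto
  have "(1 + \<rho> * a) ^ Suc n \<le> (1 + \<rho> * a) * (1 + \<rho> * (X - 1))"
    using Suc.IH assms by (simp add: X_def mult_left_mono)
  also have "\<dots> = 1 + \<rho> * (X - 1) + \<rho> * a + \<rho> * (\<rho> * (a * (X - 1)))" by (simp add: algebra_simps)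
  also have "\<rho> * (\<rho> * (a * (X - 1))) \<le> 1 * (\<rho> * (a * (X - 1)))"
    using assms X by (intro mult_right_mono) auto
  finally have "(1 + \<rho> * a) ^ Suc n \<le> 1 + \<rho> * (X - 1) + \<rho> * a + \<rho> * (a * (X - 1))" by simp
  then show ?case by (simp add: X_def algebra_simps)
qed simp

text \<open>A substitute for Hoelder's inequality: it decouples the factors belonging to different
  index pairs, so that each pair can be averaged alone.\<close>

lemma prod_le_sum_power_card:
  fixes x :: "'b \<Rightarrow> real"
  assumes "finite I" "I \<noteq> {}" "\<And>i. i \<in> I \<Longrightarrow> x i \<ge> 0"
  shows "(\<Prod>i\<in>I. x i) \<le> (\<Sum>i\<in>I. x i ^ card I)"
proof -
  have "Max (x ` I) \<in> x ` I" using assms by (intro Max_in) auto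
  then obtain m where m: "m \<in> I" "x m = Max (x ` I)" by auto
  have le: "x i \<le> x m" if "i \<in> I" for i using assms(1) that m(2) by simp
  have "(\<Prod>i\<in>I. x i) \<le> (\<Prod>i\<in>I. x m)" using assms le by (intro prod_mono) auto
  also have "\<dots> = x m ^ card I" by simp
  also have "\<dots> \<le> (\<Sum>i\<in>I. x i ^ card I)"
    by (rule member_le_sum) (use assms m in auto)
  finally show ?thesis .
qed

text \<open>\<open>L\<close> is a discrepancy uniform in modulus and residue class. The main term
  uses a real length \<open>\<sigma>\<close> instead of \<open>card U\<close>, so that
  \<open>\<sigma>\<close> can be an exact multiple of the mean spacing.\<close>

definition equidist :: "real \<Rightarrow> real \<Rightarrow> int set \<Rightarrow> bool" where
  "equidist L \<sigma> U \<longleftrightarrow>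
     (\<forall>e>0. \<forall>c. \<bar>real (card {u\<in>U. u mod int e = c mod int e}) - \<sigma> / real e\<bar> \<le> L)"

lemma equidist_card:
  assumes "equidist L \<sigma> U"
  shows "\<bar>real (card U) - \<sigma>\<bar> \<le> L"
  using assms[unfolded equidist_def, rule_format, of 1 0] by simp

lemma card_interval_mod:
  fixes x y :: real
  assumes "e > 0" "x \<le> y"
  shows "\<bar>real (card {u::int. x < u \<and> u \<le> y \<and> u mod int e = c mod int e}) - (y - x) / e\<bar> \<le> 1"
proof -
  define a where "a = \<lfloor>(x - c) / e\<rfloor>"
  define b where "b = \<lfloor>(y - c) / e\<rfloor>"
  have e: "real e > 0" using assms by simp
  have ab: "a \<le> b" unfolding a_def b_def using assms by (intro floor_mono divide_right_mono) auto
  have "{u::int. x < u \<and> u \<le> y \<and> u mod int e = c mod int e} = (\<lambda>z. c + int e * z) ` {a<..b}"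
  proof (intro equalityI subsetI)
    fix u :: int assume u: "u \<in> {u::int. x < u \<and> u \<le> y \<and> u mod int e = c mod int e}"
    then have "int e dvd u - c" by (simp add: mod_eq_dvd_iff)
    then obtain z where z: "u = c + int e * z" by (auto elim!: dvdE) (metis add.commute diff_add_cancel)
    have "x < c + e * z" "c + e * z \<le> y" using u z by auto
    then have "(x - c) / e < z" "z \<le> (y - c) / e" using e by (simp_all add: field_simps)
    then have "z \<in> {a<..b}" unfolding a_def b_def by (auto simp: floor_less_iff le_floor_iff)
    then show "u \<in> (\<lambda>z. c + int e * z) ` {a<..b}" using z by blast
  next
    fix u assume "u \<in> (\<lambda>z. c + int e * z) ` {a<..b}"
    then obtain z where z0: "u = c + int e * z" "z \<in> {a<..b}" by blast
    then have z: "u = c + int e * z" "a < z" "z \<le> b" by simp_all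
    have "(x - c) / e < z" "z \<le> (y - c) / e" using z unfolding a_def b_def
      by (auto simp: floor_less_iff le_floor_iff)
    then have "x < c + e * z" "c + e * z \<le> y" using e by (simp_all add: field_simps)
    then show "u \<in> {u::int. x < u \<and> u \<le> y \<and> u mod int e = c mod int e}" using z by simp
  qed
  moreover have "inj_on (\<lambda>z. c + int e * z) {a<..b}" using assms by (auto intro!: inj_onI)
  ultimately have "card {u::int. x < u \<and> u \<le> y \<and> u mod int e = c mod int e} = nat (b - a)"
    by (simp add: card_image)
  then have eq: "real (card {u::int. x < u \<and> u \<le> y \<and> u mod int e = c mod int e}) = real_of_int (b - a)"
    using ab by simp
  have d: "(y - x) / e = (y - c) / e - (x - c) / e" by (simp add: diff_divide_distrib)
  show ?thesis unfolding eq d a_def b_def of_int_diff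
    by (rule abs_leI; linarith)
qed

lemma abs_power_diff_le:
  fixes x y L :: real
  assumes "0 \<le> x" "0 \<le> y" "\<bar>x - y\<bar> \<le> L"
  shows "\<bar>x ^ r - y ^ r\<bar> \<le> real r * L * (y + L) ^ (r - 1)"
proof -
  have "x ^ r - y ^ r = (x - y) * (\<Sum>i<r. y ^ (r - Suc i) * x ^ i)"
    by (rule power_diff_sumr2)
  then have "\<bar>x ^ r - y ^ r\<bar> = \<bar>x - y\<bar> * (\<Sum>i<r. y ^ (r - Suc i) * x ^ i)"
    using assms by (simp add: abs_mult sum_nonneg)
  also have "\<dots> \<le> L * (\<Sum>i<r. (y + L) ^ (r - 1))"
  proof (intro mult_mono sum_mono)
    fix i assume i: "i \<in> {..<r}"
    have "y ^ (r - Suc i) * x ^ i \<le> (y + L) ^ (r - Suc i) * (y + L) ^ i"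
      using assms by (intro mult_mono power_mono) auto
    also have "\<dots> = (y + L) ^ (r - 1)" using i by (simp flip: power_add)
    finally show "y ^ (r - Suc i) * x ^ i \<le> (y + L) ^ (r - 1)" .
  qed (use assms in \<open>auto intro!: sum_nonneg\<close>)
  finally show ?thesis by (simp add: mult_ac)
qed

text \<open>By double counting the sum is the average over \<open>t \<in> A\<close> of
  \<open>(s * W t) ^ r\<close>, where \<open>W t\<close> counts the shifts in \<open>U\<close> that
  lead from \<open>t\<close> to \<open>A\<close>. These fill \<open>card A\<close> residue classes,
  each containing \<open>\<sigma> / e\<close> shifts up to \<open>L\<close>, so
  \<open>s * W t\<close> is within \<open>e * L\<close> of \<open>\<sigma>\<close> for every single
  \<open>t\<close>.\<close>

lemma sum_ncount_lists:
  assumes A: "A \<subseteq> {0..<int e}" "A \<noteq> {}" and U: "finite U" "equidist L \<sigma> U" and \<sigma>: "\<sigma> \<ge> 0"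
  shows "\<bar>(\<Sum>h\<in>{h. length h = r \<and> set h \<subseteq> U}. ncount e h A) - \<sigma> ^ r\<bar>
    \<le> real r * (e * L) * (\<sigma> + e * L) ^ (r - 1)"
proof -
  have finA: "finite A" using A finite_subset by blast
  have cA: "card A > 0" using A finA by (simp add: card_gt_0_iff)
  have e: "e > 0" using A by (cases "e = 0") auto
  define s where "s = inv_density e A"
  define W where "W t = card {u\<in>U. (t + u) mod int e \<in> A}" for t
  have L0: "L \<ge> 0" using equidist_card[OF U(2)] by linarith
  have W: "\<bar>s * W t - \<sigma>\<bar> \<le> e * L" for t
  proof -
    have "{u\<in>U. (t + u) mod int e \<in> A} = (\<Union>a\<in>A. {u\<in>U. u mod int e = (a - t) mod int e})"
    proof (intro equalityI subsetI)
      fix u assume u: "u \<in> {u\<in>U. (t + u) mod int e \<in> A}"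
      have "u mod int e = ((t + u) mod int e - t) mod int e" by (simp add: mod_simps)
      then show "u \<in> (\<Union>a\<in>A. {u\<in>U. u mod int e = (a - t) mod int e})" using u by blast
    next
      fix u assume "u \<in> (\<Union>a\<in>A. {u\<in>U. u mod int e = (a - t) mod int e})"
      then obtain a where a: "a \<in> A" "u \<in> U" "u mod int e = (a - t) mod int e" by blast
      have "(t + u) mod int e = (t + u mod int e) mod int e" by (simp add: mod_simps)
      also have "\<dots> = a mod int e" unfolding a(3) by (simp add: mod_simps)
      also have "\<dots> = a" using a(1) A by auto
      finally show "u \<in> {u\<in>U. (t + u) mod int e \<in> A}" using a by simp
    qed
    moreover have "card (\<Union>a\<in>A. {u\<in>U. u mod int e = (a - t) mod int e})
      = (\<Sum>a\<in>A. card {u\<in>U. u mod int e = (a - t) mod int e})"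
    proof (rule card_UN_disjoint[OF finA])
      show "\<forall>i\<in>A. \<forall>j\<in>A. i \<noteq> j \<longrightarrow> {u \<in> U. u mod int e = (i - t) mod int e} \<inter>
        {u \<in> U. u mod int e = (j - t) mod int e} = {}"
      proof (intro ballI impI)
        fix i j assume ij: "i \<in> A" "j \<in> A" "i \<noteq> j"
        have "(i - t) mod int e \<noteq> (j - t) mod int e"
        proof
          assume "(i - t) mod int e = (j - t) mod int e"
          then have "((i - t) mod int e + t) mod int e = ((j - t) mod int e + t) mod int e" by simp
          then have "i mod int e = j mod int e" by (simp add: mod_simps)
          then show False using ij A by (auto simp: subset_iff)
        qed
        then show "{u \<in> U. u mod int e = (i - t) mod int e} \<inter>
          {u \<in> U. u mod int e = (j - t) mod int e} = {}" by auto
      qed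
    qed (use U in auto)
    ultimately have Wt: "real (W t) = (\<Sum>a\<in>A. real (card {u\<in>U. u mod int e = (a - t) mod int e}))"
      by (simp add: W_def)
    have "\<bar>real (W t) - card A * (\<sigma> / e)\<bar>
      = \<bar>\<Sum>a\<in>A. (real (card {u\<in>U. u mod int e = (a - t) mod int e}) - \<sigma> / e)\<bar>"
      unfolding Wt by (simp add: sum_subtractf)
    also have "\<dots> \<le> (\<Sum>a\<in>A. \<bar>real (card {u\<in>U. u mod int e = (a - t) mod int e}) - \<sigma> / e\<bar>)"
      by (rule sum_abs)
    also have "\<dots> \<le> (\<Sum>a\<in>A. L)"
      by (rule sum_mono) (use U(2) e in \<open>auto simp: equidist_def\<close>)
    finally have "\<bar>real (W t) - card A * (\<sigma> / e)\<bar> \<le> card A * L" by simp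
    then have "s * \<bar>real (W t) - card A * (\<sigma> / e)\<bar> \<le> s * (card A * L)"
      by (intro mult_left_mono) (auto simp: s_def inv_density_def)
    moreover have "s * \<bar>real (W t) - card A * (\<sigma> / e)\<bar> = \<bar>s * (real (W t) - card A * (\<sigma> / e))\<bar>"
      by (simp add: abs_mult s_def inv_density_def)
    moreover have "s * (real (W t) - card A * (\<sigma> / e)) = s * W t - \<sigma>"
      using cA e by (simp add: s_def inv_density_def field_simps)
    moreover have "s * (card A * L) = e * L" using cA by (simp add: s_def inv_density_def)
    ultimately show ?thesis by simp
  qed
  have "(\<Sum>h\<in>{h. length h = r \<and> set h \<subseteq> U}. ncount e h A)
    = (\<Sum>h\<in>{h. length h = r \<and> set h \<subseteq> U}. real (num_tuples e h A)) * (s ^ Suc r / e)"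
    unfolding sum_distrib_right by (intro sum.cong) (auto simp: ncount_def s_def)
  also have "\<dots> = real (\<Sum>t\<in>A. W t ^ r) * (s ^ Suc r / e)"
    using sum_num_tuples_lists[OF A(1) U(1), of r] by (simp add: W_def flip: of_nat_sum)
  also have "\<dots> = (\<Sum>t\<in>A. (s * W t) ^ r) * (s / e)"
    by (simp add: power_mult_distrib sum_distrib_left sum_distrib_right sum_divide_distrib mult_ac)
  also have "s / e = 1 / card A" using e by (simp add: s_def inv_density_def)
  finally have eq: "(\<Sum>h\<in>{h. length h = r \<and> set h \<subseteq> U}. ncount e h A) = (\<Sum>t\<in>A. (s * W t) ^ r) / card A"
    by simp
  have "\<bar>(\<Sum>t\<in>A. (s * W t) ^ r) / card A - \<sigma> ^ r\<bar> = \<bar>(\<Sum>t\<in>A. (s * W t) ^ r - \<sigma> ^ r)\<bar> / card A"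
    using cA by (simp add: sum_subtractf field_simps)
  also have "\<dots> \<le> (\<Sum>t\<in>A. \<bar>(s * W t) ^ r - \<sigma> ^ r\<bar>) / card A"
    by (intro divide_right_mono sum_abs) auto
  also have "\<dots> \<le> (\<Sum>t\<in>A. real r * (e * L) * (\<sigma> + e * L) ^ (r - 1)) / card A"
    by (intro divide_right_mono sum_mono abs_power_diff_le W)
      (use \<sigma> in \<open>auto simp: s_def inv_density_def\<close>)
  also have "\<dots> = real r * (e * L) * (\<sigma> + e * L) ^ (r - 1)" using cA by simp
  finally show ?thesis unfolding eq .
qed

lemma not_distinct_map_Cons:
  assumes "\<not> distinct (map g (x # h))"
  obtains i j where "i < length h" "j \<le> i" "g ((x # h) ! Suc i) = g ((x # h) ! j)"
proof -
  from assms obtain a b where ab: "a < Suc (length h)" "b < Suc (length h)" "a \<noteq> b"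
    "g ((x # h) ! a) = g ((x # h) ! b)"
    unfolding distinct_conv_nth by (auto simp del: list.map nth_Cons_Suc)
  show ?thesis
  proof (cases "b < a")
    case True
    then obtain i where "a = Suc i" by (cases a) auto
    then show ?thesis using that[of i b] ab True by simp
  next
    case False
    then obtain i where "b = Suc i" using ab by (cases b) auto
    then show ?thesis using that[of i a] ab False by simp
  qed
qed

text \<open>A pair \<open>(i, j)\<close> stands for the positions \<open>j < Suc i\<close> in
  \<open>0 # h\<close>; position 0 is the entry 0 in front of \<open>h\<close>.\<close>

definition index_pairs :: "nat \<Rightarrow> (nat \<times> nat) set" where
  "index_pairs r = (SIGMA i:{..<r}. {..i})"

lemma finite_index_pairs [simp]: "finite (index_pairs r)"
  by (simp add: index_pairs_def)

lemma not_distinct_index_pairs: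
  assumes "\<not> distinct (map g (0 # h))"
  shows "\<exists>(i, j)\<in>index_pairs (length h). g ((0 # h) ! Suc i) = g ((0 # h) ! j)"
proof -
  obtain i j where "i < length h" "j \<le> i" "g ((0 # h) ! Suc i) = g ((0 # h) ! j)"
    by (rule not_distinct_map_Cons[OF assms])
  then show ?thesis by (auto simp: index_pairs_def intro!: bexI[of _ "(i, j)"])
qed

lemma distinct_index_pairs:
  assumes "distinct (0 # h)" "(i, j) \<in> index_pairs (length h)"
  shows "(0 # h) ! Suc i \<noteq> (0 # h) ! j"
  using assms nth_eq_iff_index_eq[OF assms(1), of "Suc i" j] by (auto simp: index_pairs_def)

lemma card_not_distinct_lists_le:
  fixes U :: "int set"
  assumes U: "U \<subseteq> {1..int H}"
  shows "real (card {h. length h = r \<and> set h \<subseteq> U \<and> \<not> distinct h})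
    \<le> real (card (index_pairs r)) * real (card U) ^ (r - 1)"
proof -
  have finU: "finite U" using U finite_subset by blast
  let ?L = "{h. length h = r \<and> set h \<subseteq> U}"
  \<comment> \<open>With the indicator of 0 as weight, the union bound over coinciding positions
    becomes an instance of \<open>sum_lists_difference_le\<close>.\<close>
  define y where "y n = (if n = 0 then 1 else 0 :: real)" for n :: int
  have ypos: "y n \<ge> 0" for n by (simp add: y_def)
  have "{- int H..int H} \<inter> {n. n = 0} = {0}" by auto
  then have sumy: "(\<Sum>n\<in>{- int H..int H}. y n) = 1" by (simp add: y_def)
  have "{h. length h = r \<and> set h \<subseteq> U \<and> \<not> distinct h} = {h \<in> ?L. \<not> distinct h}" by auto
  then have "real (card {h. length h = r \<and> set h \<subseteq> U \<and> \<not> distinct h})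
    = (\<Sum>h\<in>?L. if \<not> distinct h then 1 else 0)"
    using card_filter_eq_sum[OF finite_lists_of_length[OF finU, of r], of "\<lambda>h. \<not> distinct h"]
    by (simp add: of_nat_sum if_distrib cong: if_cong)
  also have "\<dots> \<le> (\<Sum>h\<in>?L. \<Sum>(i, j)\<in>index_pairs r. y ((0 # h) ! Suc i - (0 # h) ! j))"
  proof (rule sum_mono)
    fix h assume h: "h \<in> ?L"
    show "(if \<not> distinct h then 1 else 0) \<le> (\<Sum>(i, j)\<in>index_pairs r. y ((0 # h) ! Suc i - (0 # h) ! j))"
    proof (cases "distinct h")
      case False
      then have "\<not> distinct (map (\<lambda>x. x) (0 # h))" by simp
      from not_distinct_index_pairs[OF this] obtain i j where ij: "(i, j) \<in> index_pairs r"
        "(0 # h) ! Suc i = (0 # h) ! j" using h by auto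
      have "1 = (case (i, j) of (i, j) \<Rightarrow> y ((0 # h) ! Suc i - (0 # h) ! j))" using ij by (simp add: y_def)
      also have "\<dots> \<le> (\<Sum>(i, j)\<in>index_pairs r. y ((0 # h) ! Suc i - (0 # h) ! j))"
        by (rule member_le_sum[OF ij(1)]) (auto simp: ypos)
      finally show ?thesis using False by simp
    next
      case True
      then show ?thesis by (auto intro!: sum_nonneg simp: ypos)
    qed
  qed
  also have "\<dots> = (\<Sum>z\<in>index_pairs r. \<Sum>h\<in>?L. y ((0 # h) ! Suc (fst z) - (0 # h) ! snd z))"
    unfolding split_def by (rule sum.swap)
  also have "\<dots> \<le> (\<Sum>z\<in>index_pairs r. real (card U) ^ (r - 1) * (\<Sum>n\<in>{- int H..int H}. y n))"
    by (rule sum_mono, rule sum_lists_difference_le[OF U]) (auto simp: index_pairs_def ypos)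
  finally show ?thesis by (simp add: sumy)
qed

section \<open>Sets of primes with bounded product\<close>

lemma inj_on_prod_primes:
  "inj_on (\<lambda>G::nat set. \<Prod>G) {G. finite G \<and> (\<forall>p\<in>G. prime p)}"
proof (rule inj_onI)
  fix G G' :: "nat set"
  assume "G \<in> {G. finite G \<and> (\<forall>p\<in>G. prime p)}" "G' \<in> {G. finite G \<and> (\<forall>p\<in>G. prime p)}"
    and eq: "\<Prod>G = \<Prod>G'"
  then have G: "finite G" "\<forall>p\<in>G. prime p" and G': "finite G'" "\<forall>p\<in>G'. prime p" by auto
  have "p \<in> G \<longleftrightarrow> p \<in> G'" if "prime p" for p
    using prime_dvd_prod_primes_iff[OF G that] prime_dvd_prod_primes_iff[OF G' that] eq by simp
  then show "G = G'" using G G' by blast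
qed

text \<open>By unique factorization the products are different positive integers up to
  \<open>D\<close>.\<close>

lemma card_prime_sets_le:
  assumes P: "finite P" "\<forall>p\<in>P. prime p" and "D \<ge> 0"
  shows "real (card {G \<in> Pow P. real (\<Prod>G) \<le> D}) \<le> D"
proof -
  let ?S = "{G \<in> Pow P. real (\<Prod>G) \<le> D}"
  have sub: "?S \<subseteq> {G. finite G \<and> (\<forall>p\<in>G. prime p)}" using P finite_subset by auto
  have "card ?S = card ((\<lambda>G. \<Prod>G) ` ?S)"
    using inj_on_subset[OF inj_on_prod_primes sub] by (simp add: card_image del: of_nat_prod)
  also have "\<dots> \<le> card {1..nat \<lfloor>D\<rfloor>}"
  proof (rule card_mono)
    show "(\<lambda>G. \<Prod>G) ` ?S \<subseteq> {1..nat \<lfloor>D\<rfloor>}"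
    proof
      fix n assume "n \<in> (\<lambda>G. \<Prod>G) ` ?S"
      then obtain G where G: "G \<in> ?S" "n = \<Prod>G" by blast
      then have "\<forall>p\<in>G. prime p" using P by auto
      then have "n > 0" unfolding G(2) by (intro prod_pos) (auto intro: prime_gt_0_nat)
      moreover have "real n \<le> D" using G by (simp del: of_nat_prod)
      ultimately show "n \<in> {1..nat \<lfloor>D\<rfloor>}" by (simp add: le_nat_iff le_floor_iff)
    qed
  qed simp
  finally have "card ?S \<le> nat \<lfloor>D\<rfloor>" by simp
  then have "real (card ?S) \<le> real (nat \<lfloor>D\<rfloor>)" by (simp only: of_nat_le_iff)
  also have "\<dots> \<le> D" using assms(3) by simp
  finally show ?thesis .
qed

lemma two_power_card_le_prod_primes:
  assumes "\<forall>p\<in>G. prime (p::nat)"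
  shows "2 ^ card G \<le> \<Prod>G"
proof -
  have "(\<Prod>p\<in>G. 2) \<le> \<Prod>G" using assms by (intro prod_mono) (auto dest: prime_ge_2_nat)
  then show ?thesis by simp
qed

section \<open>Correlations of the sieved sets\<close>

locale sieved_residues =
  fixes \<Omega> :: "nat \<Rightarrow> int set" and \<epsilon> :: real
  assumes subset: "\<And>p. prime p \<Longrightarrow> \<Omega> p \<subseteq> {0..<int p}"
    and eps: "\<epsilon> > 0"
    and tuples: "\<And>k::nat. k \<ge> 2 \<Longrightarrow> \<exists>C::real. \<forall>p. prime p \<longrightarrow>
          (\<forall>h::int list. length h = k - 1 \<longrightarrow> distinct (map (\<lambda>a. a mod int p) (0 # h)) \<longrightarrow>
             (\<exists>E::real. real (num_tuples p h (\<Omega> p)) = density p (\<Omega> p) ^ k * real p * (1 + E) \<and>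
                \<bar>E\<bar> \<le> C * (1 - density p (\<Omega> p)) * real p powr (-\<epsilon>)))"
    and nonempty: "\<And>p. prime p \<Longrightarrow> \<Omega> p \<noteq> {}"
    and growth: "((\<lambda>p. ln (inv_density p (\<Omega> p)) / ln (real p)) \<longlongrightarrow> 0)
          (inf at_top (principal {p::nat. prime p}))"
begin

abbreviation s :: "nat \<Rightarrow> real" where "s p \<equiv> inv_density p (\<Omega> p)"

definition \<rho> :: "nat \<Rightarrow> real" where "\<rho> p = 1 - 1 / s p"

definition dev :: "nat \<Rightarrow> int list \<Rightarrow> real" where "dev p h = ncount p h (\<Omega> p) - 1"

lemma s_ge_1: "prime p \<Longrightarrow> s p \<ge> 1"
  by (rule inv_density_ge_1[OF subset nonempty])

text \<open>The logarithmic bound is \<open>ln x \<le> x - 1\<close> at \<open>x = 1 / s p\<close>.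
  It is the bridge from sums of \<open>\<rho> p\<close> over the primes dividing a modulus to the
  inverse density of the modulus.\<close>

lemma \<rho>_bounds:
  assumes "prime p"
  shows "0 \<le> \<rho> p" "\<rho> p \<le> 1" "\<rho> p \<le> ln (s p)"
proof -
  have s: "s p \<ge> 1" using s_ge_1[OF assms] .
  show "0 \<le> \<rho> p" "\<rho> p \<le> 1" using s by (simp_all add: \<rho>_def)
  have "ln (1 / s p) \<le> 1 / s p - 1" using s by (intro ln_le_minus_one) auto
  then show "\<rho> p \<le> ln (s p)" using s by (simp add: \<rho>_def ln_div)
qed

lemma s_eventually_le:
  assumes "\<delta> > 0"
  shows "\<exists>N. \<forall>p\<ge>N. prime p \<longrightarrow> s p \<le> real p powr \<delta>"
proof -
  have "eventually (\<lambda>p. \<bar>ln (s p) / ln (real p)\<bar> < \<delta>) (inf at_top (principal {p::nat. prime p}))"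
    using growth assms by (auto simp: tendsto_iff dist_real_def)
  then obtain N where N: "\<And>p. p \<ge> N \<Longrightarrow> prime p \<Longrightarrow> \<bar>ln (s p) / ln (real p)\<bar> < \<delta>"
    unfolding eventually_inf_principal eventually_at_top_linorder by auto
  have "s p \<le> real p powr \<delta>" if "p \<ge> N" "prime p" for p
  proof -
    have p: "real p > 1" using that(2) prime_gt_1_nat by auto
    have s: "s p \<ge> 1" using s_ge_1[OF that(2)] .
    have "ln (s p) / ln (real p) \<le> \<delta>" using N[OF that] by linarith
    then have "ln (s p) \<le> \<delta> * ln (real p)" using p by (simp add: divide_le_eq)
    also have "\<dots> = ln (real p powr \<delta>)" using p by (simp add: ln_powr)
    finally show ?thesis using p s by (subst (asm) ln_le_cancel_iff) auto
  qed
  then show ?thesis by blast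
qed

lemma s_le:
  assumes "\<delta> > 0"
  shows "\<exists>B\<ge>1. \<forall>p. prime p \<longrightarrow> s p \<le> B * real p powr \<delta>"
proof -
  obtain N where N: "\<forall>p\<ge>N. prime p \<longrightarrow> s p \<le> real p powr \<delta>" using s_eventually_le[OF assms] by blast
  define B where "B = 1 + (\<Sum>p<N. s p)"
  have s0: "s p \<ge> 0" for p by (simp add: inv_density_def)
  have B: "B \<ge> 1" unfolding B_def using s0 by (simp add: sum_nonneg)
  have "s p \<le> B * real p powr \<delta>" if p: "prime p" for p
  proof (cases "p < N")
    case True
    have "s p \<le> (\<Sum>p<N. s p)" by (rule member_le_sum) (use True s0 in auto)
    then have "s p \<le> B * 1" by (simp add: B_def)
    also have "\<dots> \<le> B * real p powr \<delta>"
      using B p assms prime_ge_1_nat[OF p] by (intro mult_left_mono ge_one_powr_ge_zero) auto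
    finally show ?thesis .
  next
    case False
    then have "s p \<le> 1 * real p powr \<delta>" using N p by simp
    also have "\<dots> \<le> B * real p powr \<delta>" using B by (intro mult_right_mono) auto
    finally show ?thesis .
  qed
  then show ?thesis using B by blast
qed

text \<open>The decay of \<open>p powr (-\<alpha>)\<close> serves only to push the coefficient below
  \<open>\<delta>\<close> for all but finitely many primes; from there on
  \<open>1 + \<delta> * ln (s p) \<le> s p powr \<delta>\<close>. The constant is independent of
  \<open>F\<close>.\<close>

lemma prod_one_plus_\<rho>_le:
  assumes "c \<ge> 0" "\<alpha> > 0" "\<delta> > 0"
  shows "\<exists>B>0. \<forall>F. finite F \<longrightarrow> (\<forall>p\<in>F. prime p) \<longrightarrow>
    (\<Prod>p\<in>F. 1 + c * real p powr (-\<alpha>) * \<rho> p) \<le> B * (\<Prod>p\<in>F. s p) powr \<delta>"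
proof -
  have "(\<lambda>p. c * real p powr (-\<alpha>)) \<longlonglongrightarrow> c * 0"
    by (intro tendsto_mult tendsto_const tendsto_neg_powr filterlim_real_sequentially) (use assms in auto)
  then have "eventually (\<lambda>p. c * real p powr (-\<alpha>) < \<delta>) sequentially"
    using assms(3) by (intro order_tendstoD(2)) auto
  then obtain N where N: "\<And>p. p \<ge> N \<Longrightarrow> c * real p powr (-\<alpha>) < \<delta>"
    by (auto simp: eventually_sequentially)
  have "\<exists>B>0. \<forall>F. finite F \<longrightarrow> (\<forall>p\<in>F. prime p) \<longrightarrow>
    (\<Prod>p\<in>F. 1 + c * real p powr (-\<alpha>) * \<rho> p) \<le> B * (\<Prod>p\<in>F. s p powr \<delta>)"
  proof (rule prod_le_of_eventually_le[where N = N])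
    fix p :: nat assume p: "prime p"
    show "0 \<le> 1 + c * real p powr (-\<alpha>) * \<rho> p" using \<rho>_bounds[OF p] assms by simp
    show "1 \<le> s p powr \<delta>" using s_ge_1[OF p] assms by (intro ge_one_powr_ge_zero) auto
    assume "p \<ge> N"
    have "1 + c * real p powr (-\<alpha>) * \<rho> p \<le> 1 + \<delta> * ln (s p)"
      using N[OF \<open>p \<ge> N\<close>] \<rho>_bounds[OF p] assms by (intro add_left_mono mult_mono) auto
    also have "\<dots> \<le> exp (\<delta> * ln (s p))" by (rule exp_ge_add_one_self)
    also have "\<dots> = s p powr \<delta>" using s_ge_1[OF p] by (simp add: powr_def)
    finally show "1 + c * real p powr (-\<alpha>) * \<rho> p \<le> s p powr \<delta>" .
  qed
  moreover have "(\<Prod>p\<in>F. s p powr \<delta>) = (\<Prod>p\<in>F. s p) powr \<delta>" for F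
    by (rule prod_powr_distrib[symmetric])
  ultimately show ?thesis by simp
qed

section \<open>Deviations at single primes\<close>

lemma abs_dev_le:
  assumes "prime p"
  shows "\<bar>dev p h\<bar> \<le> real (Suc (length h)) * \<rho> p * s p ^ Suc (length h)"
  using ncount_deviation[OF subset[OF assms] nonempty[OF assms]] by (simp only: dev_def \<rho>_def)

text \<open>For large \<open>p\<close> the choice of exponent gives
  \<open>s p ^ k \<le> p powr (1/2)\<close>, and \<open>p \<ge> k * k\<close> lets the other half
  power absorb the factor \<open>k\<close>. The bound is crude but needs no distinctness; it handles
  lists with repetitions.\<close>

lemma prod_dev_le:
  "\<exists>B>0. \<forall>F h. finite F \<longrightarrow> (\<forall>p\<in>F. prime p) \<longrightarrow> length h = r \<longrightarrow> (\<Prod>p\<in>F. \<bar>dev p h\<bar>) \<le> B * real (\<Prod>F)"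
proof -
  define k where "k = Suc r"
  have k: "real k > 0" by (simp add: k_def)
  obtain N where N: "\<And>p. p \<ge> N \<Longrightarrow> prime p \<Longrightarrow> s p \<le> real p powr (1 / (2 * real k))"
    using s_eventually_le[of "1 / (2 * real k)"] k by auto
  have "\<exists>B>0. \<forall>F. finite F \<longrightarrow> (\<forall>p\<in>F. prime p) \<longrightarrow>
    (\<Prod>p\<in>F. real k * s p ^ k) \<le> B * (\<Prod>p\<in>F. real p)"
  proof (rule prod_le_of_eventually_le[where N = "max N (k * k)"])
    fix p :: nat assume p: "prime p"
    have p1: "real p \<ge> 1" using prime_ge_1_nat[OF p] by simp
    show "1 \<le> real p" by (fact p1)
    show "0 \<le> real k * s p ^ k" using s_ge_1[OF p] by simp
    assume pN: "p \<ge> max N (k * k)"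
    then have "real k * real k \<le> real p" by (simp flip: of_nat_mult)
    then have "real k \<le> sqrt (real p)" by (intro real_le_rsqrt) (simp add: power2_eq_square)
    also have "\<dots> = real p powr (1 / 2)" using p1 by (simp add: powr_half_sqrt)
    finally have 1: "real k \<le> real p powr (1 / 2)" .
    have "s p ^ k \<le> (real p powr (1 / (2 * real k))) ^ k"
      using N[OF _ p] pN s_ge_1[OF p] by (intro power_mono) auto
    also have "\<dots> = real p powr (1 / (2 * real k) * real k)"
      using p1 by (simp add: powr_powr flip: powr_realpow)
    also have "1 / (2 * real k) * real k = 1 / 2" using k by simp
    finally have 2: "s p ^ k \<le> real p powr (1 / 2)" .
    have "real k * s p ^ k \<le> real p powr (1 / 2) * real p powr (1 / 2)"
      using 1 2 s_ge_1[OF p] by (intro mult_mono) auto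
    also have "\<dots> = real p" using p1 by (simp flip: powr_add)
    finally show "real k * s p ^ k \<le> real p" .
  qed
  then obtain B where B: "B > 0" "\<And>F. finite F \<Longrightarrow> (\<forall>p\<in>F. prime p) \<Longrightarrow>
    (\<Prod>p\<in>F. real k * s p ^ k) \<le> B * (\<Prod>p\<in>F. real p)" by blast
  have "(\<Prod>p\<in>F. \<bar>dev p h\<bar>) \<le> B * real (\<Prod>F)" if F: "finite F" "\<forall>p\<in>F. prime p" "length h = r" for F h
  proof -
    have "(\<Prod>p\<in>F. \<bar>dev p h\<bar>) \<le> (\<Prod>p\<in>F. real k * s p ^ k)"
    proof (rule prod_mono)
      fix p assume "p \<in> F"
      then have p: "prime p" using F by auto
      have "\<bar>dev p h\<bar> \<le> real k * \<rho> p * s p ^ k" using abs_dev_le[OF p, of h] F by (simp only: k_def)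
      also have "\<dots> \<le> real k * 1 * s p ^ k"
        using \<rho>_bounds[OF p] s_ge_1[OF p] by (intro mult_right_mono mult_left_mono) auto
      finally show "0 \<le> \<bar>dev p h\<bar> \<and> \<bar>dev p h\<bar> \<le> real k * s p ^ k" by simp
    qed
    then show ?thesis using B(2)[OF F(1,2)] by simp
  qed
  then show ?thesis using B(1) by blast
qed

text \<open>After normalisation the deviation is exactly the relative error \<open>E\<close> of the
  hypothesis. Replacing \<open>C\<close> by \<open>max C 0\<close> makes the bound monotone in the
  other factors.\<close>

lemma dev_distinct_le:
  assumes "r \<ge> 1"
  shows "\<exists>C\<ge>0. \<forall>p h. prime p \<longrightarrow> length h = r \<longrightarrow> distinct (map (\<lambda>a. a mod int p) (0 # h)) \<longrightarrow>
    \<bar>dev p h\<bar> \<le> C * real p powr (-\<epsilon>) * \<rho> p"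
proof -
  obtain C where C: "\<And>p h. prime p \<Longrightarrow> length h = Suc r - 1 \<Longrightarrow> distinct (map (\<lambda>a. a mod int p) (0 # h)) \<Longrightarrow>
     (\<exists>E::real. real (num_tuples p h (\<Omega> p)) = density p (\<Omega> p) ^ Suc r * real p * (1 + E) \<and>
                \<bar>E\<bar> \<le> C * (1 - density p (\<Omega> p)) * real p powr (-\<epsilon>))"
    using tuples[of "Suc r"] assms by auto
  have "\<bar>dev p h\<bar> \<le> max C 0 * real p powr (-\<epsilon>) * \<rho> p"
    if h: "prime p" "length h = r" "distinct (map (\<lambda>a. a mod int p) (0 # h))" for p h
  proof -
    obtain E where E: "real (num_tuples p h (\<Omega> p)) = density p (\<Omega> p) ^ Suc r * real p * (1 + E)"
      "\<bar>E\<bar> \<le> C * (1 - density p (\<Omega> p)) * real p powr (-\<epsilon>)" using C[OF h(1) _ h(3)] h(2) by auto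
    have p: "real p > 0" using prime_gt_0_nat[OF h(1)] by simp
    have sp: "s p \<ge> 1" using s_ge_1[OF h(1)] .
    have "ncount p h (\<Omega> p) = (density p (\<Omega> p) * s p) ^ Suc r * (1 + E)"
      unfolding ncount_def h(2) E(1) using p by (simp add: power_mult_distrib)
    also have "density p (\<Omega> p) * s p = 1" using sp by (simp add: density_def)
    finally have "dev p h = E" by (simp add: dev_def)
    then have "\<bar>dev p h\<bar> \<le> C * (real p powr (-\<epsilon>) * \<rho> p)" using E(2) by (simp add: density_def \<rho>_def mult_ac)
    also have "\<dots> \<le> max C 0 * (real p powr (-\<epsilon>) * \<rho> p)"
      using \<rho>_bounds[OF h(1)] by (intro mult_right_mono) auto
    finally show ?thesis by (simp add: mult_ac)
  qed
  then show ?thesis by (intro exI[of _ "max C 0"]) auto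
qed

text \<open>Splitting the exponent as \<open>\<eta> / k\<close> makes \<open>s p ^ k\<close> cost
  \<open>p powr \<eta>\<close>, so the base is of order \<open>p powr (2 * \<eta>)\<close> and its
  \<open>K\<close>-th power at most of order \<open>p powr (1/2)\<close>. The chord inequality
  \<open>power_one_plus_mult_le\<close> keeps the factor \<open>\<rho> p\<close>.\<close>

lemma power_bad_factor_le:
  assumes \<eta>: "\<eta> > 0" "4 * \<eta> * real K \<le> 1"
  shows "\<exists>B\<ge>0. \<forall>p. prime p \<longrightarrow>
    (1 + real (Suc r) * real p powr \<eta> * s p ^ Suc r * \<rho> p) ^ K \<le> 1 + B * real p powr (1/2) * \<rho> p"
proof -
  define k where "k = Suc r"
  have k: "real k > 0" by (simp add: k_def)
  obtain b where b: "b \<ge> 1" "\<And>p. prime p \<Longrightarrow> s p \<le> b * real p powr (\<eta> / k)"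
    using s_le[of "\<eta> / k"] \<eta> k by auto
  define B where "B = (1 + real k * b ^ k) ^ K"
  have "(1 + real k * real p powr \<eta> * s p ^ k * \<rho> p) ^ K \<le> 1 + B * real p powr (1/2) * \<rho> p"
    if p: "prime p" for p
  proof -
    define a where "a = real k * real p powr \<eta> * s p ^ k"
    have p1: "real p \<ge> 1" using prime_ge_1_nat[OF p] by simp
    note \<rho> = \<rho>_bounds[OF p]
    have a0: "a \<ge> 0" using s_ge_1[OF p] by (simp add: a_def)
    have "s p ^ k \<le> (b * real p powr (\<eta> / k)) ^ k"
      using b(2)[OF p] s_ge_1[OF p] by (intro power_mono) auto
    also have "\<dots> = b ^ k * (real p powr (\<eta> / k)) ^ k" by (rule power_mult_distrib)
    also have "(real p powr (\<eta> / k)) ^ k = real p powr \<eta>"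
      using p1 k by (subst powr_power) auto
    finally have "a \<le> real k * real p powr \<eta> * (b ^ k * real p powr \<eta>)"
      unfolding a_def using k by (intro mult_left_mono) auto
    also have "\<dots> = real k * b ^ k * real p powr (2 * \<eta>)"
      by (simp add: mult_ac flip: powr_add)
    finally have "1 + a \<le> 1 * real p powr (2 * \<eta>) + real k * b ^ k * real p powr (2 * \<eta>)"
      using ge_one_powr_ge_zero[OF p1, of "2 * \<eta>"] \<eta> by linarith
    also have "\<dots> = (1 + real k * b ^ k) * real p powr (2 * \<eta>)" by (simp add: algebra_simps)
    finally have "(1 + a) ^ K \<le> ((1 + real k * b ^ k) * real p powr (2 * \<eta>)) ^ K"
      using a0 by (intro power_mono) auto
    also have "\<dots> = B * real p powr (real K * (2 * \<eta>))"
      using p1 by (simp add: power_mult_distrib B_def powr_power)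
    also have "\<dots> \<le> B * real p powr (1/2)"
      using \<eta> p1 b by (intro mult_left_mono powr_mono) (auto simp: B_def mult_ac)
    finally have "(1 + a) ^ K \<le> B * real p powr (1/2)" .
    then have "\<rho> p * ((1 + a) ^ K - 1) \<le> \<rho> p * (B * real p powr (1/2))"
      using \<rho> by (intro mult_left_mono) auto
    moreover have "(1 + \<rho> p * a) ^ K \<le> 1 + \<rho> p * ((1 + a) ^ K - 1)"
      by (rule power_one_plus_mult_le[OF \<rho>(1,2) a0])
    ultimately have "(1 + \<rho> p * a) ^ K \<le> 1 + \<rho> p * (B * real p powr (1/2))" by linarith
    then show ?thesis by (simp add: a_def mult_ac)
  qed
  moreover have "B \<ge> 0" using b by (simp add: B_def)
  ultimately show ?thesis unfolding k_def by blast
qed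

text \<open>Rankin's trick: a set \<open>G\<close> with \<open>\<Prod>G > D\<close> is weighted by \<open>(\<Prod>G / D)\<^sup>\<eta>\<close>.\<close>
lemma sum_large_prod_dev_le:
  assumes P: "finite P" "\<forall>p\<in>P. prime p" and D: "D \<ge> 1" and \<eta>: "\<eta> > 0"
  shows "(\<Sum>G\<in>{G\<in>Pow P. real (\<Prod>G) > D}. \<Prod>p\<in>G. \<bar>dev p h\<bar>)
    \<le> D powr (-\<eta>) * (\<Prod>p\<in>P. 1 + real p powr \<eta> * \<bar>dev p h\<bar>)"
proof -
  have "(\<Sum>G\<in>{G\<in>Pow P. real (\<Prod>G) > D}. \<Prod>p\<in>G. \<bar>dev p h\<bar>)
    \<le> (\<Sum>G\<in>{G\<in>Pow P. real (\<Prod>G) > D}. D powr (-\<eta>) * (\<Prod>p\<in>G. real p powr \<eta> * \<bar>dev p h\<bar>))"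
  proof (rule sum_mono)
    fix G assume G: "G \<in> {G\<in>Pow P. real (\<Prod>G) > D}"
    have "1 = D powr (-\<eta>) * D powr \<eta>" using D by (simp flip: powr_add)
    also have "\<dots> \<le> D powr (-\<eta>) * real (\<Prod>G) powr \<eta>"
      using D G \<eta> by (intro mult_left_mono powr_mono2) auto
    also have "real (\<Prod>G) powr \<eta> = (\<Prod>p\<in>G. real p powr \<eta>)"
      by (simp add: prod_powr_distrib)
    finally have "1 * (\<Prod>p\<in>G. \<bar>dev p h\<bar>)
      \<le> (D powr (-\<eta>) * (\<Prod>p\<in>G. real p powr \<eta>)) * (\<Prod>p\<in>G. \<bar>dev p h\<bar>)"
      by (intro mult_right_mono prod_nonneg) auto
    then show "(\<Prod>p\<in>G. \<bar>dev p h\<bar>) \<le> D powr (-\<eta>) * (\<Prod>p\<in>G. real p powr \<eta> * \<bar>dev p h\<bar>)"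
      by (simp add: prod.distrib mult_ac)
  qed
  also have "\<dots> \<le> (\<Sum>G\<in>Pow P. D powr (-\<eta>) * (\<Prod>p\<in>G. real p powr \<eta> * \<bar>dev p h\<bar>))"
    by (rule sum_mono2) (use P in \<open>auto intro!: mult_nonneg_nonneg prod_nonneg\<close>)
  also have "\<dots> = D powr (-\<eta>) * (\<Prod>p\<in>P. 1 + real p powr \<eta> * \<bar>dev p h\<bar>)"
    by (simp add: prod_one_plus[OF P(1)] sum_distrib_left)
  finally show ?thesis .
qed

text \<open>At each prime either the entries of \<open>0 # h\<close> are distinct modulo
  \<open>p\<close> and the hypothesis gives the harmless factor \<open>g p\<close>, or
  \<open>p\<close> divides one of the differences and a factor \<open>1 + f p\<close> is charged to
  that difference. Averaged over \<open>h\<close>, differences divisible by \<open>p\<close> are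
  rare. Note the order of quantifiers: \<open>\<eta>\<close> is fixed before
  \<open>\<delta>\<close>, so \<open>\<delta>\<close> may later be a fraction of
  \<open>\<eta>\<close>.\<close>

lemma sum_large_dev_le:
  assumes r: "r \<ge> 1"
  shows "\<exists>\<eta>>0. \<forall>\<delta>>0. \<exists>B>0. \<forall>P D U H. finite P \<longrightarrow> (\<forall>p\<in>P. prime p) \<longrightarrow> D \<ge> 1 \<longrightarrow> U \<subseteq> {1..int H} \<longrightarrow>
    (\<Sum>h\<in>{h. length h = r \<and> distinct h \<and> set h \<subseteq> U}.
       \<Sum>G\<in>{G\<in>Pow P. real (\<Prod>G) > D}. \<Prod>p\<in>G. \<bar>dev p h\<bar>)
    \<le> B * D powr (-\<eta>) * (\<Prod>p\<in>P. s p) powr \<delta> * real H ^ r"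
proof -
  define I where "I = index_pairs r"
  define K where "K = card I"
  have "(0, 0) \<in> I" using r by (auto simp: I_def index_pairs_def)
  then have I0: "I \<noteq> {}" by blast
  have finI: "finite I" by (simp add: I_def)
  have K: "real K \<ge> 1" using I0 finI by (simp add: K_def card_gt_0_iff Suc_leI)
  \<comment> \<open>The bound \<open>\<epsilon> / 2\<close> leaves a decay of
    \<open>p powr (-(\<epsilon>/2))\<close> at primes without collisions; \<open>1 / (4 * K)\<close>
    is what the \<open>K\<close>-th power in \<open>power_bad_factor_le\<close> tolerates.\<close>
  define \<eta> where "\<eta> = min (\<epsilon> / 2) (1 / (4 * real K))"
  have \<eta>: "\<eta> > 0" "\<eta> \<le> \<epsilon> / 2" "4 * \<eta> * real K \<le> 1"
  proof -
    show "\<eta> > 0" "\<eta> \<le> \<epsilon> / 2" using eps K by (auto simp: \<eta>_def)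
    have "\<eta> \<le> 1 / (4 * real K)" by (simp add: \<eta>_def)
    then show "4 * \<eta> * real K \<le> 1" using K by (simp add: field_simps)
  qed
  obtain C where C: "C \<ge> 0" "\<And>p h. prime p \<Longrightarrow> length h = r \<Longrightarrow> distinct (map (\<lambda>a. a mod int p) (0 # h)) \<Longrightarrow>
    \<bar>dev p h\<bar> \<le> C * real p powr (-\<epsilon>) * \<rho> p" using dev_distinct_le[OF r] by blast
  define f where "f p = real (Suc r) * real p powr \<eta> * s p ^ Suc r * \<rho> p" for p
  define g where "g p = 1 + C * real p powr (-(\<epsilon>/2)) * \<rho> p" for p
  obtain b where b: "b \<ge> 0" "\<And>p. prime p \<Longrightarrow> (1 + f p) ^ K \<le> 1 + b * real p powr (1/2) * \<rho> p"
    using power_bad_factor_le[OF \<eta>(1,3), of r] unfolding f_def by blast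
  have f0: "f p \<ge> 0" if "prime p" for p
    using \<rho>_bounds[OF that] s_ge_1[OF that] by (simp add: f_def)
  have g1: "g p \<ge> 1" if "prime p" for p
    using \<rho>_bounds[OF that] C(1) by (simp add: g_def)
  define diff where "diff h z = (0 # h) ! Suc (fst z) - (0 # h) ! snd z" for h :: "int list" and z
  have factor: "1 + real p powr \<eta> * \<bar>dev p h\<bar> \<le> g p * (\<Prod>z\<in>I. if int p dvd diff h z then 1 + f p else 1)"
    if p: "prime p" and h: "length h = r" for p h
  proof (cases "distinct (map (\<lambda>a. a mod int p) (0 # h))")
    case True
    have p1: "real p \<ge> 1" using prime_ge_1_nat[OF p] by simp
    have "real p powr \<eta> * \<bar>dev p h\<bar> \<le> real p powr \<eta> * (C * real p powr (-\<epsilon>) * \<rho> p)"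
      by (intro mult_left_mono C(2)[OF p h True]) auto
    also have "\<dots> = C * real p powr (\<eta> - \<epsilon>) * \<rho> p" by (simp add: mult_ac powr_diff powr_minus divide_simps)
    also have "\<dots> \<le> C * real p powr (-(\<epsilon>/2)) * \<rho> p"
      using \<eta> C(1) \<rho>_bounds[OF p] p1 by (intro mult_right_mono mult_left_mono powr_mono) auto
    finally have "1 + real p powr \<eta> * \<bar>dev p h\<bar> \<le> g p * 1" by (simp add: g_def)
    also have "\<dots> \<le> g p * (\<Prod>z\<in>I. if int p dvd diff h z then 1 + f p else 1)"
      using f0[OF p] g1[OF p] by (intro mult_left_mono prod_ge_1) auto
    finally show ?thesis .
  next
    case False
    from not_distinct_index_pairs[OF this] obtain i j where ij: "(i, j) \<in> I"
      "(0 # h) ! Suc i mod int p = (0 # h) ! j mod int p" by (auto simp: I_def h)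
    then have dv: "int p dvd diff h (i, j)" by (simp add: diff_def mod_eq_dvd_iff)
    have "real p powr \<eta> * \<bar>dev p h\<bar> \<le> real p powr \<eta> * (real (Suc r) * \<rho> p * s p ^ Suc r)"
      using abs_dev_le[OF p, of h] h by (intro mult_left_mono) auto
    then have "1 + real p powr \<eta> * \<bar>dev p h\<bar> \<le> 1 + f p" by (simp add: f_def mult_ac)
    also have "\<dots> = (\<Prod>z\<in>{(i,j)}. if int p dvd diff h z then 1 + f p else 1)" using dv by simp
    also have "\<dots> \<le> (\<Prod>z\<in>I. if int p dvd diff h z then 1 + f p else 1)"
      by (rule prod_mono2) (use finI ij f0[OF p] in auto)
    also have "\<dots> = 1 * (\<Prod>z\<in>I. if int p dvd diff h z then 1 + f p else 1)" by simp
    also have "\<dots> \<le> g p * (\<Prod>z\<in>I. if int p dvd diff h z then 1 + f p else 1)"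
      using g1[OF p] f0[OF p] by (intro mult_right_mono prod_nonneg) auto
    finally show ?thesis .
  qed
  show ?thesis
  proof (rule exI[of _ \<eta>], rule conjI[OF \<eta>(1)], intro allI impI)
    fix \<delta> :: real assume \<delta>: "\<delta> > 0"
    obtain B1 where B1: "B1 > 0" "\<And>F. finite F \<Longrightarrow> (\<forall>p\<in>F. prime p) \<Longrightarrow>
      (\<Prod>p\<in>F. g p) \<le> B1 * (\<Prod>p\<in>F. s p) powr (\<delta>/2)"
      using prod_one_plus_\<rho>_le[of C "\<epsilon>/2" "\<delta>/2"] C(1) eps \<delta> unfolding g_def by auto
    obtain B2 where B2: "B2 > 0" "\<And>F. finite F \<Longrightarrow> (\<forall>p\<in>F. prime p) \<Longrightarrow>
      (\<Prod>p\<in>F. 1 + b * real p powr (-(1/2)) * \<rho> p) \<le> B2 * (\<Prod>p\<in>F. s p) powr (\<delta>/2)"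
      using prod_one_plus_\<rho>_le[of b "1/2" "\<delta>/2"] b(1) \<delta> by auto
    define B where "B = B1 * real K * 2 * B2"
    have "(\<Sum>h\<in>{h. length h = r \<and> distinct h \<and> set h \<subseteq> U}.
       \<Sum>G\<in>{G\<in>Pow P. real (\<Prod>G) > D}. \<Prod>p\<in>G. \<bar>dev p h\<bar>)
      \<le> B * D powr (-\<eta>) * (\<Prod>p\<in>P. s p) powr \<delta> * real H ^ r"
      if P: "finite P" "\<forall>p\<in>P. prime p" and D: "D \<ge> 1" and U: "U \<subseteq> {1..int H}" for P D U H
    proof -
      have finU: "finite U" using U finite_subset by blast
      have UH: "card U \<le> H" using card_mono[OF _ U] by simp
      define S where "S = (\<Prod>p\<in>P. s p)"
      \<comment> \<open>Entries of \<open>h\<close> are positive and distinct, so no difference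
        occurring below is 0. Setting \<open>y 0 = 0\<close> makes it safe to sum over all lists
        later on: a zero difference would otherwise contribute the product over the whole of
        \<open>P\<close>.\<close>
      define y where "y n = (if n = 0 then 0
        else \<Prod>p\<in>P. if int p dvd n then 1 + b * real p powr (1/2) * \<rho> p else 1)" for n :: int
      have bp0: "b * real p powr (1/2) * \<rho> p \<ge> 0" if "p \<in> P" for p
        using P that \<rho>_bounds[of p] b(1) by simp
      have y0: "y n \<ge> 0" for n
        using bp0 by (auto simp: y_def intro!: prod_nonneg add_nonneg_nonneg)
      have pt: "(\<Prod>p\<in>P. 1 + real p powr \<eta> * \<bar>dev p h\<bar>) \<le> B1 * S powr (\<delta>/2) * (\<Sum>z\<in>I. y (diff h z))"
        if h: "length h = r" "distinct h" "set h \<subseteq> U" for h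
      proof -
        define x where "x z = (\<Prod>p\<in>P. if int p dvd diff h z then 1 + f p else 1)" for z
        have x0: "x z \<ge> 0" for z unfolding x_def using P f0 by (intro prod_nonneg) (auto intro!: add_nonneg_nonneg)
        have "(\<Prod>p\<in>P. 1 + real p powr \<eta> * \<bar>dev p h\<bar>)
          \<le> (\<Prod>p\<in>P. g p * (\<Prod>z\<in>I. if int p dvd diff h z then 1 + f p else 1))"
          by (rule prod_mono) (use factor h P in \<open>auto intro!: add_nonneg_nonneg\<close>)
        also have "\<dots> = (\<Prod>p\<in>P. g p) * (\<Prod>p\<in>P. \<Prod>z\<in>I. if int p dvd diff h z then 1 + f p else 1)"
          by (rule prod.distrib)
        also have "(\<Prod>p\<in>P. \<Prod>z\<in>I. if int p dvd diff h z then 1 + f p else 1) = (\<Prod>z\<in>I. x z)"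
          unfolding x_def by (rule prod.swap)
        also have "(\<Prod>p\<in>P. g p) * (\<Prod>z\<in>I. x z) \<le> (B1 * S powr (\<delta>/2)) * (\<Sum>z\<in>I. y (diff h z))"
        proof (rule mult_mono)
          show "(\<Prod>p\<in>P. g p) \<le> B1 * S powr (\<delta>/2)" using B1(2)[OF P] by (simp add: S_def)
          have "(\<Prod>z\<in>I. x z) \<le> (\<Sum>z\<in>I. x z ^ K)"
            unfolding K_def by (rule prod_le_sum_power_card[OF finI I0 x0])
          also have "\<dots> \<le> (\<Sum>z\<in>I. y (diff h z))"
          proof (rule sum_mono)
            fix z assume z: "z \<in> I"
            have "0 \<notin> U" using U by auto
            then have "distinct (0 # h)" using h by auto
            then have nz: "diff h z \<noteq> 0"
              using distinct_index_pairs[of h "fst z" "snd z"] z h by (simp add: I_def diff_def)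
            have "x z ^ K = (\<Prod>p\<in>P. if int p dvd diff h z then (1 + f p) ^ K else 1)"
              unfolding x_def prod_power_distrib by (intro prod.cong) auto
            also have "\<dots> \<le> (\<Prod>p\<in>P. if int p dvd diff h z then 1 + b * real p powr (1/2) * \<rho> p else 1)"
              by (rule prod_mono) (use b(2) P f0 in \<open>auto intro!: zero_le_power add_nonneg_nonneg\<close>)
            also have "\<dots> = y (diff h z)" using nz by (simp add: y_def)
            finally show "x z ^ K \<le> y (diff h z)" .
          qed
          finally show "(\<Prod>z\<in>I. x z) \<le> (\<Sum>z\<in>I. y (diff h z))" .
          show "0 \<le> (\<Prod>z\<in>I. x z)" by (intro prod_nonneg x0)
          show "0 \<le> B1 * S powr (\<delta>/2)" using B1(1) by simp
        qed
        finally show ?thesis .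
      qed
      let ?DL = "{h. length h = r \<and> distinct h \<and> set h \<subseteq> U}"
      let ?AL = "{h. length h = r \<and> set h \<subseteq> U}"
      have sumy: "(\<Sum>n\<in>{- int H..int H}. y n) \<le> 2 * real H * (B2 * S powr (\<delta>/2))"
      proof -
        have "(\<Sum>n\<in>{- int H..int H}. y n) = (\<Sum>n\<in>{- int H..int H} - {0}. y n)"
          by (rule sum.mono_neutral_right) (auto simp: y_def)
        also have "\<dots> = (\<Sum>n\<in>{- int H..int H} - {0}.
            \<Prod>p\<in>P. if int p dvd n then 1 + b * real p powr (1/2) * \<rho> p else 1)"
          by (rule sum.cong) (auto simp: y_def)
        \<comment> \<open>Multiples of \<open>p\<close> have density \<open>1 / p\<close>; this
          turns the loss \<open>p powr (1/2)\<close> into the decaying weight that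
          \<open>prod_one_plus_\<rho>_le\<close> requires.\<close>
        also have "\<dots> \<le> 2 * real H * (\<Prod>p\<in>P. 1 + b * real p powr (1/2) * \<rho> p / real p)"
          by (rule sum_divisor_products_le[OF P bp0])
        also have "(\<Prod>p\<in>P. 1 + b * real p powr (1/2) * \<rho> p / real p)
            = (\<Prod>p\<in>P. 1 + b * real p powr (-(1/2)) * \<rho> p)"
        proof (rule prod.cong[OF refl])
          fix p assume "p \<in> P"
          then have "real p > 0" using P prime_gt_0_nat by auto
          then have "real p powr (1/2) / real p = real p powr (-(1/2))"
            using powr_diff[of "real p" "1/2" 1] by simp
          moreover have "1 + b * real p powr (1/2) * \<rho> p / real p = 1 + b * (real p powr (1/2) / real p) * \<rho> p"
            by simp
          ultimately show "1 + b * real p powr (1/2) * \<rho> p / real p = 1 + b * real p powr (-(1/2)) * \<rho> p"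
            by (simp only:)
        qed
        also have "2 * real H * (\<Prod>p\<in>P. 1 + b * real p powr (-(1/2)) * \<rho> p) \<le> 2 * real H * (B2 * S powr (\<delta>/2))"
          unfolding S_def by (intro mult_left_mono B2(2)[OF P]) auto
        finally show ?thesis .
      qed
      have "(\<Sum>h\<in>?DL. \<Sum>z\<in>I. y (diff h z)) \<le> (\<Sum>h\<in>?AL. \<Sum>z\<in>I. y (diff h z))"
        by (rule sum_mono2) (use finU y0 finite_lists_of_length in \<open>auto intro!: sum_nonneg\<close>)
      also have "\<dots> = (\<Sum>z\<in>I. \<Sum>h\<in>?AL. y (diff h z))" by (rule sum.swap)
      also have "\<dots> \<le> (\<Sum>z\<in>I. real (card U) ^ (r - 1) * (\<Sum>n\<in>{- int H..int H}. y n))"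
        unfolding diff_def
        by (rule sum_mono, rule sum_lists_difference_le[OF U]) (auto simp: I_def index_pairs_def y0)
      also have "\<dots> = real K * (real (card U) ^ (r - 1) * (\<Sum>n\<in>{- int H..int H}. y n))"
        by (simp add: K_def)
      also have "\<dots> \<le> real K * (real H ^ (r - 1) * (2 * real H * (B2 * S powr (\<delta>/2))))"
        using UH y0 by (intro mult_left_mono mult_mono power_mono sumy) (auto intro!: sum_nonneg)
      also have "\<dots> = real K * 2 * B2 * S powr (\<delta>/2) * real H ^ r"
        using r by (simp add: power_eq_if mult_ac)
      finally have avg: "(\<Sum>h\<in>?DL. \<Sum>z\<in>I. y (diff h z)) \<le> real K * 2 * B2 * S powr (\<delta>/2) * real H ^ r" .
      have "(\<Sum>h\<in>?DL. \<Sum>G\<in>{G\<in>Pow P. real (\<Prod>G) > D}. \<Prod>p\<in>G. \<bar>dev p h\<bar>)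
        \<le> (\<Sum>h\<in>?DL. D powr (-\<eta>) * (B1 * S powr (\<delta>/2) * (\<Sum>z\<in>I. y (diff h z))))"
      proof (rule sum_mono)
        fix h assume h: "h \<in> ?DL"
        have "(\<Sum>G\<in>{G\<in>Pow P. real (\<Prod>G) > D}. \<Prod>p\<in>G. \<bar>dev p h\<bar>)
          \<le> D powr (-\<eta>) * (\<Prod>p\<in>P. 1 + real p powr \<eta> * \<bar>dev p h\<bar>)"
          by (rule sum_large_prod_dev_le[OF P D \<eta>(1)])
        also have "\<dots> \<le> D powr (-\<eta>) * (B1 * S powr (\<delta>/2) * (\<Sum>z\<in>I. y (diff h z)))"
          using h by (intro mult_left_mono pt) auto
        finally show "(\<Sum>G\<in>{G\<in>Pow P. real (\<Prod>G) > D}. \<Prod>p\<in>G. \<bar>dev p h\<bar>)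
          \<le> D powr (-\<eta>) * (B1 * S powr (\<delta>/2) * (\<Sum>z\<in>I. y (diff h z)))" .
      qed
      also have "\<dots> = D powr (-\<eta>) * (B1 * S powr (\<delta>/2) * (\<Sum>h\<in>?DL. \<Sum>z\<in>I. y (diff h z)))"
        by (simp only: sum_distrib_left)
      also have "\<dots> \<le> D powr (-\<eta>) * (B1 * S powr (\<delta>/2) * (real K * 2 * B2 * S powr (\<delta>/2) * real H ^ r))"
        using B1(1) by (intro mult_left_mono avg) auto
      also have "\<dots> = B * D powr (-\<eta>) * (S powr (\<delta>/2) * S powr (\<delta>/2)) * real H ^ r"
        by (simp add: B_def mult_ac)
      also have "S powr (\<delta>/2) * S powr (\<delta>/2) = S powr \<delta>" by (simp flip: powr_add)
      finally show ?thesis by (simp add: S_def)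
    qed
    moreover have "B > 0" using B1 B2 K by (simp add: B_def)
    ultimately show "\<exists>B>0. \<forall>P D U H. finite P \<longrightarrow> (\<forall>p\<in>P. prime p) \<longrightarrow> D \<ge> 1 \<longrightarrow> U \<subseteq> {1..int H} \<longrightarrow>
      (\<Sum>h\<in>{h. length h = r \<and> distinct h \<and> set h \<subseteq> U}.
         \<Sum>G\<in>{G\<in>Pow P. real (\<Prod>G) > D}. \<Prod>p\<in>G. \<bar>dev p h\<bar>)
      \<le> B * D powr (-\<eta>) * (\<Prod>p\<in>P. s p) powr \<delta> * real H ^ r" by blast
  qed
qed

text \<open>Expand each \<open>ncount - 1\<close> with signs over the subsets \<open>X\<close> of
  \<open>G\<close>. The normalised count for \<open>\<Prod>X\<close> has sum close to
  \<open>\<sigma> ^ r\<close>, the same main term for every \<open>X\<close>, so the signs cancel it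
  unless \<open>G\<close> is empty. There are \<open>2 ^ card G \<le> \<Prod>G \<le> D\<close> error
  terms.\<close>

lemma sum_small_dev_le:
  assumes G: "finite G" "\<forall>p\<in>G. prime p" "real (\<Prod>G) \<le> D"
    and U: "finite U" "equidist L \<sigma> U" and \<sigma>: "\<sigma> \<ge> 0"
  shows "\<bar>(\<Sum>h\<in>{h. length h = r \<and> set h \<subseteq> U}. \<Prod>p\<in>G. dev p h) - (if G = {} then \<sigma> ^ r else 0)\<bar>
    \<le> D * (real r * (D * L) * (\<sigma> + D * L) ^ (r - 1))"
proof -
  let ?AL = "{h. length h = r \<and> set h \<subseteq> U}"
  define R where "R = real r * (D * L) * (\<sigma> + D * L) ^ (r - 1)"
  define sg where "sg X = (-1::real) ^ (card G - card X)" for X :: "nat set"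
  have L0: "L \<ge> 0" using equidist_card[OF U(2)] by linarith
  have D0: "D \<ge> 0" using G(3) of_nat_0_le_iff order_trans by blast
  have R0: "R \<ge> 0" using L0 D0 \<sigma> by (simp add: R_def)
  have X: "\<bar>(\<Sum>h\<in>?AL. \<Prod>p\<in>X. ncount p h (\<Omega> p)) - \<sigma> ^ r\<bar> \<le> R" if X: "X \<in> Pow G" for X
  proof -
    have fX: "finite X" "\<forall>p\<in>X. prime p" using X G finite_subset by auto
    have sub: "\<forall>p\<in>X. \<Omega> p \<subseteq> {0..<int p}" using fX subset by auto
    let ?e = "\<Prod>X"
    have "card (crt_set \<Omega> ?e) = (\<Prod>p\<in>X. card (\<Omega> p))" by (rule card_crt_set[OF fX sub])
    moreover have "card (\<Omega> p) > 0" if "p \<in> X" for p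
      using nonempty subset fX that finite_subset[of "\<Omega> p" "{0..<int p}"] by (auto simp: card_gt_0_iff)
    ultimately have "card (crt_set \<Omega> ?e) > 0" by (auto intro: prod_pos)
    then have ne: "crt_set \<Omega> ?e \<noteq> {}" by (metis card.empty less_irrefl)
    have "real ?e \<le> real (\<Prod>G)"
    proof -
      have "?e \<le> \<Prod>G" using G X by (intro dvd_imp_le prod_dvd_prod_subset) (auto intro!: prod_pos prime_gt_0_nat)
      then show ?thesis by (simp only: of_nat_le_iff)
    qed
    then have eD: "real ?e \<le> D" using G(3) by linarith
    have "\<bar>(\<Sum>h\<in>?AL. ncount ?e h (crt_set \<Omega> ?e)) - \<sigma> ^ r\<bar> \<le> real r * (real ?e * L) * (\<sigma> + real ?e * L) ^ (r - 1)"
      by (rule sum_ncount_lists[OF crt_set_subset ne U \<sigma>])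
    also have "\<dots> \<le> R" unfolding R_def
      using eD L0 \<sigma> D0 by (intro mult_mono power_mono add_mono) (auto simp del: of_nat_prod)
    finally show ?thesis by (simp add: ncount_crt_set[OF fX sub])
  qed
  have "(\<Sum>h\<in>?AL. \<Prod>p\<in>G. dev p h) = (\<Sum>h\<in>?AL. \<Sum>X\<in>Pow G. sg X * (\<Prod>p\<in>X. ncount p h (\<Omega> p)))"
    unfolding dev_def sg_def prod_diff_conv_sum'[OF G(1)] by simp
  also have "\<dots> = (\<Sum>X\<in>Pow G. sg X * (\<Sum>h\<in>?AL. \<Prod>p\<in>X. ncount p h (\<Omega> p)))"
    by (subst sum.swap) (simp add: sum_distrib_left)
  finally have 1: "(\<Sum>h\<in>?AL. \<Prod>p\<in>G. dev p h) = (\<Sum>X\<in>Pow G. sg X * (\<Sum>h\<in>?AL. \<Prod>p\<in>X. ncount p h (\<Omega> p)))" .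
  \<comment> \<open>The alternating sum of signs is evaluated by applying the same expansion to a
    product of zeros.\<close>
  have "(\<Prod>p\<in>G. 1 - (1::real)) = (\<Sum>X\<in>Pow G. sg X)"
    unfolding sg_def prod_diff_conv_sum'[OF G(1)] by simp
  moreover have "(\<Prod>p\<in>G. 1 - (1::real)) = (if G = {} then 1 else 0)" using G(1) by (simp add: card_gt_0_iff)
  ultimately have 2: "(if G = {} then \<sigma> ^ r else 0) = (\<Sum>X\<in>Pow G. sg X * \<sigma> ^ r)"
    by (simp flip: sum_distrib_right)
  have "\<bar>(\<Sum>h\<in>?AL. \<Prod>p\<in>G. dev p h) - (if G = {} then \<sigma> ^ r else 0)\<bar>
    = \<bar>\<Sum>X\<in>Pow G. sg X * ((\<Sum>h\<in>?AL. \<Prod>p\<in>X. ncount p h (\<Omega> p)) - \<sigma> ^ r)\<bar>"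
    unfolding 1 2 by (simp add: right_diff_distrib sum_subtractf)
  also have "\<dots> \<le> (\<Sum>X\<in>Pow G. \<bar>sg X * ((\<Sum>h\<in>?AL. \<Prod>p\<in>X. ncount p h (\<Omega> p)) - \<sigma> ^ r)\<bar>)"
    by (rule sum_abs)
  also have "\<dots> \<le> (\<Sum>X\<in>Pow G. R)"
    by (rule sum_mono) (use X in \<open>auto simp: abs_mult sg_def\<close>)
  also have "\<dots> = 2 ^ card G * R" by (simp add: card_Pow G(1))
  also have "\<dots> \<le> D * R"
  proof (rule mult_right_mono[OF _ R0])
    have "real (2 ^ card G) \<le> real (\<Prod>G)"
      using two_power_card_le_prod_primes[OF G(2)] by (simp only: of_nat_le_iff)
    then have "real (2 ^ card G) \<le> D" using G(3) by (rule order_trans)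
    then show "2 ^ card G \<le> D" by simp
  qed
  finally show ?thesis by (simp add: R_def)
qed

text \<open>Three errors are compared with the trivial size \<open>S ^ r\<close>: the discrepancy
  for small \<open>G\<close>, the lists with repetitions for small \<open>G\<close>, and the Rankin
  tail for large \<open>G\<close>. The constants do not depend on \<open>q\<close>,
  \<open>U\<close>, \<open>\<sigma>\<close> or \<open>H\<close>, which is what allows
  \<open>q\<close> to run through a sequence.\<close>

lemma correlation:
  assumes r: "r \<ge> 1" and c: "c > 0" and L: "L \<ge> 0"
  shows "\<exists>B a. a > 0 \<and> (\<forall>q U \<sigma> H. squarefree q \<longrightarrow> U \<subseteq> {1..int H} \<longrightarrow>
     real H \<le> c * inv_density q (crt_set \<Omega> q) \<longrightarrow> equidist L \<sigma> U \<longrightarrow>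
     0 \<le> \<sigma> \<longrightarrow> \<sigma> \<le> c * inv_density q (crt_set \<Omega> q) \<longrightarrow>
     \<bar>real (\<Sum>h\<in>{h. length h = r \<and> distinct h \<and> set h \<subseteq> U}. num_tuples q h (crt_set \<Omega> q))
        / real (card (crt_set \<Omega> q)) - (\<sigma> / inv_density q (crt_set \<Omega> q)) ^ r\<bar>
     \<le> B * inv_density q (crt_set \<Omega> q) powr (-a))"
proof -
  obtain \<eta> where \<eta>: "\<eta> > 0" "\<And>\<delta>. \<delta> > 0 \<Longrightarrow> \<exists>B>0. \<forall>P D U H. finite P \<longrightarrow> (\<forall>p\<in>P. prime p) \<longrightarrow> D \<ge> 1 \<longrightarrow> U \<subseteq> {1..int H} \<longrightarrow>
    (\<Sum>h\<in>{h. length h = r \<and> distinct h \<and> set h \<subseteq> U}.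
       \<Sum>G\<in>{G\<in>Pow P. real (\<Prod>G) > D}. \<Prod>p\<in>G. \<bar>dev p h\<bar>)
    \<le> B * D powr (-\<eta>) * (\<Prod>p\<in>P. s p) powr \<delta> * real H ^ r"
    using sum_large_dev_le[OF r] by blast
  \<comment> \<open>Rankin's trick gains \<open>D powr (-\<eta>) = S powr (-(\<eta>/6))\<close>;
    spending half of that exponent on the collision factors leaves
    \<open>S powr (-(\<eta>/12))\<close>.\<close>
  have "\<eta> / 12 > 0" using \<eta>(1) by simp
  from \<eta>(2)[OF this] obtain B3 where B3: "B3 > 0" "\<And>P D U H. finite P \<Longrightarrow> (\<forall>p\<in>P. prime p) \<Longrightarrow> D \<ge> 1 \<Longrightarrow> U \<subseteq> {1..int H} \<Longrightarrow>
    (\<Sum>h\<in>{h. length h = r \<and> distinct h \<and> set h \<subseteq> U}.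
       \<Sum>G\<in>{G\<in>Pow P. real (\<Prod>G) > D}. \<Prod>p\<in>G. \<bar>dev p h\<bar>)
    \<le> B3 * D powr (-\<eta>) * (\<Prod>p\<in>P. s p) powr (\<eta>/12) * real H ^ r"
    by blast
  obtain B0 where B0: "B0 > 0" "\<And>F h. finite F \<Longrightarrow> (\<forall>p\<in>F. prime p) \<Longrightarrow> length h = r \<Longrightarrow>
    (\<Prod>p\<in>F. \<bar>dev p h\<bar>) \<le> B0 * real (\<Prod>F)" using prod_dev_le[of r] by blast
  define K where "K = real (card (index_pairs r))"
  define a where "a = min (1/2) (\<eta>/12)"
  have a: "a > 0" "a \<le> 1/2" "a \<le> \<eta>/12" using \<eta>(1) by (auto simp: a_def)
  define C1 where "C1 = real r * L * (c + L) ^ (r - 1)"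
  define C2 where "C2 = K * c ^ (r - 1) * B0"
  define C3 where "C3 = B3 * c ^ r"
  have main: "\<bar>real (\<Sum>h\<in>{h. length h = r \<and> distinct h \<and> set h \<subseteq> U}. num_tuples q h (crt_set \<Omega> q))
        / real (card (crt_set \<Omega> q)) - (\<sigma> / inv_density q (crt_set \<Omega> q)) ^ r\<bar>
     \<le> (C1 + C2 + C3) * inv_density q (crt_set \<Omega> q) powr (-a)"
    if q: "squarefree q" and U: "U \<subseteq> {1..int H}" and H: "real H \<le> c * inv_density q (crt_set \<Omega> q)"
      and eq: "equidist L \<sigma> U" and \<sigma>: "0 \<le> \<sigma>" "\<sigma> \<le> c * inv_density q (crt_set \<Omega> q)" for q U \<sigma> H
  proof -
    define P where "P = prime_factors q"
    have P: "finite P" "\<forall>p\<in>P. prime p" by (auto simp: P_def)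
    have subP: "\<forall>p\<in>P. \<Omega> p \<subseteq> {0..<int p}" using P subset by auto
    have qP: "q = \<Prod>P" using squarefree_prod_prime_factors[OF q] by (simp add: P_def)
    have qpos: "q > 0" using q by (intro gr0I) auto
    define A where "A = crt_set \<Omega> q"
    define S where "S = inv_density q A"
    have SP: "S = (\<Prod>p\<in>P. s p)" unfolding S_def A_def qP by (rule inv_density_crt_set[OF P subP])
    have S1: "S \<ge> 1" unfolding SP using P s_ge_1 by (intro prod_ge_1) auto
    have finU: "finite U" using U finite_subset by blast
    have UH: "real (card U) \<le> real H" using card_mono[OF _ U] by simp
    \<comment> \<open>For small \<open>G\<close> the error is of order
      \<open>D * D * S ^ (r - 1)\<close> per set and there are at most \<open>D\<close> sets. The
      exponent 1/6 makes the total \<open>S powr (1/2) * S ^ (r - 1)\<close>, a saving of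
      \<open>S powr (1/2)\<close>.\<close>
    define D where "D = S powr (1/6)"
    have D1: "D \<ge> 1" unfolding D_def using S1 by (intro ge_one_powr_ge_zero) auto
    have D3: "D * D * D = S powr (1/2)" unfolding D_def by (simp flip: powr_add)
    have DS: "D \<le> S" unfolding D_def using S1 powr_mono[of "1/6" 1 S] by simp
    have D2: "D * D \<le> S powr (1/2)" using D1 by (simp flip: D3)
    let ?AL = "{h. length h = r \<and> set h \<subseteq> U}"
    let ?DL = "{h. length h = r \<and> distinct h \<and> set h \<subseteq> U}"
    let ?NL = "{h. length h = r \<and> set h \<subseteq> U \<and> \<not> distinct h}"
    let ?SG = "{G\<in>Pow P. real (\<Prod>G) \<le> D}"
    let ?LG = "{G\<in>Pow P. real (\<Prod>G) > D}"
    have finAL: "finite ?AL" by (rule finite_lists_of_length[OF finU])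
    have finDL: "finite ?DL" by (rule finite_subset[OF _ finAL]) auto
    have finNL: "finite ?NL" by (rule finite_subset[OF _ finAL]) auto
    define dG where "dG G h = (\<Prod>p\<in>G. dev p h)" for G h
    have "ncount q h A = (\<Sum>G\<in>?SG. dG G h) + (\<Sum>G\<in>?LG. dG G h)" for h
    proof -
      have "ncount q h A = (\<Prod>p\<in>P. 1 + dev p h)"
        unfolding A_def qP ncount_crt_set[OF P subP] by (simp add: dev_def)
      also have "\<dots> = (\<Sum>G\<in>Pow P. dG G h)" unfolding dG_def by (rule prod_one_plus[OF P(1)])
      also have "Pow P = ?SG \<union> ?LG" by auto
      also have "(\<Sum>G\<in>?SG \<union> ?LG. dG G h) = (\<Sum>G\<in>?SG. dG G h) + (\<Sum>G\<in>?LG. dG G h)"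
        using P(1) by (intro sum.union_disjoint) auto
      finally show ?thesis .
    qed
    then have 1: "(\<Sum>h\<in>?DL. ncount q h A) = (\<Sum>h\<in>?DL. \<Sum>G\<in>?SG. dG G h) + (\<Sum>h\<in>?DL. \<Sum>G\<in>?LG. dG G h)"
      by (simp only: sum.distrib)
    \<comment> \<open>Only the small sets \<open>G\<close> are summed over all lists, where they
      cancel; the large ones remain on distinct lists.\<close>
    have "?AL = ?DL \<union> ?NL" by auto
    then have "(\<Sum>h\<in>?AL. \<Sum>G\<in>?SG. dG G h) = (\<Sum>h\<in>?DL. \<Sum>G\<in>?SG. dG G h) + (\<Sum>h\<in>?NL. \<Sum>G\<in>?SG. dG G h)"
      using sum.union_disjoint[OF finDL finNL, of "\<lambda>h. \<Sum>G\<in>?SG. dG G h"] by auto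
    moreover have "(\<Sum>h\<in>?AL. \<Sum>G\<in>?SG. dG G h) = (\<Sum>G\<in>?SG. \<Sum>h\<in>?AL. dG G h)" by (rule sum.swap)
    ultimately have 2: "(\<Sum>h\<in>?DL. ncount q h A) = (\<Sum>G\<in>?SG. \<Sum>h\<in>?AL. dG G h)
      - (\<Sum>h\<in>?NL. \<Sum>G\<in>?SG. dG G h) + (\<Sum>h\<in>?DL. \<Sum>G\<in>?LG. dG G h)"
      using 1 by linarith
    have cSG: "real (card ?SG) \<le> D" using D1 by (intro card_prime_sets_le P) auto
    define R where "R = real r * (D * L) * (\<sigma> + D * L) ^ (r - 1)"
    have R0: "R \<ge> 0" unfolding R_def using D1 L \<sigma>(1) by simp
    have T1: "\<bar>(\<Sum>G\<in>?SG. \<Sum>h\<in>?AL. dG G h) - \<sigma> ^ r\<bar> \<le> D * (D * R)"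
    proof -
      have "{} \<in> ?SG" using D1 by simp
      then have "(\<Sum>G\<in>?SG. if G = {} then \<sigma> ^ r else 0) = \<sigma> ^ r"
        using P(1) by (subst sum.delta) auto
      then have "\<bar>(\<Sum>G\<in>?SG. \<Sum>h\<in>?AL. dG G h) - \<sigma> ^ r\<bar>
        = \<bar>\<Sum>G\<in>?SG. ((\<Sum>h\<in>?AL. dG G h) - (if G = {} then \<sigma> ^ r else 0))\<bar>"
        by (simp only: sum_subtractf)
      also have "\<dots> \<le> (\<Sum>G\<in>?SG. \<bar>(\<Sum>h\<in>?AL. dG G h) - (if G = {} then \<sigma> ^ r else 0)\<bar>)" by (rule sum_abs)
      also have "\<dots> \<le> (\<Sum>G\<in>?SG. D * R)"
      proof (rule sum_mono)
        fix G assume "G \<in> ?SG"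
        then have G: "finite G" "\<forall>p\<in>G. prime p" "real (\<Prod>G) \<le> D" using P finite_subset by auto
        show "\<bar>(\<Sum>h\<in>?AL. dG G h) - (if G = {} then \<sigma> ^ r else 0)\<bar> \<le> D * R"
          unfolding dG_def R_def by (rule sum_small_dev_le[OF G finU eq \<sigma>(1)])
      qed
      also have "\<dots> = real (card ?SG) * (D * R)" by simp
      also have "\<dots> \<le> D * (D * R)" using cSG R0 D1 by (intro mult_right_mono) auto
      finally show ?thesis .
    qed
    have "R \<le> real r * (D * L) * ((c + L) * S) ^ (r - 1)"
      unfolding R_def using \<sigma> D1 L DS mult_right_mono[OF DS L]
      by (intro mult_left_mono power_mono) (auto simp: algebra_simps S_def[unfolded A_def, symmetric])
    then have "D * (D * R) \<le> D * (D * (real r * (D * L) * ((c + L) * S) ^ (r - 1)))"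
      using D1 by (intro mult_left_mono) auto
    also have "\<dots> = C1 * (D * D * D) * S ^ (r - 1)" by (simp add: C1_def power_mult_distrib mult_ac)
    finally have T1': "\<bar>(\<Sum>G\<in>?SG. \<Sum>h\<in>?AL. dG G h) - \<sigma> ^ r\<bar> \<le> C1 * S powr (1/2) * S ^ (r - 1)"
      using T1 unfolding D3 by linarith
    have "\<bar>\<Sum>h\<in>?NL. \<Sum>G\<in>?SG. dG G h\<bar> \<le> (\<Sum>h\<in>?NL. \<Sum>G\<in>?SG. B0 * D)"
    proof (rule order_trans[OF sum_abs], rule sum_mono, rule order_trans[OF sum_abs], rule sum_mono)
      fix h G assume h: "h \<in> ?NL" and "G \<in> ?SG"
      then have G: "finite G" "\<forall>p\<in>G. prime p" "real (\<Prod>G) \<le> D" using P finite_subset by auto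
      have "\<bar>dG G h\<bar> = (\<Prod>p\<in>G. \<bar>dev p h\<bar>)" unfolding dG_def by (rule abs_prod)
      also have "\<dots> \<le> B0 * real (\<Prod>G)" using h by (intro B0(2) G) auto
      also have "\<dots> \<le> B0 * D" using G(3) B0(1) by (intro mult_left_mono) auto
      finally show "\<bar>dG G h\<bar> \<le> B0 * D" .
    qed
    also have "\<dots> = real (card ?NL) * (real (card ?SG) * (B0 * D))" by simp
    also have "\<dots> \<le> (K * (c * S) ^ (r - 1)) * (D * (B0 * D))"
    proof (intro mult_mono)
      have "real (card ?NL) \<le> K * real (card U) ^ (r - 1)"
        unfolding K_def by (rule card_not_distinct_lists_le[OF U])
      also have "\<dots> \<le> K * (c * S) ^ (r - 1)"
        using UH H by (intro mult_left_mono power_mono) (auto simp: K_def S_def A_def)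
      finally show "real (card ?NL) \<le> K * (c * S) ^ (r - 1)" .
    qed (use cSG B0(1) D1 c S1 in \<open>auto simp: K_def\<close>)
    also have "\<dots> = C2 * S ^ (r - 1) * (D * D)" by (simp add: C2_def power_mult_distrib mult_ac)
    also have "\<dots> \<le> C2 * S ^ (r - 1) * S powr (1/2)"
      using D2 B0(1) c S1 by (intro mult_left_mono) (auto simp: C2_def K_def)
    finally have T2: "\<bar>\<Sum>h\<in>?NL. \<Sum>G\<in>?SG. dG G h\<bar> \<le> C2 * S powr (1/2) * S ^ (r - 1)" by (simp add: mult_ac)
    have "\<bar>\<Sum>h\<in>?DL. \<Sum>G\<in>?LG. dG G h\<bar> \<le> (\<Sum>h\<in>?DL. \<Sum>G\<in>?LG. \<Prod>p\<in>G. \<bar>dev p h\<bar>)"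
    proof (rule order_trans[OF sum_abs], rule sum_mono, rule order_trans[OF sum_abs], rule sum_mono)
      show "\<bar>dG G h\<bar> \<le> (\<Prod>p\<in>G. \<bar>dev p h\<bar>)" for G h unfolding dG_def by (simp add: abs_prod)
    qed
    also have "\<dots> \<le> B3 * D powr (-\<eta>) * S powr (\<eta>/12) * real H ^ r"
      unfolding SP by (rule B3(2)[OF P D1 U])
    also have "\<dots> \<le> B3 * D powr (-\<eta>) * S powr (\<eta>/12) * (c * S) ^ r"
      using H B3(1) by (intro mult_left_mono power_mono) (auto simp: S_def A_def)
    also have "D powr (-\<eta>) = S powr (-(\<eta>/6))" by (simp add: D_def powr_powr)
    also have "B3 * S powr (-(\<eta>/6)) * S powr (\<eta>/12) * (c * S) ^ r
      = C3 * (S powr (-(\<eta>/6)) * S powr (\<eta>/12)) * S ^ r"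
      by (simp add: C3_def power_mult_distrib mult_ac)
    also have "S powr (-(\<eta>/6)) * S powr (\<eta>/12) = S powr (-(\<eta>/12))" by (simp flip: powr_add)
    finally have T3: "\<bar>\<Sum>h\<in>?DL. \<Sum>G\<in>?LG. dG G h\<bar> \<le> C3 * S powr (-(\<eta>/12)) * S ^ r" .
    have C0: "C1 \<ge> 0" "C2 \<ge> 0" "C3 \<ge> 0" using c L B0(1) B3(1) by (auto simp: C1_def C2_def C3_def K_def)
    have half: "S powr (1/2) * S ^ (r - 1) \<le> S powr (-a) * S ^ r"
    proof -
      have "S powr (1/2) * S ^ (r - 1) = S powr (-(1/2)) * S * S ^ (r - 1)"
        using S1 powr_add[of S "-(1/2)" 1] by simp
      also have "\<dots> = S powr (-(1/2)) * S ^ r" using r by (simp add: power_eq_if)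
      also have "\<dots> \<le> S powr (-a) * S ^ r" using S1 a by (intro mult_right_mono powr_mono) auto
      finally show ?thesis .
    qed
    have tail: "S powr (-(\<eta>/12)) * S ^ r \<le> S powr (-a) * S ^ r"
      using S1 a by (intro mult_right_mono powr_mono) auto
    have "\<bar>(\<Sum>h\<in>?DL. ncount q h A) - \<sigma> ^ r\<bar>
      \<le> C1 * (S powr (1/2) * S ^ (r - 1)) + C2 * (S powr (1/2) * S ^ (r - 1)) + C3 * (S powr (-(\<eta>/12)) * S ^ r)"
      using T1' T2 T3 unfolding 2 mult.assoc by linarith
    also have "\<dots> \<le> C1 * (S powr (-a) * S ^ r) + C2 * (S powr (-a) * S ^ r) + C3 * (S powr (-a) * S ^ r)"
      using C0 half tail by (intro add_mono mult_left_mono) auto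
    also have "\<dots> = (C1 + C2 + C3) * S powr (-a) * S ^ r" by (simp add: algebra_simps)
    finally have E: "\<bar>(\<Sum>h\<in>?DL. ncount q h A) - \<sigma> ^ r\<bar> \<le> (C1 + C2 + C3) * S powr (-a) * S ^ r" .
    have SrS: "S ^ r > 0" using S1 by simp
    have cA: "real (card A) > 0" using S1 by (cases "card A = 0") (auto simp: S_def inv_density_def)
    have "(\<Sum>h\<in>?DL. ncount q h A) = (\<Sum>h\<in>?DL. real (num_tuples q h A) / real (card A) * S ^ r)"
    proof (rule sum.cong[OF refl])
      fix h assume h: "h \<in> ?DL"
      have "ncount q h A = real (num_tuples q h A) * (S / q) * S ^ r"
        using h by (simp add: ncount_def S_def)
      also have "S / q = 1 / card A" using qpos by (simp add: S_def inv_density_def)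
      finally show "ncount q h A = real (num_tuples q h A) / real (card A) * S ^ r" by simp
    qed
    also have "\<dots> = real (\<Sum>h\<in>?DL. num_tuples q h A) / real (card A) * S ^ r"
      by (simp add: sum_distrib_right sum_divide_distrib)
    finally have "(\<Sum>h\<in>?DL. ncount q h A) - \<sigma> ^ r
      = (real (\<Sum>h\<in>?DL. num_tuples q h A) / real (card A) - (\<sigma> / S) ^ r) * S ^ r"
      using S1 by (simp add: left_diff_distrib power_divide)
    then have "\<bar>real (\<Sum>h\<in>?DL. num_tuples q h A) / real (card A) - (\<sigma> / S) ^ r\<bar> * S ^ r
      \<le> (C1 + C2 + C3) * S powr (-a) * S ^ r" using E SrS by (simp add: abs_mult)
    then have "\<bar>real (\<Sum>h\<in>?DL. num_tuples q h A) / real (card A) - (\<sigma> / S) ^ r\<bar> \<le> (C1 + C2 + C3) * S powr (-a)"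
      using SrS by (simp only: mult_le_cancel_right_pos)
    then show ?thesis by (simp only: S_def A_def)
  qed
  show ?thesis
    by (rule exI[of _ "C1 + C2 + C3"], rule exI[of _ a], rule conjI[OF a(1)], intro allI impI, rule main)
qed

end

section \<open>Spacings and occupation patterns\<close>

text \<open>The non-negative elements of \<open>A + q\<int>\<close> in increasing order; the spacings are their successive
  differences.\<close>
definition periodic_enum :: "nat \<Rightarrow> int set \<Rightarrow> nat \<Rightarrow> int" where
  "periodic_enum q A j = sorted_list_of_set A ! (j mod card A) + int q * int (j div card A)"

context
  fixes q :: nat and A :: "int set"
  assumes A: "A \<subseteq> {0..<int q}" "A \<noteq> {}"
begin

private lemma finA: "finite A" using A finite_subset by blast

private lemma cA: "card A > 0" using A finA by (simp add: card_gt_0_iff)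

private lemma nth_in: "i < card A \<Longrightarrow> sorted_list_of_set A ! i \<in> A"
  using finA nth_mem[of i "sorted_list_of_set A"] by simp

private lemma nth_strict: "i < j \<Longrightarrow> j < card A \<Longrightarrow> sorted_list_of_set A ! i < sorted_list_of_set A ! j"
  using sorted_wrt_nth_less[OF strict_sorted_list_of_set[of A]] by simp

lemma periodic_enum_Suc:
  "periodic_enum q A (Suc j) - periodic_enum q A j =
    (if Suc (j mod card A) < card A then sorted_list_of_set A ! Suc (j mod card A) - sorted_list_of_set A ! (j mod card A)
     else sorted_list_of_set A ! 0 + int q - sorted_list_of_set A ! (j mod card A))"
proof (cases "Suc (j mod card A) < card A")
  case True
  then have "Suc j mod card A = Suc (j mod card A)" "Suc j div card A = j div card A"
    by (auto simp: mod_Suc div_Suc)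
  then show ?thesis using True by (simp add: periodic_enum_def)
next
  case False
  moreover have "j mod card A < card A" using cA by simp
  ultimately have "Suc (j mod card A) = card A" by linarith
  then have "Suc j mod card A = 0" "Suc j div card A = Suc (j div card A)"
    by (auto simp: mod_Suc div_Suc)
  then show ?thesis using False by (simp add: periodic_enum_def algebra_simps)
qed

lemma spacing_periodic_enum:
  "spacing q A (j mod card A) = real_of_int (periodic_enum q A (Suc j) - periodic_enum q A j) / inv_density q A"
  unfolding periodic_enum_Suc spacing_def Let_def ..

lemma strict_mono_periodic_enum: "strict_mono (periodic_enum q A)"
proof (rule strict_mono_Suc_iff[THEN iffD2], rule allI)
  fix j
  have "sorted_list_of_set A ! 0 \<in> A" "sorted_list_of_set A ! (j mod card A) \<in> A"
    using cA by (auto intro!: nth_in)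
  then have "sorted_list_of_set A ! 0 \<ge> 0" "sorted_list_of_set A ! (j mod card A) < int q"
    using A by auto
  then have "periodic_enum q A (Suc j) - periodic_enum q A j > 0"
    unfolding periodic_enum_Suc using nth_strict[of "j mod card A" "Suc (j mod card A)"] by auto
  then show "periodic_enum q A j < periodic_enum q A (Suc j)" by simp
qed

lemma periodic_enum_mod: "periodic_enum q A j mod int q = sorted_list_of_set A ! (j mod card A)"
proof -
  have "sorted_list_of_set A ! (j mod card A) \<in> A" using cA by (auto intro!: nth_in)
  then show ?thesis using A by (auto simp: periodic_enum_def)
qed

lemma periodic_enum_mod_in: "periodic_enum q A j mod int q \<in> A"
  unfolding periodic_enum_mod using cA by (auto intro!: nth_in)

text \<open>The enumeration misses no point, so the successor of a point is never later than a given
  hit.\<close>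

lemma periodic_enum_surj:
  assumes "y > 0" "(periodic_enum q A i + y) mod int q \<in> A"
  shows "\<exists>j>i. periodic_enum q A j = periodic_enum q A i + y"
proof -
  let ?xs = "sorted_list_of_set A"
  define z where "z = periodic_enum q A i + y"
  have q: "q > 0" using A by (cases "q = 0") auto
  have "?xs ! (i mod card A) \<in> A" using cA by (auto intro!: nth_in)
  then have "periodic_enum q A i \<ge> 0" using A by (auto simp: periodic_enum_def)
  then have z0: "z \<ge> 0" using assms by (simp add: z_def)
  have "z mod int q \<in> set ?xs" using assms(2) finA by (simp add: z_def)
  then obtain l where l: "l < card A" "?xs ! l = z mod int q" by (auto simp: in_set_conv_nth)
  define j where "j = card A * nat (z div int q) + l"
  have "j mod card A = l" "j div card A = nat (z div int q)" using l(1) by (simp_all add: j_def)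
  then have "periodic_enum q A j = z mod int q + int q * (z div int q)"
    using l z0 q by (simp add: periodic_enum_def pos_imp_zdiv_nonneg_iff)
  then have e: "periodic_enum q A j = z" by simp
  then have "periodic_enum q A i < periodic_enum q A j" using assms(1) by (simp add: z_def)
  then have "i < j" using strict_mono_less[OF strict_mono_periodic_enum] by simp
  then show ?thesis using e by (auto simp: z_def)
qed

text \<open>\<open>Prob\<close> starts with the spacing of index \<open>j + 1\<close>, hence the
  base point belonging to \<open>j\<close> is the one of index \<open>Suc j\<close>. Summing over
  \<open>j\<close> is the same as averaging over the points of \<open>A\<close>.\<close>

lemma bij_betw_periodic_enum: "bij_betw (\<lambda>j. periodic_enum q A (Suc j) mod int q) {..<card A} A"
proof -
  let ?f = "\<lambda>j. periodic_enum q A (Suc j) mod int q"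
  have "inj_on ?f {..<card A}"
  proof (rule inj_onI)
    fix i j assume ij: "i \<in> {..<card A}" "j \<in> {..<card A}" "?f i = ?f j"
    have "distinct (sorted_list_of_set A)" by simp
    then have "Suc i mod card A = Suc j mod card A"
      using ij(3) cA finA unfolding periodic_enum_mod by (simp add: nth_eq_iff_index_eq)
    then have "[Suc i = Suc j] (mod card A)" by (simp add: cong_def)
    then have "[i + 1 = j + 1] (mod card A)" by simp
    then have "[i = j] (mod card A)" by (simp only: cong_add_rcancel_nat)
    then show "i = j" using ij(1,2) by (simp add: cong_def)
  qed
  moreover have "?f ` {..<card A} = A"
  proof (rule card_subset_eq[OF finA])
    show "?f ` {..<card A} \<subseteq> A" using periodic_enum_mod_in by auto
    show "card (?f ` {..<card A}) = card A" using calculation by (simp add: card_image)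
  qed
  ultimately show ?thesis by (simp add: bij_betw_def)
qed

end

text \<open>The bins are open on the left, so the base point (shift 0) lies in bin 0 and the bins
  from 1 on contain later points only.\<close>

definition bin :: "real \<Rightarrow> nat \<Rightarrow> int set" where
  "bin w a = {u. w * (real a - 1) < real_of_int u \<and> real_of_int u \<le> w * real a}"

definition occupied :: "nat \<Rightarrow> int set \<Rightarrow> real \<Rightarrow> int \<Rightarrow> nat \<Rightarrow> bool" where
  "occupied q A w x a \<longleftrightarrow> (\<exists>u\<in>bin w a. (x + u) mod int q \<in> A)"

text \<open>Occupation forgets multiplicities: two points in one bin hide a gap from the pattern.
  This is the exceptional event to be discarded.\<close>

definition crowded :: "nat \<Rightarrow> int set \<Rightarrow> real \<Rightarrow> int \<Rightarrow> nat \<Rightarrow> bool" where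
  "crowded q A w x a \<longleftrightarrow> (\<exists>u\<in>bin w a. \<exists>v\<in>bin w a. u \<noteq> v \<and> (x + u) mod int q \<in> A \<and> (x + v) mod int q \<in> A)"

text \<open>The \<open>c i\<close> are differences of successive occupied bin numbers, counted from
  bin 0, so that \<open>c i\<close> approximates the \<open>i\<close>-th gap in units of the
  mesh.\<close>

definition psum :: "(nat \<Rightarrow> nat) \<Rightarrow> nat \<Rightarrow> nat" where
  "psum c i = (\<Sum>l\<in>{1..i}. c l)"

text \<open>The occupied bins among the first \<open>psum c k\<close> are exactly those with the numbers
  \<open>psum c 1, \<dots>, psum c k\<close>.\<close>
definition pattern :: "nat \<Rightarrow> int set \<Rightarrow> real \<Rightarrow> nat \<Rightarrow> (nat \<Rightarrow> nat) \<Rightarrow> int \<Rightarrow> bool" where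
  "pattern q A w k c x \<longleftrightarrow> (\<forall>a\<in>psum c ` {1..k}. occupied q A w x a)
     \<and> (\<forall>a\<in>{1..psum c k} - psum c ` {1..k}. \<not> occupied q A w x a)"

lemma psum_0 [simp]: "psum c 0 = 0"
  by (simp add: psum_def)

lemma psum_Suc: "psum c (Suc i) = psum c i + c (Suc i)"
  by (simp add: psum_def)

lemma psum_mono: "i \<le> j \<Longrightarrow> psum c i \<le> psum c j"
  unfolding psum_def by (intro sum_mono2) auto

lemma psum_less:
  assumes "\<forall>l\<in>{1..k}. c l \<ge> 1" "i < j" "j \<le> k"
  shows "psum c i < psum c j"
proof -
  have "psum c i < psum c (Suc i)" using bspec[OF assms(1), of "Suc i"] assms(2,3) by (simp add: psum_Suc)
  also have "\<dots> \<le> psum c j" using assms(2) by (intro psum_mono) simp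
  finally show ?thesis .
qed

lemma psum_less_iff:
  assumes "\<forall>l\<in>{1..k}. c l \<ge> 1" "i \<le> k" "j \<le> k"
  shows "psum c i < psum c j \<longleftrightarrow> i < j"
  using psum_less[OF assms(1), where i = i and j = j] psum_mono[of j i c] assms(2,3) by (metis linorder_not_less)

lemma inj_on_psum:
  assumes "\<forall>l\<in>{1..k}. c l \<ge> 1"
  shows "inj_on (psum c) {1..k}"
proof (rule linorder_inj_onI')
  fix i j assume "i \<in> {1..k}" "j \<in> {1..k}" "i < j"
  then show "psum c i \<noteq> psum c j" using psum_less[OF assms, where i = i and j = j] by simp
qed

lemma bin_exists:
  assumes "w > 0" "u > 0"
  shows "\<exists>a\<ge>1. u \<in> bin w a"
proof -
  have pos: "real_of_int u / w > 0" using assms by simp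
  define a where "a = nat \<lceil>real_of_int u / w\<rceil>"
  have a1: "a \<ge> 1" using pos unfolding a_def by linarith
  have ra: "real a = real_of_int \<lceil>real_of_int u / w\<rceil>" using pos unfolding a_def by simp
  have "real a - 1 < real_of_int u / w" "real_of_int u / w \<le> real a" unfolding ra by linarith+
  then have "u \<in> bin w a" using assms(1) by (simp add: bin_def field_simps)
  then show ?thesis using a1 by blast
qed

lemma bin_mono:
  assumes "w > 0" "u \<in> bin w a" "v \<in> bin w b" "u \<le> v"
  shows "a \<le> b"
proof -
  have "real_of_int u \<le> real_of_int v" using assms(4) by simp
  then have "w * (real a - 1) < w * real b" using assms(2,3) unfolding bin_def by simp
  then have "real a - 1 < real b" using assms(1) by simp
  then show ?thesis by linarith
qed

text \<open>The next point is no later than a hit in bin \<open>psum c (Suc i)\<close>, so its bin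
  is an occupied one between those numbered \<open>psum c i\<close> and
  \<open>psum c (Suc i)\<close>. The pattern leaves only the two ends, and the lower end would be
  crowded.\<close>

lemma pattern_enum_in_bin:
  assumes A: "A \<subseteq> {0..<int q}" "A \<noteq> {}" and w: "w > 0"
    and c: "\<forall>l\<in>{1..k}. c l \<ge> 1"
    and pat: "pattern q A w k c (periodic_enum q A J mod int q)"
    and nc: "\<And>a. a \<in> {1..psum c k} \<Longrightarrow> \<not> crowded q A w (periodic_enum q A J mod int q) a"
  shows "i \<le> k \<Longrightarrow> periodic_enum q A (J + i) - periodic_enum q A J \<in> bin w (psum c i)"
proof (induction i)
  case 0
  then show ?case using w by (simp add: bin_def)
next
  case (Suc i)
  let ?e = "periodic_enum q A"
  let ?b = "psum c"
  have hit: "(?e J mod int q + u) mod int q = (?e J + u) mod int q" for u by (simp add: mod_simps)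
  define y where "y = ?e (J + i) - ?e J"
  define y' where "y' = ?e (J + Suc i) - ?e J"
  have yb: "y \<in> bin w (?b i)" using Suc by (simp add: y_def)
  have yy: "y < y'" unfolding y_def y'_def
    using strict_mono_less[OF strict_mono_periodic_enum[OF A], of "J + i" "J + Suc i"] by simp
  have y0: "y \<ge> 0" unfolding y_def
    using strict_mono_less_eq[OF strict_mono_periodic_enum[OF A], of J "J + i"] by simp
  have bi: "?b i < ?b (Suc i)" using bspec[OF c, of "Suc i"] Suc.prems by (simp add: psum_Suc)
  have "occupied q A w (?e J mod int q) (?b (Suc i))" using pat Suc.prems by (auto simp: pattern_def)
  then obtain u where u: "u \<in> bin w (?b (Suc i))" "(?e J + u) mod int q \<in> A"
    by (auto simp: occupied_def hit)
  have "real_of_int y \<le> w * real (?b i)" using yb by (simp add: bin_def)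
  also have "\<dots> \<le> w * (real (?b (Suc i)) - 1)" using bi w by (intro mult_left_mono) auto
  also have "\<dots> < real_of_int u" using u by (simp add: bin_def)
  finally have yu: "y < u" by simp
  then have "u > 0" using y0 by simp
  from periodic_enum_surj[OF A this u(2)] obtain j where j: "j > J" "?e j = ?e J + u" by blast
  have "?e (J + i) < ?e j" using yu j by (simp add: y_def)
  then have "J + Suc i \<le> j" using strict_mono_less[OF strict_mono_periodic_enum[OF A]] by simp
  then have "?e (J + Suc i) \<le> ?e j" using strict_mono_less_eq[OF strict_mono_periodic_enum[OF A]] by blast
  then have y'u: "y' \<le> u" using j by (simp add: y'_def)
  have y'0: "y' > 0" using yy y0 by simp
  obtain a where a: "a \<ge> 1" "y' \<in> bin w a" using bin_exists[OF w y'0] by blast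
  have y'A: "(?e J + y') mod int q \<in> A" using periodic_enum_mod_in[OF A, of "J + Suc i"] by (simp add: y'_def)
  have occ: "occupied q A w (?e J mod int q) a" using a y'A by (auto simp: occupied_def hit)
  have a_le: "a \<le> ?b (Suc i)" using bin_mono[OF w a(2) u(1) y'u] .
  have a_ge: "?b i \<le> a" using bin_mono[OF w yb a(2)] yy by simp
  have "a \<le> ?b k" using a_le psum_mono[OF Suc.prems, of c] by linarith
  then have "a \<in> ?b ` {1..k}" using pat occ a(1) by (auto simp: pattern_def)
  then obtain l where l: "l \<in> {1..k}" "a = ?b l" by blast
  have "\<not> l < i" using psum_less_iff[OF c, where i = l and j = i] l a_ge Suc.prems by auto
  moreover have "\<not> Suc i < l" using psum_less_iff[OF c, where i = "Suc i" and j = l] l a_le Suc.prems by auto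
  \<comment> \<open>Bin 0 is not covered by \<open>nc\<close>, but \<open>l = i\<close> forces
    \<open>i \<ge> 1\<close>.\<close>
  moreover have "l \<noteq> i"
  proof
    assume "l = i"
    then have "y' \<in> bin w (?b i)" using a l by simp
    moreover have "(?e J + y) mod int q \<in> A" using periodic_enum_mod_in[OF A, of "J + i"] by (simp add: y_def)
    ultimately have "crowded q A w (?e J mod int q) (?b i)"
      using yb yy y'A unfolding crowded_def hit by (intro bexI[of _ y] bexI[of _ y']) auto
    moreover have "?b i \<in> {1..?b k}" using l \<open>l = i\<close> a(1) \<open>a \<le> ?b k\<close> by simp
    ultimately show False using nc by blast
  qed
  ultimately have "l = Suc i" by linarith
  then show ?case using a l by (simp add: y'_def)
qed

text \<open>Consecutive points lie in bins whose numbers differ by \<open>c i\<close>, and each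
  position is uncertain by less than one mesh \<open>w\<close>.\<close>

lemma spacing_of_pattern:
  assumes A: "A \<subseteq> {0..<int q}" "A \<noteq> {}" and w: "w > 0"
    and c: "\<forall>l\<in>{1..k}. c l \<ge> 1"
    and pat: "pattern q A w k c (periodic_enum q A (Suc j) mod int q)"
    and nc: "\<And>a. a \<in> {1..psum c k} \<Longrightarrow> \<not> crowded q A w (periodic_enum q A (Suc j) mod int q) a"
    and i: "i \<in> {1..k}"
  shows "w * (real (c i) - 1) < spacing q A ((j + i) mod card A) * inv_density q A"
    and "spacing q A ((j + i) mod card A) * inv_density q A < w * (real (c i) + 1)"
proof -
  let ?e = "periodic_enum q A"
  have sp: "spacing q A ((j + i) mod card A) * inv_density q A = real_of_int (?e (Suc (j + i)) - ?e (j + i))"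
    using spacing_periodic_enum[OF A, of "j + i"] inv_density_ge_1[OF A] by simp
  obtain i' where i': "i = Suc i'" using i by (cases i) auto
  have 1: "?e (Suc j + i) - ?e (Suc j) \<in> bin w (psum c i)"
    using i by (intro pattern_enum_in_bin[OF A w c pat nc]) auto
  have 2: "?e (Suc j + i') - ?e (Suc j) \<in> bin w (psum c i')"
    using i i' by (intro pattern_enum_in_bin[OF A w c pat nc]) auto
  have ci: "real (psum c i) = real (psum c i') + real (c i)" by (simp add: i' psum_Suc)
  show "w * (real (c i) - 1) < spacing q A ((j + i) mod card A) * inv_density q A"
    "spacing q A ((j + i) mod card A) * inv_density q A < w * (real (c i) + 1)"
    using 1 2 unfolding sp bin_def ci by (auto simp: i' algebra_simps)
qed

text \<open>At the first disagreement, the smaller of the two next bin numbers would have to be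
  occupied in the other pattern, strictly between two of its successive occupied bins. Different
  patterns are therefore disjoint events.\<close>

lemma pattern_unique:
  assumes c: "\<forall>l\<in>{1..k}. c l \<ge> 1" and c': "\<forall>l\<in>{1..k}. c' l \<ge> 1"
    and pat: "pattern q A w k c x" "pattern q A w k c' x"
  shows "i \<in> {1..k} \<Longrightarrow> c i = c' i"
proof -
  have not_less: "\<not> psum d (Suc i) < psum d' (Suc i)"
    if d: "\<forall>l\<in>{1..k}. d l \<ge> 1" and d': "\<forall>l\<in>{1..k}. d' l \<ge> 1"
      and p: "pattern q A w k d x" "pattern q A w k d' x" and i: "Suc i \<le> k" and e: "psum d i = psum d' i"
    for d d' i
  proof
    assume less: "psum d (Suc i) < psum d' (Suc i)"
    have "occupied q A w x (psum d (Suc i))" using p(1) i by (auto simp: pattern_def)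
    moreover have "psum d (Suc i) \<ge> 1" using bspec[OF d, of "Suc i"] i by (simp add: psum_Suc)
    moreover have "psum d (Suc i) \<le> psum d' k" using less psum_mono[OF i, of d'] by linarith
    ultimately have "psum d (Suc i) \<in> psum d' ` {1..k}" using p(2) by (auto simp: pattern_def)
    then obtain l where l: "l \<in> {1..k}" "psum d (Suc i) = psum d' l" by blast
    have "l < Suc i" using less l psum_less_iff[OF d', where i = l and j = "Suc i"] i by auto
    moreover have "psum d' i < psum d' l"
      using psum_less[OF d, where i = i and j = "Suc i"] i l e by simp
    then have "i < l" using psum_less_iff[OF d', where i = i and j = l] l i by auto
    ultimately show False by simp
  qed
  have eq: "i \<le> k \<Longrightarrow> psum c i = psum c' i" for i
  proof (induction i)
    case (Suc i)
    then have "psum c i = psum c' i" by simp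
    then show ?case using not_less[OF c c' pat Suc.prems] not_less[OF c' c pat(2,1) Suc.prems] by simp
  qed simp
  show "c i = c' i" if i: "i \<in> {1..k}"
  proof -
    obtain i' where i': "i = Suc i'" using i by (cases i) auto
    show ?thesis using eq[of i] eq[of i'] i by (simp add: i' psum_Suc)
  qed
qed

section \<open>Limits along a sequence of moduli\<close>

lemma alternating_binomial_sum:
  "(\<Sum>i\<le>R. (-1) ^ i * real (Suc n choose i)) = (-1) ^ R * real (n choose R)"
  by (induction R) (auto simp: algebra_simps)

text \<open>For \<open>N = Suc n\<close> the truncated sum is exactly \<open>n choose R\<close> up
  to sign, which Pascal's rule bounds by \<open>N choose Suc R\<close>. One absolute bound covers
  both parities of \<open>R\<close>.\<close>

lemma bonferroni:
  "\<bar>(if N = 0 then 1 else 0) - (\<Sum>i\<le>R. (-1) ^ i * real (N choose i))\<bar> \<le> real (N choose Suc R)"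
proof (cases N)
  case 0
  have "(\<Sum>i\<le>R. (-1) ^ i * real (0 choose i)) = (\<Sum>i\<in>{0}. (-1) ^ i * real (0 choose i))"
    by (rule sum.mono_neutral_right) auto
  then show ?thesis using 0 by simp
next
  case (Suc n)
  have "\<bar>- ((-1) ^ R * real (n choose R))\<bar> = real (n choose R)" by (simp add: abs_mult)
  then show ?thesis unfolding Suc alternating_binomial_sum by simp
qed

definition hits :: "nat \<Rightarrow> int set \<Rightarrow> int set \<Rightarrow> int \<Rightarrow> nat" where
  "hits q A U x = card {u\<in>U. (x + u) mod int q \<in> A}"

definition bins :: "real \<Rightarrow> nat set \<Rightarrow> int set" where
  "bins w T = (\<Union>a\<in>T. bin w a)"

lemma finite_bin: "finite (bin w a)"
proof -
  have "bin w a \<subseteq> {\<lfloor>w * (real a - 1)\<rfloor>..\<lfloor>w * real a\<rfloor>}"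
    unfolding bin_def by (auto simp: le_floor_iff floor_le_iff)
  then show ?thesis using finite_subset by blast
qed

lemma bin_disjoint:
  assumes "w > 0" "a \<noteq> b"
  shows "bin w a \<inter> bin w b = {}"
  using bin_mono[OF assms(1)] assms(2) by (metis (no_types, lifting) disjoint_iff nle_le order_antisym order_refl)

lemma bins_subset:
  assumes "w > 0" "T \<subseteq> {1..n}"
  shows "bins w T \<subseteq> {1..int (nat \<lfloor>w * real n\<rfloor>)}"
proof
  fix u assume "u \<in> bins w T"
  then obtain a where a: "a \<in> T" "u \<in> bin w a" by (auto simp: bins_def)
  then have an: "1 \<le> a" "a \<le> n" using assms(2) by auto
  have "0 \<le> w * (real a - 1)" using an assms(1) by simp
  then have "u > 0" using a(2) by (simp add: bin_def)
  moreover have "real_of_int u \<le> w * real n"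
  proof -
    have "w * real a \<le> w * real n" using an assms(1) by simp
    then show ?thesis using a(2) by (simp add: bin_def)
  qed
  ultimately show "u \<in> {1..int (nat \<lfloor>w * real n\<rfloor>)}" by (simp add: le_floor_iff)
qed

text \<open>Each bin is an interval and contributes an error of at most 1. The discrepancy is thus
  independent of \<open>w\<close>, which will tend to infinity.\<close>

lemma equidist_bins:
  assumes w: "w > 0" and T: "finite T"
  shows "equidist (real (card T)) (w * real (card T)) (bins w T)"
  unfolding equidist_def
proof (intro allI impI)
  fix e :: nat and c :: int assume e: "e > 0"
  have "{u\<in>bins w T. u mod int e = c mod int e} = (\<Union>a\<in>T. {u\<in>bin w a. u mod int e = c mod int e})"
    by (auto simp: bins_def)
  moreover have "card (\<Union>a\<in>T. {u\<in>bin w a. u mod int e = c mod int e})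
    = (\<Sum>a\<in>T. card {u\<in>bin w a. u mod int e = c mod int e})"
    by (rule card_UN_disjoint[OF T]) (use finite_bin bin_disjoint[OF w] in fastforce)+
  ultimately have "real (card {u\<in>bins w T. u mod int e = c mod int e}) - w * real (card T) / real e
    = (\<Sum>a\<in>T. (real (card {u\<in>bin w a. u mod int e = c mod int e}) - w / real e))"
    by (simp add: sum_subtractf)
  also have "\<bar>\<dots>\<bar> \<le> (\<Sum>a\<in>T. \<bar>real (card {u\<in>bin w a. u mod int e = c mod int e}) - w / real e\<bar>)"
    by (rule sum_abs)
  also have "\<dots> \<le> (\<Sum>a\<in>T. 1)"
  proof (rule sum_mono)
    fix a
    have "w * real a - w * (real a - 1) = w" by (simp add: algebra_simps)
    moreover have "{u\<in>bin w a. u mod int e = c mod int e}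
      = {u. w * (real a - 1) < real_of_int u \<and> real_of_int u \<le> w * real a \<and> u mod int e = c mod int e}"
      by (auto simp: bin_def)
    ultimately show "\<bar>real (card {u\<in>bin w a. u mod int e = c mod int e}) - w / real e\<bar> \<le> 1"
      using card_interval_mod[OF e, of "w * (real a - 1)" "w * real a" c] w by simp
  qed
  finally show "\<bar>real (card {u\<in>bins w T. u mod int e = c mod int e}) - w * real (card T) / real e\<bar> \<le> real (card T)"
    by simp
qed

lemma hits_eq_0_iff: "finite U \<Longrightarrow> hits q A U x = 0 \<longleftrightarrow> (\<forall>u\<in>U. (x + u) mod int q \<notin> A)"
  unfolding hits_def by auto

lemma hits_bins_eq_0_iff:
  "finite T \<Longrightarrow> hits q A (bins w T) x = 0 \<longleftrightarrow> (\<forall>a\<in>T. \<not> occupied q A w x a)"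
  by (subst hits_eq_0_iff) (auto simp: bins_def occupied_def finite_bin)

text \<open>This bounds the probability of crowding by a second factorial moment.\<close>

lemma crowded_hits:
  assumes "crowded q A w x a"
  shows "1 \<le> hits q A (bins w {a}) x choose 2"
proof -
  obtain u v where uv: "u \<in> bin w a" "v \<in> bin w a" "u \<noteq> v"
    "(x + u) mod int q \<in> A" "(x + v) mod int q \<in> A" using assms by (auto simp: crowded_def)
  then have "card {u, v} \<le> hits q A (bins w {a}) x"
    unfolding hits_def by (intro card_mono) (auto simp: bins_def finite_bin)
  then have "2 \<le> hits q A (bins w {a}) x" using uv(3) by simp
  then show ?thesis by (simp add: Suc_leI zero_less_binomial)
qed

lemma prod_if_zero_one:
  assumes "finite T"
  shows "(\<Prod>a\<in>T. if P a then 1 else (0::real)) = (if \<forall>a\<in>T. P a then 1 else 0)"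
  using assms by (induction T rule: finite_induct) auto

lemma card_eq_sum_if:
  "finite A \<Longrightarrow> real (card {x\<in>A. P x}) = (\<Sum>x\<in>A. if P x then 1 else 0)"
  unfolding card_filter_eq_sum by (simp add: if_distrib cong: if_cong)

text \<open>The ranges ensure \<open>c i - 1 \<ge> u i * M\<close> and
  \<open>c i + 1 \<le> v i * M\<close>, so that a gap known only up to one mesh still falls strictly
  between \<open>u i\<close> and \<open>v i\<close>. \<open>PiE\<close> makes tuples that agree on
  \<open>{1..k}\<close> equal.\<close>

definition tuples_in :: "nat \<Rightarrow> real \<Rightarrow> (nat \<Rightarrow> real) \<Rightarrow> (nat \<Rightarrow> real) \<Rightarrow> (nat \<Rightarrow> nat) set" where
  "tuples_in k M u v = PiE {1..k} (\<lambda>i. {nat \<lceil>u i * M\<rceil> + 1..nat \<lfloor>v i * M\<rfloor> - 1})"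

lemma finite_tuples_in: "finite (tuples_in k M u v)"
  unfolding tuples_in_def by (rule finite_PiE) auto

lemma geometric_sum_interval:
  fixes p :: real
  assumes "a \<le> b"
  shows "(\<Sum>c\<in>{a + 1..b}. p ^ (c - 1) * (1 - p)) = p ^ a - p ^ b"
  using assms by (induction b rule: dec_induct) (auto simp: algebra_simps)

text \<open>The tolerance 2 covers the rounding error together with the shift by 1 in
  \<open>tuples_in\<close>.\<close>

lemma power_exp_limit:
  fixes f :: "nat \<Rightarrow> nat"
  assumes "\<And>m. \<bar>real (f m) - x * real (Suc m)\<bar> \<le> 2"
  shows "(\<lambda>m. exp (- (1 / real (Suc m))) ^ f m) \<longlonglongrightarrow> exp (- x)"
proof -
  have "(\<lambda>m. real (f m) / real (Suc m) - x) \<longlonglongrightarrow> 0"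
  proof (rule tendsto_0_le[OF lim_inverse_n', where K = 4])
    show "eventually (\<lambda>m. norm (real (f m) / real (Suc m) - x) \<le> norm (1 / real m) * 4) sequentially"
      using eventually_gt_at_top[of 0]
    proof eventually_elim
      case (elim m)
      have "real (f m) / real (Suc m) - x = (real (f m) - x * real (Suc m)) / real (Suc m)"
        by (simp add: field_simps)
      then have "\<bar>real (f m) / real (Suc m) - x\<bar> = \<bar>real (f m) - x * real (Suc m)\<bar> / real (Suc m)" by simp
      also have "\<dots> \<le> 2 / real (Suc m)" by (intro divide_right_mono assms) auto
      also have "\<dots> \<le> 1 / real m * 4" using elim by (simp add: field_simps)
      finally show ?case by simp
    qed
  qed
  then have "(\<lambda>m. real (f m) / real (Suc m)) \<longlonglongrightarrow> x" by (simp only: LIM_zero_iff)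
  then have "(\<lambda>m. exp (- (real (f m) / real (Suc m)))) \<longlonglongrightarrow> exp (- x)" by (intro tendsto_intros)
  moreover have "exp (- (1 / real (Suc m))) ^ f m = exp (- (real (f m) / real (Suc m)))" for m
    by (simp flip: exp_of_nat_mult)
  ultimately show ?thesis by simp
qed

locale sieved_residues_seq = sieved_residues +
  fixes Q :: "nat \<Rightarrow> nat"
  assumes sqf: "\<And>n. squarefree (Q n)"
    and lim: "filterlim (\<lambda>n. inv_density (Q n) (crt_set \<Omega> (Q n))) at_top sequentially"
begin

definition A :: "nat \<Rightarrow> int set" where "A n = crt_set \<Omega> (Q n)"

definition S :: "nat \<Rightarrow> real" where "S n = inv_density (Q n) (A n)"

text \<open>The average sees the set from one of its own points; the point itself is not counted
  because only bins from 1 on are inspected.\<close>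

definition avg :: "nat \<Rightarrow> (int \<Rightarrow> real) \<Rightarrow> real" where "avg n f = (\<Sum>x\<in>A n. f x) / real (card (A n))"

lemma S_at_top: "filterlim S at_top sequentially"
  using lim by (simp add: S_def[abs_def] A_def)

lemma A_subset: "A n \<subseteq> {0..<int (Q n)}"
  by (simp add: A_def crt_set_subset)

lemma finite_A [simp]: "finite (A n)"
  using A_subset finite_subset by blast

lemma card_A: "card (A n) > 0"
proof -
  let ?P = "prime_factors (Q n)"
  have P: "finite ?P" "\<forall>p\<in>?P. prime p" by auto
  have "card (A n) = (\<Prod>p\<in>?P. card (\<Omega> p))"
    using card_crt_set[OF P, of \<Omega>] subset P squarefree_prod_prime_factors[OF sqf[of n]] by (simp add: A_def)
  moreover have "card (\<Omega> p) > 0" if "p \<in> ?P" for p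
    using nonempty subset P that finite_subset[of "\<Omega> p" "{0..<int p}"] by (auto simp: card_gt_0_iff)
  ultimately show ?thesis by (auto intro: prod_pos)
qed

lemma A_nonempty: "A n \<noteq> {}"
  using card_A[of n] by auto

lemma S_ge_1: "S n \<ge> 1"
  unfolding S_def by (rule inv_density_ge_1[OF A_subset A_nonempty])

lemma avg_sum: "avg n (\<lambda>x. \<Sum>i\<in>I. f i x) = (\<Sum>i\<in>I. avg n (f i))"
  unfolding avg_def by (subst sum.swap) (simp add: sum_divide_distrib)

lemma avg_mult: "avg n (\<lambda>x. c * f x) = c * avg n f"
  by (simp add: avg_def sum_distrib_left)

lemma avg_diff: "avg n (\<lambda>x. f x - g x) = avg n f - avg n g"
  by (simp add: avg_def sum_subtractf diff_divide_distrib)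

lemma avg_mono: "(\<And>x. x \<in> A n \<Longrightarrow> f x \<le> g x) \<Longrightarrow> avg n f \<le> avg n g"
  unfolding avg_def by (intro divide_right_mono sum_mono) auto

lemma abs_avg_le: "\<bar>avg n f\<bar> \<le> avg n (\<lambda>x. \<bar>f x\<bar>)"
  unfolding avg_def by (simp add: divide_right_mono)

lemma avg_const: "avg n (\<lambda>x. c) = c"
  using card_A[of n] A_nonempty[of n] by (simp add: avg_def)

lemma avg_indicator: "avg n (\<lambda>x. if P x then 1 else 0) = real (card {x\<in>A n. P x}) / real (card (A n))"
  unfolding avg_def by (simp add: card_eq_sum_if)

text \<open>\<open>correlation\<close> is applied with \<open>\<sigma> = S n * card T / M\<close>.
  The limits are the factorial moments of a Poisson variable with mean \<open>card T / M\<close>,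
  divided by \<open>fact r\<close>.\<close>

lemma factorial_moment_limit:
  assumes T: "T \<subseteq> {1..N}" and M: "M > 0"
  shows "(\<lambda>n. avg n (\<lambda>x. real (hits (Q n) (A n) (bins (S n / M) T) x choose r)))
    \<longlonglongrightarrow> (real (card T) / M) ^ r / fact r"
proof (cases "r = 0")
  case True
  then show ?thesis by (simp add: avg_const)
next
  case False
  then have r: "r \<ge> 1" by simp
  have finT: "finite T" using T finite_subset by blast
  have cT: "card T \<le> N" using card_mono[OF _ T] by simp
  \<comment> \<open>One constant dominates both \<open>H\<close> and \<open>\<sigma>\<close>; the
    extra 1 keeps it positive for \<open>N = 0\<close>.\<close>
  define c where "c = (real N + 1) / M"
  have c: "c > 0" using M by (simp add: c_def)
  have L: "real (card T) \<ge> 0" by simp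
  obtain B a where Ba: "a > 0" "\<And>q U \<sigma> H. squarefree q \<Longrightarrow> U \<subseteq> {1..int H} \<Longrightarrow>
     real H \<le> c * inv_density q (crt_set \<Omega> q) \<Longrightarrow> equidist (real (card T)) \<sigma> U \<Longrightarrow>
     0 \<le> \<sigma> \<Longrightarrow> \<sigma> \<le> c * inv_density q (crt_set \<Omega> q) \<Longrightarrow>
     \<bar>real (\<Sum>h\<in>{h. length h = r \<and> distinct h \<and> set h \<subseteq> U}. num_tuples q h (crt_set \<Omega> q))
        / real (card (crt_set \<Omega> q)) - (\<sigma> / inv_density q (crt_set \<Omega> q)) ^ r\<bar>
     \<le> B * inv_density q (crt_set \<Omega> q) powr (-a)"
    using correlation[OF r c L] by blast
  let ?X = "\<lambda>n. avg n (\<lambda>x. real (hits (Q n) (A n) (bins (S n / M) T) x choose r))"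
  have bound: "\<bar>fact r * ?X n - (real (card T) / M) ^ r\<bar> \<le> B * S n powr (-a)" for n
  proof -
    define w where "w = S n / M"
    have w: "w > 0" using S_ge_1[of n] M by (simp add: w_def)
    define H where "H = nat \<lfloor>w * real N\<rfloor>"
    have sub: "bins w T \<subseteq> {1..int H}" unfolding H_def by (rule bins_subset[OF w T])
    have wc: "w * real k \<le> c * S n" if "k \<le> N" for k
    proof -
      have "w * real k \<le> w * (real N + 1)" using w that by (intro mult_left_mono) auto
      then show ?thesis by (simp add: w_def c_def mult.commute)
    qed
    have "real H \<le> w * real N" unfolding H_def using w by simp
    then have H: "real H \<le> c * S n" using wc[of N] by simp
    have "\<bar>real (\<Sum>h\<in>{h. length h = r \<and> distinct h \<and> set h \<subseteq> bins w T}. num_tuples (Q n) h (A n))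
        / real (card (A n)) - (w * real (card T) / S n) ^ r\<bar> \<le> B * S n powr (-a)"
      using Ba(2)[OF sqf sub _ equidist_bins[OF w finT]] H wc[OF cT] w
      unfolding S_def A_def by simp
    moreover have "w * real (card T) / S n = real (card T) / M" using S_ge_1[of n] by (simp add: w_def)
    moreover have "real (\<Sum>h\<in>{h. length h = r \<and> distinct h \<and> set h \<subseteq> bins w T}. num_tuples (Q n) h (A n))
        / real (card (A n)) = fact r * ?X n"
      using sum_num_tuples_distinct_lists[OF A_subset finite_subset[OF sub], of n r]
      by (simp add: avg_def hits_def w_def)
    ultimately show ?thesis by simp
  qed
  have "(\<lambda>n. S n powr (-a)) \<longlonglongrightarrow> 0"
    using Ba(1) by (intro tendsto_neg_powr S_at_top) simp
  then have "(\<lambda>n. B * S n powr (-a)) \<longlonglongrightarrow> B * 0" by (intro tendsto_intros)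
  then have z: "(\<lambda>n. B * S n powr (-a)) \<longlonglongrightarrow> 0" by simp
  have "(\<lambda>n. fact r * ?X n - (real (card T) / M) ^ r) \<longlonglongrightarrow> 0"
    by (rule tendsto_0_le[OF z, where K = 1])
      (intro always_eventually allI, use bound in \<open>force intro: order_trans[OF _ abs_ge_self]\<close>)
  then have "(\<lambda>n. fact r * ?X n) \<longlonglongrightarrow> (real (card T) / M) ^ r" by (simp only: LIM_zero_iff)
  then have "(\<lambda>n. fact r * ?X n / fact r) \<longlonglongrightarrow> (real (card T) / M) ^ r / fact r"
    by (intro tendsto_divide tendsto_const) auto
  then show ?thesis by simp
qed

text \<open>The truncation \<open>R\<close> is chosen first, so that the exponential series and its
  next term are within \<open>\<delta>/4\<close>; then only finitely many moments have to be close
  to their limits. The next moment bounds the Bonferroni error uniformly in sign.\<close>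

lemma void_limit:
  assumes T: "T \<subseteq> {1..N}" and M: "M > 0"
  shows "(\<lambda>n. avg n (\<lambda>x. if \<forall>a\<in>T. \<not> occupied (Q n) (A n) (S n / M) x a then 1 else 0))
    \<longlonglongrightarrow> exp (- (real (card T) / M))"
proof (rule LIMSEQ_I)
  fix \<delta> :: real assume \<delta>: "\<delta> > 0"
  define u where "u = real (card T) / M"
  have finT: "finite T" using T finite_subset by blast
  let ?N = "\<lambda>n x. hits (Q n) (A n) (bins (S n / M) T) x"
  have "(\<lambda>k. u ^ k / fact k) \<longlonglongrightarrow> 0" using summable_LIMSEQ_zero[OF summable_exp[of u]]
    by (simp add: divide_inverse mult.commute)
  then have l1: "(\<lambda>k. u ^ Suc k / fact (Suc k)) \<longlonglongrightarrow> 0" by (rule LIMSEQ_Suc)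
  have "(\<lambda>k. (- u) ^ k /\<^sub>R fact k) sums exp (- u)" by (rule exp_converges)
  then have l2: "(\<lambda>R. \<Sum>i\<le>R. (- u) ^ i / fact i) \<longlonglongrightarrow> exp (- u)"
    by (simp add: sums_def_le divide_inverse mult.commute)
  obtain R1 where R1: "\<forall>k\<ge>R1. norm (u ^ Suc k / fact (Suc k) - 0) < \<delta>/4"
    using LIMSEQ_D[OF l1, of "\<delta>/4"] \<delta> by auto
  obtain R2 where R2: "\<forall>k\<ge>R2. norm ((\<Sum>i\<le>k. (- u) ^ i / fact i) - exp (- u)) < \<delta>/4"
    using LIMSEQ_D[OF l2, of "\<delta>/4"] \<delta> by auto
  define R where "R = max R1 R2"
  let ?f = "\<lambda>n. \<Sum>i\<le>R. (-1) ^ i * avg n (\<lambda>x. real (?N n x choose i))"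
  have l3: "?f \<longlonglongrightarrow> (\<Sum>i\<le>R. (-1) ^ i * (u ^ i / fact i))"
    unfolding u_def by (intro tendsto_intros factorial_moment_limit[OF T M])
  have l4: "(\<lambda>n. avg n (\<lambda>x. real (?N n x choose Suc R))) \<longlonglongrightarrow> u ^ Suc R / fact (Suc R)"
    unfolding u_def by (rule factorial_moment_limit[OF T M])
  have "(\<Sum>i\<le>R. (-1) ^ i * (u ^ i / fact i)) = (\<Sum>i\<le>R. (- u) ^ i / fact i)"
    by (simp add: power_minus[of u])
  then have e1: "\<bar>(\<Sum>i\<le>R. (-1) ^ i * (u ^ i / fact i)) - exp (- u)\<bar> < \<delta>/4" using R2 by (simp add: R_def)
  have e2: "u ^ Suc R / fact (Suc R) < \<delta>/4" using R1 unfolding R_def by (metis abs_ge_self diff_zero le_less_trans max.cobounded1 real_norm_def)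
  obtain n1 where n1: "\<forall>n\<ge>n1. norm (?f n - (\<Sum>i\<le>R. (-1) ^ i * (u ^ i / fact i))) < \<delta>/4"
    using LIMSEQ_D[OF l3, of "\<delta>/4"] \<delta> by auto
  obtain n2 where n2: "\<forall>n\<ge>n2. norm (avg n (\<lambda>x. real (?N n x choose Suc R)) - u ^ Suc R / fact (Suc R)) < \<delta>/4"
    using LIMSEQ_D[OF l4, of "\<delta>/4"] \<delta> by auto
  let ?V = "\<lambda>n. avg n (\<lambda>x. if \<forall>a\<in>T. \<not> occupied (Q n) (A n) (S n / M) x a then 1 else 0)"
  have bonf: "\<bar>?V n - ?f n\<bar> \<le> avg n (\<lambda>x. real (?N n x choose Suc R))" for n
  proof -
    have "?f n = avg n (\<lambda>x. \<Sum>i\<le>R. (-1) ^ i * real (?N n x choose i))" by (simp add: avg_sum avg_mult)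
    then have "?V n - ?f n = avg n (\<lambda>x. (if ?N n x = 0 then 1 else 0)
        - (\<Sum>i\<le>R. (-1) ^ i * real (?N n x choose i)))"
      by (simp only: avg_diff hits_bins_eq_0_iff[OF finT])
    then have "\<bar>?V n - ?f n\<bar> \<le> avg n (\<lambda>x. \<bar>(if ?N n x = 0 then 1 else 0)
        - (\<Sum>i\<le>R. (-1) ^ i * real (?N n x choose i))\<bar>)" by (simp only: abs_avg_le)
    also have "\<dots> \<le> avg n (\<lambda>x. real (?N n x choose Suc R))" by (intro avg_mono bonferroni)
    finally show ?thesis .
  qed
  show "\<exists>no. \<forall>n\<ge>no. norm (?V n - exp (- (real (card T) / M))) < \<delta>"
  proof (intro exI allI impI)
    fix n assume "n \<ge> max n1 n2"
    then have "\<bar>?f n - (\<Sum>i\<le>R. (-1) ^ i * (u ^ i / fact i))\<bar> < \<delta>/4"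
      "\<bar>avg n (\<lambda>x. real (?N n x choose Suc R)) - u ^ Suc R / fact (Suc R)\<bar> < \<delta>/4"
      using n1 n2 by auto
    then have "\<bar>?V n - exp (- u)\<bar> < \<delta>" using bonf[of n] e1 e2 by linarith
    then show "norm (?V n - exp (- (real (card T) / M))) < \<delta>" by (simp add: u_def)
  qed
qed

text \<open>Inclusion-exclusion over \<open>T\<close> leaves void events for
  \<open>X \<union> W\<close>. Their limits \<open>p ^ (card X + card W)\<close> factor, which is
  the asymptotic independence of the bins, and the signed sum over \<open>X\<close> folds back into
  a power of \<open>1 - p\<close>.\<close>

lemma occupancy_limit:
  assumes T: "T \<subseteq> {1..N}" and W: "W \<subseteq> {1..N}" and TW: "T \<inter> W = {}" and M: "M > 0"
  shows "(\<lambda>n. avg n (\<lambda>x. if (\<forall>a\<in>T. occupied (Q n) (A n) (S n / M) x a)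
        \<and> (\<forall>a\<in>W. \<not> occupied (Q n) (A n) (S n / M) x a) then 1 else 0))
    \<longlonglongrightarrow> exp (- (1 / M)) ^ card W * (1 - exp (- (1 / M))) ^ card T"
proof -
  have fin: "finite T" "finite W" using T W finite_subset by blast+
  define p where "p = exp (- (1 / M))"
  let ?o = "\<lambda>n x a. occupied (Q n) (A n) (S n / M) x a"
  have pk: "p ^ k = exp (- (real k / M))" for k by (simp add: p_def flip: exp_of_nat_mult)
  have eq: "(if (\<forall>a\<in>T. ?o n x a) \<and> (\<forall>a\<in>W. \<not> ?o n x a) then 1 else 0)
    = (\<Sum>X\<in>Pow T. (-1) ^ card X * (if \<forall>a\<in>X \<union> W. \<not> ?o n x a then 1 else (0::real)))" for n x
  proof -
    have "(if (\<forall>a\<in>T. ?o n x a) \<and> (\<forall>a\<in>W. \<not> ?o n x a) then 1 else (0::real))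
      = (if \<forall>a\<in>T. ?o n x a then 1 else 0) * (if \<forall>a\<in>W. \<not> ?o n x a then 1 else 0)" by simp
    also have "(if \<forall>a\<in>T. ?o n x a then 1 else (0::real)) = (\<Prod>a\<in>T. if ?o n x a then 1 else 0)"
      by (rule prod_if_zero_one[OF fin(1), symmetric])
    also have "\<dots> = (\<Prod>a\<in>T. 1 - (if \<not> ?o n x a then 1 else 0))" by (intro prod.cong) auto
    also have "\<dots> = (\<Sum>X\<in>Pow T. (-1) ^ card X * (\<Prod>a\<in>X. if \<not> ?o n x a then 1 else 0))"
      unfolding prod_diff_conv_sum[OF fin(1)] by simp
    also have "\<dots> = (\<Sum>X\<in>Pow T. (-1) ^ card X * (if \<forall>a\<in>X. \<not> ?o n x a then 1 else 0))"
      using fin(1) by (intro sum.cong refl arg_cong2[of _ _ _ _ "(*)"] prod_if_zero_one) (auto intro: finite_subset)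
    also have "\<dots> * (if \<forall>a\<in>W. \<not> ?o n x a then 1 else 0)
      = (\<Sum>X\<in>Pow T. (-1) ^ card X * (if \<forall>a\<in>X \<union> W. \<not> ?o n x a then 1 else (0::real)))"
      unfolding sum_distrib_right by (intro sum.cong refl) auto
    finally show ?thesis .
  qed
  have "(\<lambda>n. \<Sum>X\<in>Pow T. (-1) ^ card X * avg n (\<lambda>x. if \<forall>a\<in>X \<union> W. \<not> ?o n x a then 1 else 0))
    \<longlonglongrightarrow> (\<Sum>X\<in>Pow T. (-1) ^ card X * exp (- (real (card (X \<union> W)) / M)))"
    by (intro tendsto_intros void_limit[OF _ M, where N = N]) (use T W in auto)
  also have "(\<Sum>X\<in>Pow T. (-1) ^ card X * exp (- (real (card (X \<union> W)) / M)))
    = (\<Sum>X\<in>Pow T. ((-1) ^ card X * p ^ card X) * p ^ card W)"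
  proof (rule sum.cong[OF refl])
    fix X assume X: "X \<in> Pow T"
    have "card (X \<union> W) = card X + card W"
      using X TW fin by (intro card_Un_disjoint) (auto intro: finite_subset)
    then show "(-1) ^ card X * exp (- (real (card (X \<union> W)) / M)) = ((-1) ^ card X * p ^ card X) * p ^ card W"
      by (simp only: flip: pk) (simp add: power_add)
  qed
  also have "\<dots> = (\<Sum>X\<in>Pow T. (-1) ^ card X * p ^ card X) * p ^ card W" by (simp add: sum_distrib_right)
  also have "(\<Sum>X\<in>Pow T. (-1) ^ card X * p ^ card X) = (\<Prod>a\<in>T. 1 - p)"
    unfolding prod_diff_conv_sum[OF fin(1)] by simp
  finally show ?thesis unfolding eq by (simp add: avg_sum avg_mult p_def mult.commute)
qed

text \<open>A single bin has limiting second moment \<open>1 / (2 * M^2)\<close>. In the application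
  \<open>N\<close> is of order \<open>M\<close>, so the total is of order
  \<open>1 / M\<close>.\<close>

lemma crowded_eventually_le:
  assumes M: "M > 0" and \<delta>: "\<delta> > 0"
  shows "eventually (\<lambda>n. (\<Sum>a\<in>{1..N}. avg n (\<lambda>x. if crowded (Q n) (A n) (S n / M) x a then 1 else 0))
       \<le> real N / (2 * M^2) + \<delta>) sequentially"
proof -
  let ?c = "\<lambda>n a. avg n (\<lambda>x. real (hits (Q n) (A n) (bins (S n / M) {a}) x choose 2))"
  have "(\<lambda>n. \<Sum>a\<in>{1..N}. ?c n a) \<longlonglongrightarrow> (\<Sum>a\<in>{1..N}. (real (card {a}) / M) ^ 2 / fact 2)"
    by (intro tendsto_sum factorial_moment_limit[OF _ M, where N = N]) auto
  moreover have "(\<Sum>a\<in>{1..N}. (real (card {a}) / M) ^ 2 / fact 2) = real N / (2 * M^2)"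
    by (simp add: power_divide fact_numeral mult.commute)
  ultimately have "(\<lambda>n. \<Sum>a\<in>{1..N}. ?c n a) \<longlonglongrightarrow> real N / (2 * M^2)" by (simp only:)
  then have "eventually (\<lambda>n. (\<Sum>a\<in>{1..N}. ?c n a) < real N / (2 * M^2) + \<delta>) sequentially"
    using \<delta> by (intro order_tendstoD(2)) auto
  then show ?thesis
  proof eventually_elim
    case (elim n)
    have "(\<Sum>a\<in>{1..N}. avg n (\<lambda>x. if crowded (Q n) (A n) (S n / M) x a then 1 else 0)) \<le> (\<Sum>a\<in>{1..N}. ?c n a)"
    proof (intro sum_mono avg_mono)
      fix a x
      have "real 1 \<le> real (hits (Q n) (A n) (bins (S n / M) {a}) x choose 2)"
        if "crowded (Q n) (A n) (S n / M) x a"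
        using crowded_hits[OF that] by (simp only: of_nat_le_iff)
      then show "(if crowded (Q n) (A n) (S n / M) x a then 1 else 0)
        \<le> real (hits (Q n) (A n) (bins (S n / M) {a}) x choose 2)" by simp
    qed
    then show ?case using elim by linarith
  qed
qed

section \<open>Lower bounds for box probabilities\<close>

definition box_prob :: "nat \<Rightarrow> nat \<Rightarrow> (nat \<Rightarrow> real) \<Rightarrow> (nat \<Rightarrow> real) \<Rightarrow> real" where
  "box_prob n k u v = real (card {j. j < card (A n) \<and> (\<forall>i\<in>{1..k}.
      u i < spacing (Q n) (A n) ((j + i) mod card (A n)) \<and>
      spacing (Q n) (A n) ((j + i) mod card (A n)) < v i)}) / real (card (A n))"

text \<open>A base point showing an admissible pattern and no crowded bin has its gaps in the box.
  Patterns exclude each other, so their probabilities add; the range of \<open>a\<close> contains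
  every bin that any admissible tuple inspects, so crowding is subtracted once and not once per
  tuple.\<close>

lemma box_prob_ge:
  assumes M: "M > 0" and u: "\<And>i. i \<in> {1..k} \<Longrightarrow> u i \<ge> 0"
  shows "(\<Sum>c\<in>tuples_in k M u v. avg n (\<lambda>x. if pattern (Q n) (A n) (S n / M) k c x then 1 else 0))
    - (\<Sum>a\<in>{1..\<Sum>i\<in>{1..k}. nat \<lfloor>v i * M\<rfloor>}. avg n (\<lambda>x. if crowded (Q n) (A n) (S n / M) x a then 1 else 0))
    \<le> box_prob n k u v"
proof -
  define w where "w = S n / M"
  define N where "N = (\<Sum>i\<in>{1..k}. nat \<lfloor>v i * M\<rfloor>)"
  let ?C = "tuples_in k M u v"
  let ?m = "card (A n)"
  let ?\<phi> = "\<lambda>j. periodic_enum (Q n) (A n) (Suc j) mod int (Q n)"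
  let ?pat = "\<lambda>c. {x\<in>A n. pattern (Q n) (A n) w k c x}"
  let ?crd = "\<lambda>a. {x\<in>A n. crowded (Q n) (A n) w x a}"
  define X where "X = (\<Union>c\<in>?C. ?pat c)"
  define Y where "Y = (\<Union>a\<in>{1..N}. ?crd a)"
  define J where "J = {j. j < ?m \<and> (\<forall>i\<in>{1..k}.
      u i < spacing (Q n) (A n) ((j + i) mod ?m) \<and> spacing (Q n) (A n) ((j + i) mod ?m) < v i)}"
  have w: "w > 0" using S_ge_1[of n] M by (simp add: w_def)
  have c1: "\<forall>l\<in>{1..k}. c l \<ge> 1" if "c \<in> ?C" for c
  proof
    fix l assume "l \<in> {1..k}"
    then have "c l \<in> {nat \<lceil>u l * M\<rceil> + 1..nat \<lfloor>v l * M\<rfloor> - 1}" using that unfolding tuples_in_def by blast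
    then show "c l \<ge> 1" by simp
  qed
  have cardX: "card X = (\<Sum>c\<in>?C. card (?pat c))"
    unfolding X_def
  proof (rule card_UN_disjoint[OF finite_tuples_in])
    show "\<forall>c\<in>?C. \<forall>c'\<in>?C. c \<noteq> c' \<longrightarrow> ?pat c \<inter> ?pat c' = {}"
    proof (intro ballI impI)
      fix c c' assume cc: "c \<in> ?C" "c' \<in> ?C" "c \<noteq> c'"
      show "?pat c \<inter> ?pat c' = {}"
      proof (rule ccontr)
        assume "?pat c \<inter> ?pat c' \<noteq> {}"
        then obtain x where "pattern (Q n) (A n) w k c x" "pattern (Q n) (A n) w k c' x" by blast
        then have "c i = c' i" if "i \<in> {1..k}" for i
          using pattern_unique[OF c1[OF cc(1)] c1[OF cc(2)]] that by blast
        then have "c = c'" using cc(1,2) unfolding tuples_in_def by (rule PiE_ext[rotated 2])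
        then show False using cc by simp
      qed
    qed
  qed auto
  have cardY: "card Y \<le> (\<Sum>a\<in>{1..N}. card (?crd a))" unfolding Y_def by (rule card_UN_le) simp
  have XA: "X \<subseteq> A n" by (auto simp: X_def)
  have YA: "Y \<subseteq> A n" by (auto simp: Y_def)
  have finXY: "finite X" "finite Y" using XA YA finite_A finite_subset by blast+
  have bij: "bij_betw ?\<phi> {..<?m} (A n)" by (rule bij_betw_periodic_enum[OF A_subset A_nonempty])
  have "X - Y \<subseteq> ?\<phi> ` J"
  proof
    fix x assume x: "x \<in> X - Y"
    then obtain j where j: "j < ?m" "x = ?\<phi> j" using bij XA unfolding bij_betw_def by blast
    obtain c where c: "c \<in> ?C" "pattern (Q n) (A n) w k c (?\<phi> j)" using x j by (auto simp: X_def)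
    have crange: "c i \<in> {nat \<lceil>u i * M\<rceil> + 1..nat \<lfloor>v i * M\<rfloor> - 1}" if "i \<in> {1..k}" for i
      using c(1) that unfolding tuples_in_def by blast
    have "psum c k \<le> N" unfolding psum_def N_def
    proof (rule sum_mono)
      fix i assume "i \<in> {1..k}"
      then have "c i \<le> nat \<lfloor>v i * M\<rfloor> - 1" using crange by (meson atLeastAtMost_iff)
      then show "c i \<le> nat \<lfloor>v i * M\<rfloor>" by linarith
    qed
    then have nc: "\<not> crowded (Q n) (A n) w (?\<phi> j) a" if "a \<in> {1..psum c k}" for a
      using x j that XA by (auto simp: Y_def)
    have "j \<in> J" unfolding J_def
    proof (intro CollectI conjI ballI j(1))
      fix i assume i: "i \<in> {1..k}"
      let ?sp = "spacing (Q n) (A n) ((j + i) mod ?m)"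
      note sp = spacing_of_pattern[OF A_subset A_nonempty w c1[OF c(1)] c(2) nc i]
      have S0: "S n > 0" using S_ge_1[of n] by simp
      have 1: "real (c i) - 1 < ?sp * M" "?sp * M < real (c i) + 1"
      proof -
        have "S n * (real (c i) - 1) < S n * (?sp * M)" "S n * (?sp * M) < S n * (real (c i) + 1)"
          using sp M unfolding w_def S_def[symmetric] by (simp_all add: field_simps)
        then show "real (c i) - 1 < ?sp * M" "?sp * M < real (c i) + 1" using S0 by simp_all
      qed
      have "u i * M \<le> real (nat \<lceil>u i * M\<rceil>)" by linarith
      also have "\<dots> \<le> real (c i) - 1" using crange[OF i] by auto
      finally have "u i * M < ?sp * M" using 1 by linarith
      then show "u i < ?sp" using M by simp
      have "real (c i) + 1 \<le> real (nat \<lfloor>v i * M\<rfloor>)" using crange[OF i] by auto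
      moreover have "c i + 1 \<le> nat \<lfloor>v i * M\<rfloor>" using crange[OF i] by auto
      ultimately have "real (c i) + 1 \<le> v i * M" by linarith
      then have "?sp * M < v i * M" using 1 by linarith
      then show "?sp < v i" using M by simp
    qed
    then show "x \<in> ?\<phi> ` J" using j by blast
  qed
  moreover have finJ: "finite J" unfolding J_def by simp
  ultimately have "card (X - Y) \<le> card J"
    by (meson card_image_le card_mono finite_imageI order_trans)
  moreover have "card X - card Y \<le> card (X - Y)" by (rule diff_card_le_card_Diff[OF finXY(2)])
  ultimately have "real (card X) - real (card Y) \<le> real (card J)" by linarith
  then have "real (\<Sum>c\<in>?C. card (?pat c)) - real (\<Sum>a\<in>{1..N}. card (?crd a)) \<le> real (card J)"
    using cardX cardY by linarith
  then have "(real (\<Sum>c\<in>?C. card (?pat c)) - real (\<Sum>a\<in>{1..N}. card (?crd a))) / real ?m \<le> real (card J) / real ?m"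
    by (intro divide_right_mono) auto
  then show ?thesis
    unfolding box_prob_def avg_indicator J_def[symmetric] w_def[symmetric] N_def[symmetric]
    by (simp add: diff_divide_distrib sum_divide_distrib)
qed

text \<open>There are \<open>k\<close> occupied bins and \<open>c i - 1\<close> empty ones before
  the \<open>i\<close>-th of them: the \<open>c i\<close> become independent geometric
  variables.\<close>

lemma pattern_limit:
  assumes c: "\<forall>l\<in>{1..k}. c l \<ge> 1" and M: "M > 0"
  shows "(\<lambda>n. avg n (\<lambda>x. if pattern (Q n) (A n) (S n / M) k c x then 1 else 0))
    \<longlonglongrightarrow> (\<Prod>i\<in>{1..k}. exp (- (1 / M)) ^ (c i - 1) * (1 - exp (- (1 / M))))"
proof -
  let ?T = "psum c ` {1..k}"
  let ?W = "{1..psum c k} - ?T"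
  have T: "?T \<subseteq> {1..psum c k}"
  proof
    fix a assume "a \<in> ?T"
    then obtain i where i: "i \<in> {1..k}" "a = psum c i" by blast
    have "psum c 0 < psum c i" using i psum_less[OF c, where i = 0 and j = i] by simp
    moreover have "psum c i \<le> psum c k" using i by (intro psum_mono) simp
    ultimately show "a \<in> {1..psum c k}" using i by simp
  qed
  have cT: "card ?T = k" using card_image[OF inj_on_psum[OF c]] by simp
  have "card ?W = psum c k - k" using card_Diff_subset[of ?T "{1..psum c k}"] T cT by simp
  moreover have "psum c k = (\<Sum>i\<in>{1..k}. (c i - 1) + 1)"
    unfolding psum_def
  proof (rule sum.cong[OF refl])
    fix i assume "i \<in> {1..k}"
    then have "c i \<ge> 1" using c by blast
    then show "c i = (c i - 1) + 1" by simp
  qed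
  moreover have "(\<Sum>i\<in>{1..k}. (c i - 1) + 1) - k = (\<Sum>i\<in>{1..k}. c i - 1)" unfolding sum.distrib by simp
  ultimately have cW: "card ?W = (\<Sum>i\<in>{1..k}. c i - 1)" by (simp only:)
  have "?W \<subseteq> {1..psum c k}" "?T \<inter> ?W = {}" by auto
  from occupancy_limit[OF T this M]
  have "(\<lambda>n. avg n (\<lambda>x. if pattern (Q n) (A n) (S n / M) k c x then 1 else 0))
    \<longlonglongrightarrow> exp (- (1 / M)) ^ card ?W * (1 - exp (- (1 / M))) ^ card ?T"
    unfolding pattern_def .
  then show ?thesis unfolding cW cT by (simp add: prod.distrib power_sum)
qed

lemma box_prob_nonneg: "box_prob n k u v \<ge> 0"
  by (simp add: box_prob_def)

text \<open>The mesh is fixed before \<open>n\<close> grows: \<open>M\<close> is taken so large that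
  the geometric probabilities are close to exponential ones and the crowding bound, at most
  \<open>V / (2 * M)\<close>, is small.\<close>

lemma box_prob_eventually_ge:
  assumes u: "\<And>i. i \<in> {1..k} \<Longrightarrow> 0 \<le> u i" and uv: "\<And>i. i \<in> {1..k} \<Longrightarrow> u i \<le> v i" and \<delta>: "\<delta> > 0"
  shows "eventually (\<lambda>n. box_prob n k u v \<ge> (\<Prod>i\<in>{1..k}. exp (- u i) - exp (- v i)) - \<delta>) sequentially"
proof (cases "\<exists>i\<in>{1..k}. u i = v i")
  case True
  then have z: "(\<Prod>i\<in>{1..k}. exp (- u i) - exp (- v i)) = 0" by (intro prod_zero) auto
  have "0 - \<delta> \<le> box_prob n k u v" for n using box_prob_nonneg[of n k u v] \<delta> by simp
  then show ?thesis unfolding z by (intro always_eventually allI)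
next
  case False
  then have less: "u i < v i" if "i \<in> {1..k}" for i using uv[OF that] that by fastforce
  define P where "P = (\<Prod>i\<in>{1..k}. exp (- u i) - exp (- v i))"
  define V where "V = (\<Sum>i\<in>{1..k}. v i)"
  have v0: "v i \<ge> 0" if "i \<in> {1..k}" for i using u[OF that] uv[OF that] by simp
  define p where "p m = exp (- (1 / real (Suc m)))" for m
  let ?a = "\<lambda>i m. nat \<lceil>u i * real (Suc m)\<rceil>"
  let ?b = "\<lambda>i m. nat \<lfloor>v i * real (Suc m)\<rfloor> - 1"
  have "(\<lambda>m. \<Prod>i\<in>{1..k}. p m ^ ?a i m - p m ^ ?b i m) \<longlonglongrightarrow> P"
    unfolding P_def p_def
  proof (intro tendsto_prod tendsto_diff power_exp_limit)
    fix i m assume i: "i \<in> {1..k}"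
    have "u i * real (Suc m) \<ge> 0" "v i * real (Suc m) \<ge> 0" using u[OF i] v0[OF i] by simp_all
    then show "\<bar>real (?a i m) - u i * real (Suc m)\<bar> \<le> 2" "\<bar>real (?b i m) - v i * real (Suc m)\<bar> \<le> 2"
      by linarith+
  qed
  then have e1: "eventually (\<lambda>m. (\<Prod>i\<in>{1..k}. p m ^ ?a i m - p m ^ ?b i m) > P - \<delta>/4) sequentially"
    using \<delta> by (intro order_tendstoD(1)) auto
  have "(\<lambda>m. V / 2 * (1 / real (Suc m))) \<longlonglongrightarrow> V / 2 * 0"
    using LIMSEQ_inverse_real_of_nat by (intro tendsto_mult tendsto_const) (simp add: inverse_eq_divide)
  then have e2: "eventually (\<lambda>m. V / 2 * (1 / real (Suc m)) < \<delta>/4) sequentially"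
    using \<delta> by (intro order_tendstoD(2)) auto
  \<comment> \<open>A length of 3 in units of the mesh guarantees that the range of
    \<open>c i\<close> has ordered ends after both roundings and the shift by 1, as
    \<open>geometric_sum_interval\<close> requires.\<close>
  have e3: "eventually (\<lambda>m. \<forall>i\<in>{1..k}. (v i - u i) * real (Suc m) \<ge> 3) sequentially"
  proof (rule eventually_ball_finite, simp, rule ballI)
    fix i assume i: "i \<in> {1..k}"
    obtain m0 :: nat where m0: "real m0 \<ge> 3 / (v i - u i)" using real_arch_simple by blast
    show "eventually (\<lambda>m. (v i - u i) * real (Suc m) \<ge> 3) sequentially"
      using eventually_ge_at_top[of m0]
    proof eventually_elim
      case (elim m)
      have "v i - u i \<noteq> 0" using less[OF i] by simp
      then have "3 = (v i - u i) * (3 / (v i - u i))" by (metis nonzero_mult_div_cancel_left times_divide_eq_right)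
      also have "\<dots> \<le> (v i - u i) * real (Suc m)"
        using m0 elim less[OF i] by (intro mult_left_mono) auto
      finally show ?case .
    qed
  qed
  obtain m where m: "(\<Prod>i\<in>{1..k}. p m ^ ?a i m - p m ^ ?b i m) > P - \<delta>/4"
    "V / 2 * (1 / real (Suc m)) < \<delta>/4" "\<forall>i\<in>{1..k}. (v i - u i) * real (Suc m) \<ge> 3"
    using eventually_happens[OF eventually_conj[OF e1 eventually_conj[OF e2 e3]]] by auto
  define M where "M = real (Suc m)"
  have M: "M > 0" by (simp add: M_def)
  let ?C = "tuples_in k M u v"
  define N where "N = (\<Sum>i\<in>{1..k}. nat \<lfloor>v i * M\<rfloor>)"
  have "real N \<le> V * M" unfolding N_def V_def sum_distrib_right of_nat_sum
    using v0 M by (intro sum_mono) simp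
  then have "real N / (2 * M^2) \<le> V * M / (2 * M^2)" by (intro divide_right_mono) auto
  also have "\<dots> = V / 2 * (1 / M)" using M by (simp add: power2_eq_square)
  also have "\<dots> < \<delta>/4" using m(2) unfolding M_def .
  finally have N: "real N / (2 * M^2) < \<delta>/4" .
  have "(\<lambda>n. \<Sum>c\<in>?C. avg n (\<lambda>x. if pattern (Q n) (A n) (S n / M) k c x then 1 else 0))
    \<longlonglongrightarrow> (\<Sum>c\<in>?C. \<Prod>i\<in>{1..k}. p m ^ (c i - 1) * (1 - p m))"
    unfolding p_def M_def[symmetric]
  proof (intro tendsto_sum pattern_limit M ballI)
    fix c l assume "c \<in> ?C" "l \<in> {1..k}"
    then have "c l \<in> {nat \<lceil>u l * M\<rceil> + 1..nat \<lfloor>v l * M\<rfloor> - 1}" unfolding tuples_in_def by blast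
    then show "c l \<ge> 1" by simp
  qed
  also have "(\<Sum>c\<in>?C. \<Prod>i\<in>{1..k}. p m ^ (c i - 1) * (1 - p m))
    = (\<Prod>i\<in>{1..k}. \<Sum>c\<in>{nat \<lceil>u i * M\<rceil> + 1..nat \<lfloor>v i * M\<rfloor> - 1}. p m ^ (c - 1) * (1 - p m))"
    unfolding tuples_in_def by (rule prod_sum_PiE[symmetric]) auto
  also have "\<dots> = (\<Prod>i\<in>{1..k}. p m ^ ?a i m - p m ^ ?b i m)"
  proof (rule prod.cong[OF refl])
    fix i assume i: "i \<in> {1..k}"
    have "v i * M - u i * M \<ge> 3" using m(3) i by (simp add: M_def algebra_simps)
    moreover have "u i * M \<ge> 0" using u[OF i] M by simp
    ultimately have "nat \<lceil>u i * M\<rceil> \<le> nat \<lfloor>v i * M\<rfloor> - 1" by linarith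
    then show "(\<Sum>c\<in>{nat \<lceil>u i * M\<rceil> + 1..nat \<lfloor>v i * M\<rfloor> - 1}. p m ^ (c - 1) * (1 - p m)) = p m ^ ?a i m - p m ^ ?b i m"
      unfolding M_def by (rule geometric_sum_interval)
  qed
  finally have "eventually (\<lambda>n. (\<Sum>c\<in>?C. avg n (\<lambda>x. if pattern (Q n) (A n) (S n / M) k c x then 1 else 0)) > P - \<delta>/4) sequentially"
    using m(1) by (rule order_tendstoD(1))
  moreover have "eventually (\<lambda>n. (\<Sum>a\<in>{1..N}. avg n (\<lambda>x. if crowded (Q n) (A n) (S n / M) x a then 1 else 0))
       \<le> real N / (2 * M^2) + \<delta>/4) sequentially"
    using \<delta> by (intro crowded_eventually_le M) auto
  ultimately show ?thesis
  proof eventually_elim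
    case (elim n)
    have "(\<Sum>c\<in>?C. avg n (\<lambda>x. if pattern (Q n) (A n) (S n / M) k c x then 1 else 0))
      - (\<Sum>a\<in>{1..N}. avg n (\<lambda>x. if crowded (Q n) (A n) (S n / M) x a then 1 else 0)) \<le> box_prob n k u v"
      unfolding N_def by (rule box_prob_ge[OF M u])
    then show ?case using elim N \<delta> unfolding P_def by linarith
  qed
qed

section \<open>From boxes to the joint tail distribution\<close>

lemma Prob_ge_box_prob: "box_prob n k t v \<le> Prob (Q n) (A n) k t"
  unfolding box_prob_def Prob_def by (intro divide_right_mono of_nat_mono card_mono) auto

text \<open>\<open>X\<close> records which gaps stay below their thresholds. A nonempty
  \<open>X\<close> contradicts the event of \<open>Prob\<close>, and different \<open>X\<close>
  contradict each other. The empty set is left out because its box lies inside that event.\<close>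

lemma Prob_le_box_prob:
  assumes "\<And>i. i \<in> {1..k} \<Longrightarrow> t i \<le> R"
  shows "Prob (Q n) (A n) k t + (\<Sum>X\<in>Pow {1..k} - {{}}.
    box_prob n k (\<lambda>i. if i \<in> X then 0 else t i) (\<lambda>i. if i \<in> X then t i else R)) \<le> 1"
proof -
  let ?m = "card (A n)"
  let ?sp = "\<lambda>j i. spacing (Q n) (A n) ((j + i) mod ?m)"
  define F where "F = {j. j < ?m \<and> (\<forall>i\<in>{1..k}. ?sp j i > t i)}"
  define B where "B X = {j. j < ?m \<and> (\<forall>i\<in>{1..k}. (if i \<in> X then 0 else t i) < ?sp j i
      \<and> ?sp j i < (if i \<in> X then t i else R))}" for X
  let ?I = "Pow {1..k} - {{}}"
  have fin: "finite F" "\<And>X. finite (B X)" by (auto simp: F_def B_def)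
  have BX: "i \<in> X \<longleftrightarrow> ?sp j i < t i" if "j \<in> B X" "i \<in> {1..k}" for i j X
  proof -
    have "(if i \<in> X then 0 else t i) < ?sp j i" "?sp j i < (if i \<in> X then t i else R)"
      using that by (auto simp: B_def)
    then show ?thesis by (auto split: if_splits)
  qed
  have "card (\<Union>X\<in>?I. B X) = (\<Sum>X\<in>?I. card (B X))"
  proof (rule card_UN_disjoint)
    show "\<forall>X\<in>?I. \<forall>Y\<in>?I. X \<noteq> Y \<longrightarrow> B X \<inter> B Y = {}"
    proof (intro ballI impI)
      fix X Y assume XY: "X \<in> ?I" "Y \<in> ?I" "X \<noteq> Y"
      show "B X \<inter> B Y = {}"
      proof (rule ccontr)
        assume "B X \<inter> B Y \<noteq> {}"
        then obtain j where "j \<in> B X" "j \<in> B Y" by blast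
        then have "i \<in> X \<longleftrightarrow> i \<in> Y" if "i \<in> {1..k}" for i using BX that by blast
        then show False using XY by blast
      qed
    qed
  qed (use fin in auto)
  moreover have "F \<inter> (\<Union>X\<in>?I. B X) = {}"
  proof (rule ccontr)
    assume "F \<inter> (\<Union>X\<in>?I. B X) \<noteq> {}"
    then obtain j X where jX: "j \<in> F" "X \<in> ?I" "j \<in> B X" by blast
    then obtain i where i: "i \<in> X" "i \<in> {1..k}" by blast
    have "?sp j i < t i" using BX[OF jX(3) i(2)] i(1) by simp
    moreover have "?sp j i > t i" using jX(1) i(2) by (simp add: F_def)
    ultimately show False by simp
  qed
  ultimately have "card F + (\<Sum>X\<in>?I. card (B X)) = card (F \<union> (\<Union>X\<in>?I. B X))"
    using fin by (subst card_Un_disjoint) auto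
  also have "\<dots> \<le> card {..<?m}" by (rule card_mono) (auto simp: F_def B_def)
  finally have "card F + (\<Sum>X\<in>?I. card (B X)) \<le> ?m" by simp
  then have "real (card F) + (\<Sum>X\<in>?I. real (card (B X))) \<le> real ?m"
    by (simp flip: of_nat_sum of_nat_add)
  then have "(real (card F) + (\<Sum>X\<in>?I. real (card (B X)))) / real ?m \<le> real ?m / real ?m"
    by (intro divide_right_mono) auto
  also have "\<dots> = 1" using card_A[of n] by (intro divide_self) (simp only: of_nat_eq_0_iff)
  finally show ?thesis
    unfolding Prob_def box_prob_def F_def[symmetric] B_def[symmetric]
    by (simp add: add_divide_distrib sum_divide_distrib)
qed

text \<open>The box of the empty \<open>X\<close> bounds \<open>Prob\<close> from below. All boxes
  together have limiting mass \<open>(1 - exp (- R)) ^ k\<close>, close to 1 for large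
  \<open>R\<close>, so lower bounds for the remaining boxes bound \<open>Prob\<close> from
  above.\<close>

lemma Prob_limit:
  assumes t: "\<And>i. i \<in> {1..k} \<Longrightarrow> t i \<ge> 0"
  shows "(\<lambda>n. Prob (Q n) (A n) k t) \<longlonglongrightarrow> exp (- (\<Sum>i\<in>{1..k}. t i))"
proof (rule LIMSEQ_I)
  fix \<delta> :: real assume \<delta>: "\<delta> > 0"
  let ?I = "Pow {1..k} - {{}}"
  define E where "E = exp (- (\<Sum>i\<in>{1..k}. t i))"
  have E: "E = (\<Prod>i\<in>{1..k}. exp (- t i) - 0)" by (simp add: E_def exp_sum flip: sum_negf)
  have r0: "(\<lambda>r. exp (- real r)) \<longlonglongrightarrow> 0"
    by (intro filterlim_compose[OF exp_at_bot] filterlim_compose[OF filterlim_uminus_at_bot_at_top]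
        filterlim_real_sequentially)
  have l1: "(\<lambda>r. \<Prod>i\<in>{1..k}. exp (- t i) - exp (- real r)) \<longlonglongrightarrow> E"
    unfolding E by (intro tendsto_prod tendsto_diff tendsto_const r0)
  have "(\<lambda>r. \<Prod>i\<in>{1..k}. 1 - exp (- real r)) \<longlonglongrightarrow> (\<Prod>i\<in>{1..k}. 1 - 0)"
    by (intro tendsto_prod tendsto_diff tendsto_const r0)
  then have l2: "(\<lambda>r. \<Prod>i\<in>{1..k}. 1 - exp (- real r)) \<longlonglongrightarrow> 1" by simp
  have e1: "eventually (\<lambda>r. (\<Prod>i\<in>{1..k}. exp (- t i) - exp (- real r)) > E - \<delta>/4) sequentially"
    using order_tendstoD(1)[OF l1] \<delta> by simp
  have e1': "eventually (\<lambda>r. (\<Prod>i\<in>{1..k}. exp (- t i) - exp (- real r)) < E + \<delta>/4) sequentially"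
    using order_tendstoD(2)[OF l1] \<delta> by simp
  have e2: "eventually (\<lambda>r. (\<Prod>i\<in>{1..k}. 1 - exp (- real r)) > 1 - \<delta>/4) sequentially"
    using order_tendstoD(1)[OF l2] \<delta> by simp
  have e3: "eventually (\<lambda>r. \<forall>i\<in>{1..k}. t i \<le> real r) sequentially"
    by (rule eventually_ball_finite) (use filterlim_real_sequentially in \<open>auto simp: filterlim_at_top\<close>)
  obtain r where "(\<Prod>i\<in>{1..k}. exp (- t i) - exp (- real r)) > E - \<delta>/4"
    "(\<Prod>i\<in>{1..k}. exp (- t i) - exp (- real r)) < E + \<delta>/4"
    "(\<Prod>i\<in>{1..k}. 1 - exp (- real r)) > 1 - \<delta>/4" "\<forall>i\<in>{1..k}. t i \<le> real r"
    using eventually_happens[OF eventually_conj[OF e1 eventually_conj[OF e1' eventually_conj[OF e2 e3]]]] by auto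
  then obtain R where R: "(\<Prod>i\<in>{1..k}. exp (- t i) - exp (- R)) > E - \<delta>/4"
    "(\<Prod>i\<in>{1..k}. exp (- t i) - exp (- R)) < E + \<delta>/4"
    "(\<Prod>i\<in>{1..k}. 1 - exp (- R)) > 1 - \<delta>/4" "\<And>i. i \<in> {1..k} \<Longrightarrow> t i \<le> R" by blast
  have lower: "eventually (\<lambda>n. box_prob n k t (\<lambda>_. R) \<ge> (\<Prod>i\<in>{1..k}. exp (- t i) - exp (- R)) - \<delta>/4) sequentially"
    using \<delta> by (intro box_prob_eventually_ge t R(4)) auto
  define u where "u X i = (if i \<in> X then 0 else t i)" for X and i :: nat
  define v where "v X i = (if i \<in> X then t i else R)" for X and i :: nat
  \<comment> \<open>The error allowance \<open>\<delta> / 4\<close> is shared by fewer than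
    \<open>2 ^ k\<close> boxes.\<close>
  define \<delta>' where "\<delta>' = \<delta> / (4 * 2 ^ k)"
  have \<delta>': "\<delta>' > 0" using \<delta> by (simp add: \<delta>'_def)
  have "eventually (\<lambda>n. \<forall>X\<in>?I. box_prob n k (u X) (v X) \<ge> (\<Prod>i\<in>{1..k}. exp (- u X i) - exp (- v X i)) - \<delta>') sequentially"
    by (intro eventually_ball_finite ballI box_prob_eventually_ge \<delta>') (use t R(4) in \<open>auto simp: u_def v_def\<close>)
  then have upper: "eventually (\<lambda>n. (\<Sum>X\<in>?I. box_prob n k (u X) (v X))
      \<ge> (\<Prod>i\<in>{1..k}. 1 - exp (- R)) - (\<Prod>i\<in>{1..k}. exp (- t i) - exp (- R)) - \<delta>/4) sequentially"
  proof eventually_elim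
    case (elim n)
    \<comment> \<open>Cutting each interval from 0 to \<open>R\<close> at \<open>t i\<close> and
      multiplying out produces one term per box.\<close>
    have "(\<Prod>i\<in>{1..k}. 1 - exp (- R)) = (\<Prod>i\<in>{1..k}. (1 - exp (- t i)) + (exp (- t i) - exp (- R)))" by simp
    also have "\<dots> = (\<Sum>X\<in>Pow {1..k}. (\<Prod>i\<in>X. 1 - exp (- t i)) * (\<Prod>i\<in>{1..k} - X. exp (- t i) - exp (- R)))"
      by (rule prod_add) simp
    also have "\<dots> = (\<Sum>X\<in>Pow {1..k}. \<Prod>i\<in>{1..k}. exp (- u X i) - exp (- v X i))"
    proof (rule sum.cong[OF refl])
      fix X assume X: "X \<in> Pow {1..k}"
      have "(\<Prod>i\<in>{1..k}. exp (- u X i) - exp (- v X i))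
        = (\<Prod>i\<in>{1..k} - X. exp (- u X i) - exp (- v X i)) * (\<Prod>i\<in>X. exp (- u X i) - exp (- v X i))"
        by (rule prod.subset_diff) (use X in auto)
      then show "(\<Prod>i\<in>X. 1 - exp (- t i)) * (\<Prod>i\<in>{1..k} - X. exp (- t i) - exp (- R))
        = (\<Prod>i\<in>{1..k}. exp (- u X i) - exp (- v X i))" by (simp add: u_def v_def mult.commute)
    qed
    also have "\<dots> = (\<Prod>i\<in>{1..k}. exp (- t i) - exp (- R)) + (\<Sum>X\<in>?I. \<Prod>i\<in>{1..k}. exp (- u X i) - exp (- v X i))"
      by (subst sum.remove[of _ "{}"]) (auto simp: u_def v_def)
    finally have 1: "(\<Sum>X\<in>?I. \<Prod>i\<in>{1..k}. exp (- u X i) - exp (- v X i))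
      = (\<Prod>i\<in>{1..k}. 1 - exp (- R)) - (\<Prod>i\<in>{1..k}. exp (- t i) - exp (- R))" by simp
    have "card ?I \<le> card (Pow {1..k})" by (rule card_mono) auto
    also have "\<dots> = 2 ^ k" by (simp add: card_Pow)
    finally have "real (card ?I) \<le> real (2 ^ k)" by (simp only: of_nat_le_iff)
    then have "real (card ?I) * \<delta>' \<le> 2 ^ k * \<delta>'" using \<delta>' by (intro mult_right_mono) auto
    also have "\<dots> = \<delta> / 4" by (simp add: \<delta>'_def)
    finally have 2: "real (card ?I) * \<delta>' \<le> \<delta> / 4" .
    have "(\<Sum>X\<in>?I. (\<Prod>i\<in>{1..k}. exp (- u X i) - exp (- v X i)) - \<delta>') \<le> (\<Sum>X\<in>?I. box_prob n k (u X) (v X))"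
      by (rule sum_mono) (use elim in blast)
    then show ?case using 1 2 by (simp add: sum_subtractf)
  qed
  have "eventually (\<lambda>n. norm (Prob (Q n) (A n) k t - E) < \<delta>) sequentially"
    using lower upper
  proof eventually_elim
    case (elim n)
    have "Prob (Q n) (A n) k t \<le> 1 - (\<Sum>X\<in>?I. box_prob n k (u X) (v X))"
      using Prob_le_box_prob[of k t R n] R(4) unfolding u_def[abs_def] v_def[abs_def] by simp
    moreover have "box_prob n k t (\<lambda>_. R) \<le> Prob (Q n) (A n) k t" by (rule Prob_ge_box_prob)
    ultimately have "\<bar>Prob (Q n) (A n) k t - E\<bar> < \<delta>" using elim R(1,2,3) \<delta> by linarith
    then show ?case by simp
  qed
  then show "\<exists>no. \<forall>n\<ge>no. norm (Prob (Q n) (A n) k t - exp (- (\<Sum>i\<in>{1..k}. t i))) < \<delta>"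
    by (simp add: eventually_sequentially E_def)
qed

end

theorem theorem1p1:
  fixes \<Omega> :: "nat \<Rightarrow> int set" and \<epsilon> :: real
  assumes subset: "\<And>p. prime p \<Longrightarrow> \<Omega> p \<subseteq> {0..<int p}"
    and eps: "\<epsilon> > 0"
    and tuples: "\<And>k::nat. k \<ge> 2 \<Longrightarrow> \<exists>C::real. \<forall>p. prime p \<longrightarrow>
          (\<forall>h::int list. length h = k - 1 \<longrightarrow> distinct (map (\<lambda>a. a mod int p) (0 # h)) \<longrightarrow>
             (\<exists>E::real. real (num_tuples p h (\<Omega> p)) = density p (\<Omega> p) ^ k * real p * (1 + E) \<and>
                \<bar>E\<bar> \<le> C * (1 - density p (\<Omega> p)) * real p powr (-\<epsilon>)))"
    and nonempty: "\<And>p. prime p \<Longrightarrow> \<Omega> p \<noteq> {}"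
    and growth: "((\<lambda>p. ln (inv_density p (\<Omega> p)) / ln (real p)) \<longlongrightarrow> 0)
          (inf at_top (principal {p::nat. prime p}))"
  shows "spacings_become_poisson (crt_set \<Omega>)"
  unfolding spacings_become_poisson_def
proof (intro allI impI)
  fix k :: nat and t :: "nat \<Rightarrow> real" and Q :: "nat \<Rightarrow> nat"
  assume t: "\<forall>i\<in>{1..k}. t i \<ge> 0" and Q: "\<forall>n. squarefree (Q n)"
    and lim: "filterlim (\<lambda>n. inv_density (Q n) (crt_set \<Omega> (Q n))) at_top sequentially"
  interpret sieved_residues_seq \<Omega> \<epsilon> Q
    using subset eps tuples nonempty growth Q lim by unfold_locales blast+
  show "(\<lambda>n. Prob (Q n) (crt_set \<Omega> (Q n)) k t) \<longlonglongrightarrow> exp (- (\<Sum>i=1..k. t i))"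
    using Prob_limit[of k t] t by (simp add: A_def)
qed

end
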